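(* Suppose that $\mu\in\mathbb{C}$ is an isolated eigenvalue of $M$. Suppose also that $m_n(\lambda)\to m(\lambda)$ as $n\to\infty$ uniformly on any compact annulus surrounding $\mu$. Then there exists a sequence $(\lambda^{(n)})$, in which $\lambda^{(n)}$ lies in the spectrum of $M_n$, such that $\lim_{n\to\infty}\lambda^{(n)}=\mu$.
   Context: Setting. $-\infty<a<b\le\infty$; $w>0$ and $p\ne0$ a.e. on $[a,b)$; $p,q$ are complex-valued; $w,1/p,q\in L^1_{loc}[a,b)$; and $Q=\overline{\mathrm{co}}\{q(x)/w(x)+rp(x):x\in[a,b),\,0<r<\infty\}\ne\mathbb{C}$ (closed convex hull). Put $\mathcal{M}[y]=\frac1w[-(py')'+qy]$. The endpoint $a$ is regular; $b$ is singular, i.e. $b=+\infty$ or $\int_a^b(w+1/|p|+|q|)\,dx=\infty$. "The differential equation" is $\mathcal{M}[y]=\lambda y$, and $L^2_w[a,b)$ is the space of $f$ with $\int_a^b|f|^2w\,dx<\infty$. Admissible pairs. $S$ is the set of pairs $(\eta,K)$ arising as follows: for some $\lambda_0\in\mathbb{C}\setminus Q$, $K$ is the point of $Q$ nearest to $\lambda_0$ and $\eta$ is a real angle such that $\Re[(rp(x)+q(x)/w(x)-K)e^{i\eta}]\ge0$ for all $x\in[a,b)$, $r\in(0,\infty)$, and $\Re[(\lambda_0-K)e^{i\eta}]<0$. $\Lambda_{\eta,K}=\{\lambda\in\mathbb{C}:\Re[(\lambda-K)e^{i\eta}]\le0\}$. A (possibly complex) number $\alpha$ is fixed; $S(\alpha)$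 is the set of $(\eta,K)\in S$ with $\Re[e^{i\eta}\cos\alpha\,\overline{\sin\alpha}]\le0$, assumed nonempty, and $(\eta,K)\in S(\alpha)$ is fixed. Solutions. $\theta(\cdot,\lambda),\phi(\cdot,\lambda)$ are the solutions with $\phi(a,\lambda)=\sin\alpha$, $p\phi'(a,\lambda)=-\cos\alpha$, $\theta(a,\lambda)=\cos\alpha$, $p\theta'(a,\lambda)=\sin\alpha$. $[f,g]=p(fg'-f'g)$. Sims classification (known to be independent of $\lambda\in\Lambda_{\eta,K}$). Consider the condition ( * ): $\int_a^b\Re[e^{i\eta}\{p|y'|^2+(q-Kw)|y|^2\}]dx+\int_a^b|y|^2w\,dx<\infty$. For $\lambda\in\Lambda_{\eta,K}$ exactly one of the following holds. Case I: there is a unique (up to constant multiples) nontrivial solution satisfying ( * ), and it is the only one in $L^2_w[a,b)$. Case II: there is a unique (up to constant multiples) nontrivial solution satisfying ( * ), but all solutions lie in $L^2_w[a,b)$. Case III: all solutions lie in $L^2_w[a,b)$ and satisfy ( * ). Any of the three cases is allowed here. Operator $M$ and function $m$. $M$ is the realization $My=\mathcal{M}[y]$ in $L^2_w[a,b)$, with domain the $y\in L^2_w[a,b)$ such that $y,py'$ are locally absolutely continuous on $[a,b)$, $\mathcal{M}[y]\in L^2_w[a,b)$, $(\cos\alpha)y(a)+(\sin\alpha)py'(a)=0$, and, in Cases II and III, $y$ satisfies an additional boundary condition at $b$, which can be expressed as $[y,\psi(\cdot,\lambda')](b)=0$, where $\lambda'\in\Lambda_{\eta,K}$ is fixed and $\psi(\cdot,\lambda')=\theta(\cdot,\lambda')+m(\lambda')\phi(\cdot,\lambda')$.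 Here $m$ is the Titchmarsh–Weyl function, i.e. the unique function such that $\theta(\cdot,\lambda)+m(\lambda)\phi(\cdot,\lambda)$ lies in $L^2_w[a,b)$ (Case I), respectively lies in $L^2_w[a,b)$ and satisfies the boundary condition at $b$ (Cases II and III); in Cases II and III the choice of $m$ corresponds one-to-one to the choice of boundary condition at $b$. It is known that in Cases II and III the poles of $m$ of order $s$ are exactly the eigenvalues of $M$ of algebraic multiplicity $s$. In Case I it is known that $m$ has a meromorphic extension to $\mathbb{C}\setminus Q_b(\alpha)$ and that a point $\lambda\notin Q_b(\alpha)$ is a pole of $m$ if and only if it is an eigenvalue of $M$; here $Q_b(\alpha)=\bigcap_{c\in(a,b)}Q_c(\alpha)$ and $Q_c(\alpha)$ is the set $\bigcap_{(\eta,K)\in S(\alpha)}(\mathbb{C}\setminus\Lambda_{\eta,K})$ formed with the interval $[c,b)$ in place of $[a,b)$. Truncations. $b_n\nearrow b$ is a sequence in $(a,b)$. $M_n$ is the regular operator $M_ny=\mathcal{M}[y]$ on $[a,b_n]$ with boundary conditions $(\cos\alpha)y(a)+(\sin\alpha)py'(a)=0$ and $y(b_n)\cos\beta_n+py'(b_n)\sin\beta_n=0$, where the $\beta_n$ are given (complex) numbers. $m_n(\lambda)$ is the number such that $\theta+m_n(\lambda)\phi$ satisfies the boundary condition at $b_n$, i.e. $m_n(\lambda)=-\dfrac{\theta(b_n,\lambda)\cot\beta_n+p\theta'(b_n,\lambda)}{\phi(b_n,\lambda)\cot\beta_n+p\phi'(b_n,\lambda)}$. *)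

theory Defs
  imports "HOL-Analysis.Analysis"
begin

section \<open>Function spaces\<close>

definition half_open :: "real \<Rightarrow> ereal \<Rightarrow> real set" where
  "half_open a b = {x. a \<le> x \<and> ereal x < b}"

definition locally_integrable :: "real set \<Rightarrow> (real \<Rightarrow> 'a::{banach, second_countable_topology}) \<Rightarrow> bool" where
  "locally_integrable I f \<longleftrightarrow> (\<forall>c d. {c..d} \<subseteq> I \<longrightarrow> set_integrable lebesgue {c..d} f)"

definition abs_continuous_on :: "real set \<Rightarrow> (real \<Rightarrow> 'a::real_normed_vector) \<Rightarrow> bool" where
  "abs_continuous_on S f \<longleftrightarrow>
     (\<forall>e>0. \<exists>d>0. \<forall>\<D> T. \<D> division_of T \<and> T \<subseteq> S \<and> (\<Sum>J\<in>\<D>. measure lborel J) < d \<longrightarrow>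
        (\<Sum>J\<in>\<D>. norm (f (Sup J) - f (Inf J))) < e)"

definition locally_abs_continuous :: "real set \<Rightarrow> (real \<Rightarrow> 'a::real_normed_vector) \<Rightarrow> bool" where
  "locally_abs_continuous I f \<longleftrightarrow> (\<forall>c d. {c..d} \<subseteq> I \<longrightarrow> abs_continuous_on {c..d} f)"

text \<open>Elements of the weighted space are functions, not classes; identification almost everywhere
  is made explicit wherever it matters.\<close>

definition L2w :: "real set \<Rightarrow> (real \<Rightarrow> real) \<Rightarrow> (real \<Rightarrow> complex) set" where
  "L2w I w = {f. set_borel_measurable lebesgue I f \<and>
                 set_integrable lebesgue I (\<lambda>x. (cmod (f x))\<^sup>2 * w x)}"

definition L2w_norm :: "real set \<Rightarrow> (real \<Rightarrow> real) \<Rightarrow> (real \<Rightarrow> complex) \<Rightarrow> real" where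
  "L2w_norm I w f = sqrt (set_lebesgue_integral lebesgue I (\<lambda>x. (cmod (f x))\<^sup>2 * w x))"

section \<open>The differential expression\<close>

text \<open>The quasi-derivative \<open>u = p y'\<close> is the (unique) locally absolutely continuous function that
  agrees almost everywhere with \<open>p y'\<close>; only through it do values such as \<open>p y'(a)\<close> make sense.
  The functions \<open>y\<close> below are therefore accompanied by their quasi-derivatives \<open>u\<close>.\<close>

definition quasi_derivative ::
  "(real \<Rightarrow> complex) \<Rightarrow> real set \<Rightarrow> (real \<Rightarrow> complex) \<Rightarrow> (real \<Rightarrow> complex) \<Rightarrow> bool" where
  "quasi_derivative p I y u \<longleftrightarrow> locally_abs_continuous I y \<and> locally_abs_continuous I u \<and>
     (AE x in lebesgue. x \<in> I \<longrightarrow>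
        y differentiable (at x) \<and> u x = p x * vector_derivative y (at x))"

text \<open>\<open>sl_expression w p q I y u f\<close>: \<open>u\<close> is the quasi-derivative of \<open>y\<close>, and
  \<open>f = (-(p y')' + q y) / w\<close> almost everywhere on \<open>I\<close>.\<close>

definition sl_expression ::
  "(real \<Rightarrow> real) \<Rightarrow> (real \<Rightarrow> complex) \<Rightarrow> (real \<Rightarrow> complex) \<Rightarrow> real set \<Rightarrow>
   (real \<Rightarrow> complex) \<Rightarrow> (real \<Rightarrow> complex) \<Rightarrow> (real \<Rightarrow> complex) \<Rightarrow> bool" where
  "sl_expression w p q I y u f \<longleftrightarrow> quasi_derivative p I y u \<and>
     (AE x in lebesgue. x \<in> I \<longrightarrow>
        u differentiable (at x) \<and>
        f x = (- vector_derivative u (at x) + q x * y x) / complex_of_real (w x))"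

definition sl_solution ::
  "(real \<Rightarrow> real) \<Rightarrow> (real \<Rightarrow> complex) \<Rightarrow> (real \<Rightarrow> complex) \<Rightarrow> real set \<Rightarrow> complex \<Rightarrow>
   (real \<Rightarrow> complex) \<Rightarrow> (real \<Rightarrow> complex) \<Rightarrow> bool" where
  "sl_solution w p q I l y u \<longleftrightarrow> sl_expression w p q I y u (\<lambda>x. l * y x)"

text \<open>The bracket \<open>[f,g] = p (f g' - f' g)\<close>, with \<open>f1 = p f'\<close> and \<open>g1 = p g'\<close>.\<close>

definition sl_bracket ::
  "(real \<Rightarrow> complex) \<Rightarrow> (real \<Rightarrow> complex) \<Rightarrow> (real \<Rightarrow> complex) \<Rightarrow> (real \<Rightarrow> complex) \<Rightarrow> real \<Rightarrow> complex" where
  "sl_bracket f f1 g g1 x = f x * g1 x - f1 x * g x"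

definition vanishes_at_end :: "ereal \<Rightarrow> (real \<Rightarrow> complex) \<Rightarrow> bool" where
  "vanishes_at_end b f \<longleftrightarrow> ((f \<circ> real_of_ereal) \<longlongrightarrow> 0) (at_left b)"

section \<open>Admissible pairs\<close>

text \<open>Since \<open>w > 0\<close> holds only almost everywhere, points at which \<open>q / w\<close> is undefined
  (\<open>w x = 0\<close>) are left out.\<close>

definition range_hull ::
  "real set \<Rightarrow> (real \<Rightarrow> real) \<Rightarrow> (real \<Rightarrow> complex) \<Rightarrow> (real \<Rightarrow> complex) \<Rightarrow> complex set" where
  "range_hull I w p q =
     closure (convex hull
       {q x / complex_of_real (w x) + complex_of_real r * p x | x r. x \<in> I \<and> w x \<noteq> 0 \<and> 0 < r})"

definition admissible_pairs ::
  "real set \<Rightarrow> (real \<Rightarrow> real) \<Rightarrow> (real \<Rightarrow> complex) \<Rightarrow> (real \<Rightarrow> complex) \<Rightarrow> (real \<times> complex) set" where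
  "admissible_pairs I w p q = {(\<eta>, K). \<exists>l0. l0 \<notin> range_hull I w p q \<and>
     K \<in> range_hull I w p q \<and> (\<forall>z\<in>range_hull I w p q. dist l0 K \<le> dist l0 z) \<and>
     (\<forall>x\<in>I. \<forall>r>0. w x \<noteq> 0 \<longrightarrow>
        0 \<le> Re ((complex_of_real r * p x + q x / complex_of_real (w x) - K) * cis \<eta>)) \<and>
     Re ((l0 - K) * cis \<eta>) < 0}"

definition admissible_pairs_bc ::
  "real set \<Rightarrow> (real \<Rightarrow> real) \<Rightarrow> (real \<Rightarrow> complex) \<Rightarrow> (real \<Rightarrow> complex) \<Rightarrow> complex \<Rightarrow>
   (real \<times> complex) set" where
  "admissible_pairs_bc I w p q \<alpha> =
     {(\<eta>, K) \<in> admissible_pairs I w p q. Re (cis \<eta> * cos \<alpha> * cnj (sin \<alpha>)) \<le> 0}"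

definition Lambda_plane :: "real \<Rightarrow> complex \<Rightarrow> complex set" where
  "Lambda_plane \<eta> K = {l. Re ((l - K) * cis \<eta>) \<le> 0}"

section \<open>The Sims classification\<close>

text \<open>For an admissible pair both integrands are nonnegative almost everywhere, so finiteness of
  the integrals is integrability.\<close>

definition sims_condition ::
  "real set \<Rightarrow> (real \<Rightarrow> real) \<Rightarrow> (real \<Rightarrow> complex) \<Rightarrow> (real \<Rightarrow> complex) \<Rightarrow> real \<Rightarrow> complex \<Rightarrow>
   (real \<Rightarrow> complex) \<Rightarrow> bool" where
  "sims_condition I w p q \<eta> K y \<longleftrightarrow>
     set_integrable lebesgue I
       (\<lambda>x. Re (cis \<eta> * (p x * complex_of_real ((cmod (vector_derivative y (at x)))\<^sup>2)
              + (q x - K * complex_of_real (w x)) * complex_of_real ((cmod (y x))\<^sup>2)))) \<and>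
     set_integrable lebesgue I (\<lambda>x. (cmod (y x))\<^sup>2 * w x)"

definition all_solutions ::
  "real set \<Rightarrow> (real \<Rightarrow> real) \<Rightarrow> (real \<Rightarrow> complex) \<Rightarrow> (real \<Rightarrow> complex) \<Rightarrow> complex \<Rightarrow>
   (real \<Rightarrow> complex) set" where
  "all_solutions I w p q l = {y. \<exists>u. sl_solution w p q I l y u}"

definition spans_solutions ::
  "real set \<Rightarrow> (real \<Rightarrow> real) \<Rightarrow> (real \<Rightarrow> complex) \<Rightarrow> (real \<Rightarrow> complex) \<Rightarrow> complex \<Rightarrow>
   (real \<Rightarrow> complex) \<Rightarrow> ((real \<Rightarrow> complex) \<Rightarrow> bool) \<Rightarrow> bool" where
  "spans_solutions I w p q l y P \<longleftrightarrow>
     y \<in> all_solutions I w p q l \<and> (\<exists>x\<in>I. y x \<noteq> 0) \<and> P y \<and>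
     (\<forall>z\<in>all_solutions I w p q l. P z \<longrightarrow> (\<exists>c. \<forall>x\<in>I. z x = c * y x))"

definition sims_case1 ::
  "real set \<Rightarrow> (real \<Rightarrow> real) \<Rightarrow> (real \<Rightarrow> complex) \<Rightarrow> (real \<Rightarrow> complex) \<Rightarrow> real \<Rightarrow> complex \<Rightarrow> bool" where
  "sims_case1 I w p q \<eta> K \<longleftrightarrow>
     (\<forall>l\<in>Lambda_plane \<eta> K. \<exists>y. spans_solutions I w p q l y (sims_condition I w p q \<eta> K) \<and>
                               spans_solutions I w p q l y (\<lambda>z. z \<in> L2w I w))"

definition sims_case2 ::
  "real set \<Rightarrow> (real \<Rightarrow> real) \<Rightarrow> (real \<Rightarrow> complex) \<Rightarrow> (real \<Rightarrow> complex) \<Rightarrow> real \<Rightarrow> complex \<Rightarrow> bool" where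
  "sims_case2 I w p q \<eta> K \<longleftrightarrow>
     (\<forall>l\<in>Lambda_plane \<eta> K. (\<exists>y. spans_solutions I w p q l y (sims_condition I w p q \<eta> K)) \<and>
                               all_solutions I w p q l \<subseteq> L2w I w)"

definition sims_case3 ::
  "real set \<Rightarrow> (real \<Rightarrow> real) \<Rightarrow> (real \<Rightarrow> complex) \<Rightarrow> (real \<Rightarrow> complex) \<Rightarrow> real \<Rightarrow> complex \<Rightarrow> bool" where
  "sims_case3 I w p q \<eta> K \<longleftrightarrow>
     (\<forall>l\<in>Lambda_plane \<eta> K. \<forall>y\<in>all_solutions I w p q l.
        y \<in> L2w I w \<and> sims_condition I w p q \<eta> K y)"

section \<open>Operators and spectra\<close>

text \<open>Operators in the weighted space are given by their graphs: \<open>T y f\<close> means that \<open>y\<close> is in the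
  domain and \<open>f\<close> represents its image. The estimate in \<open>resolvent_set\<close> says at once that \<open>T - l\<close> is
  injective and that its inverse is bounded.\<close>

type_synonym op_graph = "(real \<Rightarrow> complex) \<Rightarrow> (real \<Rightarrow> complex) \<Rightarrow> bool"

definition resolvent_set :: "real set \<Rightarrow> (real \<Rightarrow> real) \<Rightarrow> op_graph \<Rightarrow> complex set" where
  "resolvent_set I w T = {l.
     (\<forall>g\<in>L2w I w. \<exists>y f. T y f \<and> (AE x in lebesgue. x \<in> I \<longrightarrow> f x - l * y x = g x)) \<and>
     (\<exists>C. \<forall>y f. T y f \<longrightarrow> L2w_norm I w y \<le> C * L2w_norm I w (\<lambda>x. f x - l * y x))}"

definition op_spectrum :: "real set \<Rightarrow> (real \<Rightarrow> real) \<Rightarrow> op_graph \<Rightarrow> complex set" where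
  "op_spectrum I w T = - resolvent_set I w T"

definition op_eigenvalue :: "real set \<Rightarrow> (real \<Rightarrow> real) \<Rightarrow> op_graph \<Rightarrow> complex \<Rightarrow> bool" where
  "op_eigenvalue I w T l \<longleftrightarrow>
     (\<exists>y f. T y f \<and> L2w_norm I w y \<noteq> 0 \<and> (AE x in lebesgue. x \<in> I \<longrightarrow> f x = l * y x))"

definition isolated_eigenvalue :: "real set \<Rightarrow> (real \<Rightarrow> real) \<Rightarrow> op_graph \<Rightarrow> complex \<Rightarrow> bool" where
  "isolated_eigenvalue I w T l \<longleftrightarrow> op_eigenvalue I w T l \<and> l isolated_in op_spectrum I w T"

text \<open>The singular operator on \<open>[a, b)\<close>; \<open>psi\<close>, with quasi-derivative \<open>psi1\<close>, is the function that
  fixes the boundary condition at \<open>b\<close> in Cases II and III.\<close>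

definition singular_op ::
  "real \<Rightarrow> ereal \<Rightarrow> (real \<Rightarrow> real) \<Rightarrow> (real \<Rightarrow> complex) \<Rightarrow> (real \<Rightarrow> complex) \<Rightarrow> complex \<Rightarrow>
   real \<Rightarrow> complex \<Rightarrow> (real \<Rightarrow> complex) \<Rightarrow> (real \<Rightarrow> complex) \<Rightarrow> op_graph" where
  "singular_op a b w p q \<alpha> \<eta> K psi psi1 y f \<longleftrightarrow>
     y \<in> L2w (half_open a b) w \<and> f \<in> L2w (half_open a b) w \<and>
     (\<exists>u. sl_expression w p q (half_open a b) y u f \<and>
          cos \<alpha> * y a + sin \<alpha> * u a = 0 \<and>
          (sims_case2 (half_open a b) w p q \<eta> K \<or> sims_case3 (half_open a b) w p q \<eta> K \<longrightarrow>
             vanishes_at_end b (sl_bracket y u psi psi1)))"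

definition regular_op ::
  "real \<Rightarrow> real \<Rightarrow> (real \<Rightarrow> real) \<Rightarrow> (real \<Rightarrow> complex) \<Rightarrow> (real \<Rightarrow> complex) \<Rightarrow> complex \<Rightarrow> complex \<Rightarrow>
   op_graph" where
  "regular_op a c w p q \<alpha> \<beta> y f \<longleftrightarrow>
     y \<in> L2w {a..c} w \<and> f \<in> L2w {a..c} w \<and>
     (\<exists>u. sl_expression w p q {a..c} y u f \<and>
          cos \<alpha> * y a + sin \<alpha> * u a = 0 \<and>
          y c * cos \<beta> + u c * sin \<beta> = 0)"

section \<open>Titchmarsh--Weyl functions\<close>

text \<open>\<open>z\<close> is a Weyl number at \<open>l\<close> if \<open>\<theta>(\<cdot>,l) + z \<phi>(\<cdot>,l)\<close> is square integrable and, in Cases II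
  and III, satisfies the boundary condition at \<open>b\<close>. The function \<open>m\<close> takes the unique such value
  wherever there is one; elsewhere (for instance at its poles) it is unconstrained.\<close>

definition weyl_number ::
  "real \<Rightarrow> ereal \<Rightarrow> (real \<Rightarrow> real) \<Rightarrow> (real \<Rightarrow> complex) \<Rightarrow> (real \<Rightarrow> complex) \<Rightarrow>
   real \<Rightarrow> complex \<Rightarrow> (real \<Rightarrow> complex) \<Rightarrow> (real \<Rightarrow> complex) \<Rightarrow>
   (real \<Rightarrow> complex \<Rightarrow> complex) \<Rightarrow> (real \<Rightarrow> complex \<Rightarrow> complex) \<Rightarrow>
   (real \<Rightarrow> complex \<Rightarrow> complex) \<Rightarrow> (real \<Rightarrow> complex \<Rightarrow> complex) \<Rightarrow> complex \<Rightarrow> complex \<Rightarrow> bool" where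
  "weyl_number a b w p q \<eta> K psi psi1 \<theta> \<theta>1 \<phi> \<phi>1 l z \<longleftrightarrow>
     (\<lambda>x. \<theta> x l + z * \<phi> x l) \<in> L2w (half_open a b) w \<and>
     (sims_case2 (half_open a b) w p q \<eta> K \<or> sims_case3 (half_open a b) w p q \<eta> K \<longrightarrow>
        vanishes_at_end b
          (sl_bracket (\<lambda>x. \<theta> x l + z * \<phi> x l) (\<lambda>x. \<theta>1 x l + z * \<phi>1 x l) psi psi1))"

definition titchmarsh_weyl ::
  "real \<Rightarrow> ereal \<Rightarrow> (real \<Rightarrow> real) \<Rightarrow> (real \<Rightarrow> complex) \<Rightarrow> (real \<Rightarrow> complex) \<Rightarrow>
   real \<Rightarrow> complex \<Rightarrow> (real \<Rightarrow> complex) \<Rightarrow> (real \<Rightarrow> complex) \<Rightarrow>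
   (real \<Rightarrow> complex \<Rightarrow> complex) \<Rightarrow> (real \<Rightarrow> complex \<Rightarrow> complex) \<Rightarrow>
   (real \<Rightarrow> complex \<Rightarrow> complex) \<Rightarrow> (real \<Rightarrow> complex \<Rightarrow> complex) \<Rightarrow> (complex \<Rightarrow> complex) \<Rightarrow> bool" where
  "titchmarsh_weyl a b w p q \<eta> K psi psi1 \<theta> \<theta>1 \<phi> \<phi>1 m \<longleftrightarrow>
     (\<forall>l. (\<exists>!z. weyl_number a b w p q \<eta> K psi psi1 \<theta> \<theta>1 \<phi> \<phi>1 l z) \<longrightarrow>
          weyl_number a b w p q \<eta> K psi psi1 \<theta> \<theta>1 \<phi> \<phi>1 l (m l))"

text \<open>The number \<open>z\<close> for which \<open>\<theta> + z \<phi>\<close> satisfies the boundary condition with parameter \<open>\<beta>\<close> at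
  \<open>c\<close>. Numerator and denominator have been multiplied by \<open>sin \<beta>\<close>, so that \<open>sin \<beta> = 0\<close> is
  covered.\<close>

definition truncated_m ::
  "(real \<Rightarrow> complex \<Rightarrow> complex) \<Rightarrow> (real \<Rightarrow> complex \<Rightarrow> complex) \<Rightarrow>
   (real \<Rightarrow> complex \<Rightarrow> complex) \<Rightarrow> (real \<Rightarrow> complex \<Rightarrow> complex) \<Rightarrow>
   real \<Rightarrow> complex \<Rightarrow> complex \<Rightarrow> complex" where
  "truncated_m \<theta> \<theta>1 \<phi> \<phi>1 c \<beta> l =
     - (\<theta> c l * cos \<beta> + \<theta>1 c l * sin \<beta>) / (\<phi> c l * cos \<beta> + \<phi>1 c l * sin \<beta>)"

end

theory Submission
  imports Defs "HOL-Complex_Analysis.Complex_Analysis"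
begin

text \<open>The eigenfunction of \<open>M\<close> at \<open>\<mu>\<close> is \<open>\<phi>(\<cdot>, \<mu>)\<close>. On a circle around \<open>\<mu>\<close> inside the resolvent set the
  bracket of \<open>\<phi>(\<cdot>, \<mu>)\<close> with the Weyl solution \<open>\<theta>(\<cdot>, l) + m(l) \<phi>(\<cdot>, l)\<close>, evaluated at \<open>c\<close>, tends to 0
  uniformly as \<open>c\<close> approaches \<open>b\<close>: it is controlled by the resolvent and by the tail of \<open>\<phi>(\<cdot>, \<mu>)\<close> beyond
  \<open>c\<close>. Fix such a \<open>c\<close> and replace \<open>m\<close> by \<open>m\<^sub>n\<close>. If \<open>M\<^sub>n\<close> had no eigenvalue in the disc, the bracket would
  be holomorphic there, small on the circle for large \<open>n\<close>, and equal to 1 at \<open>\<mu>\<close>, against the maximum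
  principle.

  That the spectrum of \<open>M\<^sub>n\<close> is nonempty for every single \<open>n\<close> is a separate matter, and it is
  here that the admissible pair enters. The characteristic function of \<open>M\<^sub>n\<close> is entire of order one half, so
  without zeros it is constant; accretivity and the Phragmen-Lindelof principle then exclude this.\<close>

section \<open>Absolutely continuous functions\<close>

text \<open>Nothing is assumed about \<open>m\<close> at \<mu>, and \<open>m\<close> is pinned down
  only where the Weyl number is unique. So \<open>m\<close> is used solely on circles in the
  resolvent set, where at most one Weyl number can exist, and analyticity comes from the truncations
  alone. The bracket is affine in the Weyl number, with slope [\<phi>(.,\<mu>), \<phi>(.,l)](c). For
  fixed c this slope is bounded on the circle, so exchanging m for m_n costs a multiple of |m_n -
  m|; this is why c is chosen before n. At l = \<mu> the slope vanishes, so the value 1 comes from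
  [\<theta>, \<phi>] = -1, whatever m_n(\<mu>) is. The spectrum must be nonempty also for the
  finitely many n that the limit argument does not reach. With complex coefficients and complex
  boundary parameters there is no self-adjointness to supply eigenvalues. Order one half is used
  twice: a zero-free entire function of order below 1 is constant, and such growth can be beaten on
  a sector of opening less than 2 pi.\<close>

lemma AE_lebesgue_negligibleE:
  assumes "AE x in lebesgue. P x"
  obtains N where "negligible N" "\<And>x. x \<notin> N \<Longrightarrow> P x"
  using assms unfolding eventually_ae_filter negligible_iff_null_sets by auto

lemma abs_continuous_onD:
  assumes "abs_continuous_on S f" "0 < e"
  obtains d where "0 < d"
    "\<And>\<D> T. \<D> division_of T \<Longrightarrow> T \<subseteq> S \<Longrightarrow> (\<Sum>J\<in>\<D>. measure lborel J) < d \<Longrightarrow>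
       (\<Sum>J\<in>\<D>. norm (f (Sup J) - f (Inf J))) < e"
  using assms unfolding abs_continuous_on_def by metis

lemma abs_continuous_on_imp_continuous_on:
  fixes f :: "real \<Rightarrow> 'a::real_normed_vector"
  assumes "abs_continuous_on {c..d} f"
  shows "continuous_on {c..d} f"
  unfolding continuous_on_iff
proof (intro ballI allI impI)
  fix x e :: real assume x: "x \<in> {c..d}" and "0 < e"
  obtain r where r: "0 < r" "\<And>\<D> T. \<D> division_of T \<Longrightarrow> T \<subseteq> {c..d} \<Longrightarrow> (\<Sum>J\<in>\<D>. measure lborel J) < r \<Longrightarrow>
       (\<Sum>J\<in>\<D>. norm (f (Sup J) - f (Inf J))) < e"
    using abs_continuous_onD[OF assms \<open>0 < e\<close>] by metis
  have *: "norm (f v - f u) < e" if "u \<in> {c..d}" "v \<in> {c..d}" "u \<le> v" "v - u < r" for u v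
    using r(2)[of "{{u..v}}" "{u..v}"] division_of_self[of u v] that by simp
  show "\<exists>\<delta>>0. \<forall>y\<in>{c..d}. dist y x < \<delta> \<longrightarrow> dist (f y) (f x) < e"
  proof (intro exI[of _ r] conjI ballI impI)
    fix y assume "y \<in> {c..d}" "dist y x < r"
    then show "dist (f y) (f x) < e"
      using *[of x y] *[of y x] x by (cases "x \<le> y") (auto simp: dist_norm norm_minus_commute)
  qed (use r in auto)
qed

text \<open>Outer regularity encloses the null set in an open set whose measure is below the
  threshold of absolute continuity. This controls the tags of the fundamental theorem at which the
  derivative may fail to exist.\<close>

lemma abs_continuous_on_small_open:
  fixes f :: "real \<Rightarrow> 'a::real_normed_vector"
  assumes ac: "abs_continuous_on {c..d} f" and "negligible N" "0 < e"
  obtains G where "open G" "N \<subseteq> G"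
    "\<And>p. p tagged_partial_division_of {c..d} \<Longrightarrow> \<Union>(snd ` p) \<subseteq> G \<Longrightarrow>
       (\<Sum>(x,K)\<in>p. norm (f (Sup K) - f (Inf K))) < e"
proof -
  obtain r where r: "0 < r" "\<And>\<D> T. \<D> division_of T \<Longrightarrow> T \<subseteq> {c..d} \<Longrightarrow> (\<Sum>J\<in>\<D>. measure lborel J) < r \<Longrightarrow>
       (\<Sum>J\<in>\<D>. norm (f (Sup J) - f (Inf J))) < e"
    using abs_continuous_onD[OF ac \<open>0 < e\<close>] by metis
  have N: "N \<in> sets lebesgue" "N \<in> null_sets lebesgue"
    using \<open>negligible N\<close> by (auto simp: negligible_iff_null_sets)
  obtain G where G: "open G" "N \<subseteq> G" "G - N \<in> lmeasurable" "emeasure lebesgue (G - N) < ennreal r"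
    using sets_lebesgue_outer_open[OF N(1) r(1)] by metis
  have Gm: "G \<in> lmeasurable" "measure lebesgue G < r"
  proof -
    have "emeasure lebesgue G = emeasure lebesgue (G - N)"
      using N G(1) by (metis borel_open emeasure_Diff_null_set lborelD sets_completionI_sets)
    then have e: "emeasure lebesgue G < ennreal r" using G by simp
    show "G \<in> lmeasurable"
      using e G(1) by (intro fmeasurableI) (auto intro: order.strict_trans)
    with e show "measure lebesgue G < r"
      using r by (simp add: emeasure_eq_measure2 ennreal_less_iff)
  qed
  show thesis
  proof (rule that[OF G(1,2)])
    fix p assume p: "p tagged_partial_division_of {c..d}" and sub: "\<Union>(snd ` p) \<subseteq> G"
    have tag: "p tagged_division_of \<Union>(snd ` p)"
      using p by (rule tagged_partial_division_of_Union_self)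
    have div: "snd ` p division_of \<Union>(snd ` p)"
      using tag by (rule division_of_tagged_division)
    \<comment> \<open>The sum over tagged intervals becomes a sum over the intervals themselves. An
      interval can carry two tags only if it is degenerate, so the summand has to vanish on
      degenerate boxes, including the empty one, where \<open>Sup\<close> and \<open>Inf\<close>
      carry no information.\<close>
    define D where "D K = (if K = {} then 0 else norm (f (Sup K) - f (Inf K)))" for K
    have "(\<Sum>(x,K)\<in>p. norm (f (Sup K) - f (Inf K))) = (\<Sum>(x,K)\<in>p. D K)"
    proof (rule sum.cong)
      fix z assume "z \<in> p"
      then have "snd z \<noteq> {}" using tagged_partial_division_ofD(2)[OF p, of "fst z" "snd z"] by auto
      then show "(case z of (x, K) \<Rightarrow> norm (f (Sup K) - f (Inf K))) = (case z of (x, K) \<Rightarrow> D K)"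
        by (simp add: D_def case_prod_unfold)
    qed simp
    also have "\<dots> = (\<Sum>K\<in>snd ` p. D K)"
    proof (rule sum.over_tagged_division_lemma[OF tag])
      fix u v :: real assume "box u v = {}"
      then have "v \<le> u" by simp
      then show "D (cbox u v) = 0"
        by (cases "u = v") (auto simp: D_def)
    qed
    also have "\<dots> = (\<Sum>K\<in>snd ` p. norm (f (Sup K) - f (Inf K)))"
      using division_ofD(3)[OF div] by (intro sum.cong) (auto simp: D_def)
    also have "\<dots> < e"
    proof (rule r(2)[OF div])
      show "\<Union>(snd ` p) \<subseteq> {c..d}"
        using tagged_partial_division_ofD(3)[OF p] by (fastforce simp del: atLeastAtMost_iff)
      have "(\<Sum>J\<in>snd ` p. measure lborel J) = (\<Sum>J\<in>snd ` p. measure lebesgue J)"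
      proof (rule sum.cong)
        fix K assume "K \<in> snd ` p"
        then obtain u v where "K = cbox u v" using division_ofD(4)[OF div] by blast
        then show "measure lborel K = measure lebesgue K" by (simp add: measure_completion)
      qed simp
      also have "\<dots> = measure lebesgue (\<Union>(snd ` p))"
        using content_division[OF div] .
      also have "\<dots> \<le> measure lebesgue G"
        using sub Gm lmeasurable_division[OF div] by (intro measure_mono_fmeasurable) auto
      finally show "(\<Sum>J\<in>snd ` p. measure lborel J) < r" using Gm by linarith
    qed
    finally show "(\<Sum>(x,K)\<in>p. norm (f (Sup K) - f (Inf K))) < e" .
  qed
qed

text \<open>A gauge argument that yields integrability of g together with the value. Tags outside N
  are handled by the difference quotient, tags in N by absolute continuity; each family contributes
  at most \<open>e * (d - c)\<close>, hence \<open>e = e0 / 2\<close>.\<close>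

theorem abs_continuous_fundamental_theorem:
  fixes f :: "real \<Rightarrow> 'a::banach"
  assumes ac: "abs_continuous_on {c..d} f" and "c \<le> d"
    and der: "AE x in lebesgue. x \<in> {c..d} \<longrightarrow> (f has_vector_derivative g x) (at x)"
  shows "(g has_integral (f d - f c)) {c..d}"
proof -
  obtain N where N: "negligible N"
      "\<And>x. x \<notin> N \<Longrightarrow> x \<in> {c..d} \<Longrightarrow> (f has_vector_derivative g x) (at x)"
    using AE_lebesgue_negligibleE[OF der] by metis
  \<comment> \<open>The integrand is reset to 0 on N, so a tag in N contributes only an increment of
    f, whatever g is there.\<close>
  define h where "h x = (if x \<in> N then 0 else g x)" for x
  have "(h has_integral (f d - f c)) {c..d}"
  proof (cases "c = d")
    case True
    then show ?thesis by auto
  next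
    case False
    with \<open>c \<le> d\<close> have "c < d" by simp
    show ?thesis
      unfolding has_integral_factor_content_real
    proof (intro allI impI)
      fix e0 :: real assume "e0 > 0"
      define e where "e = e0 / 2"
      have "e > 0" using \<open>e0 > 0\<close> by (simp add: e_def)
      have "\<forall>x. \<exists>r>0. x \<in> {c..d} - N \<longrightarrow>
         (\<forall>y\<in>{c..d}. norm (y-x) < r \<longrightarrow> norm (f y - f x - (y-x) *\<^sub>R g x) \<le> e * norm (y-x))"
      proof
        fix x
        show "\<exists>r>0. x \<in> {c..d} - N \<longrightarrow>
         (\<forall>y\<in>{c..d}. norm (y-x) < r \<longrightarrow> norm (f y - f x - (y-x) *\<^sub>R g x) \<le> e * norm (y-x))"
        proof (cases "x \<in> {c..d} - N")
          case True
          then have "(f has_vector_derivative g x) (at x within {c..d})"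
            using N(2) has_vector_derivative_at_within by blast
          then show ?thesis
            using \<open>e > 0\<close> unfolding has_vector_derivative_def has_derivative_within_alt by blast
        qed (auto intro: exI[of _ 1])
      qed
      then obtain r where r: "\<And>x. 0 < r x"
           "\<And>x y. \<lbrakk>x \<in> {c..d}; x \<notin> N; y \<in> {c..d}; norm (y-x) < r x\<rbrakk>
              \<Longrightarrow> norm (f y - f x - (y-x) *\<^sub>R g x) \<le> e * norm (y-x)"
        by (metis DiffI)
      have "0 < e * (d - c)" using \<open>c < d\<close> \<open>e > 0\<close> by simp
      then obtain G where G: "open G" "N \<subseteq> G"
         "\<And>p. p tagged_partial_division_of {c..d} \<Longrightarrow> \<Union>(snd ` p) \<subseteq> G \<Longrightarrow>
           (\<Sum>(x,K)\<in>p. norm (f (Sup K) - f (Inf K))) < e * (d - c)"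
        using abs_continuous_on_small_open[OF ac N(1)] by metis
      define \<gamma> where "\<gamma> x = (if x \<in> N then G else ball x (r x))" for x
      have "gauge \<gamma>"
        using G r(1) by (auto simp: gauge_def \<gamma>_def)
      show "\<exists>\<gamma>. gauge \<gamma> \<and> (\<forall>p. p tagged_division_of {c..d} \<and> \<gamma> fine p \<longrightarrow>
               norm ((\<Sum>(x, k)\<in>p. measure lborel k *\<^sub>R h x) - (f d - f c)) \<le> e0 * measure lborel {c..d})"
      proof (intro exI[of _ \<gamma>] conjI allI impI \<open>gauge \<gamma>\<close>, elim conjE)
        fix p assume p: "p tagged_division_of {c..d}" and fine: "\<gamma> fine p"
        have finp: "finite p" using p by auto
        define p1 p2 where "p1 = {z\<in>p. fst z \<in> N}" and "p2 = {z\<in>p. fst z \<notin> N}"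
        have pp: "p = p1 \<union> p2" "p1 \<inter> p2 = {}" "finite p1" "finite p2"
          using finp by (auto simp: p1_def p2_def)
        define D where "D = (\<lambda>(x,K). measure lborel K *\<^sub>R h x - (f (Sup K) - f (Inf K)))"
        have "(\<Sum>(x, K)\<in>p. measure lborel K *\<^sub>R h x) - (f d - f c) = sum D p"
          using additive_tagged_division_1[OF \<open>c \<le> d\<close> p, of f]
          by (simp add: D_def case_prod_unfold sum_subtractf)
        also have "\<dots> = sum D p1 + sum D p2"
          using pp by (simp add: sum.union_disjoint)
        also have "norm \<dots> \<le> norm (sum D p1) + norm (sum D p2)" by (rule norm_triangle_ineq)
        also have "norm (sum D p1) \<le> e * (d - c)"
        proof -
          have "norm (sum D p1) \<le> (\<Sum>(x,K)\<in>p1. norm (f (Sup K) - f (Inf K)))"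
            unfolding case_prod_unfold
            by (rule sum_norm_le) (simp add: D_def p1_def h_def case_prod_unfold norm_minus_commute)
          also have "\<dots> \<le> e * (d - c)"
          proof (rule less_imp_le[OF G(3)])
            show "p1 tagged_partial_division_of {c..d}"
              using p tagged_partial_division_subset[of p "{c..d}" p1] pp(1) tagged_division_of_def by blast
            show "\<Union>(snd ` p1) \<subseteq> G"
            proof
              fix y assume "y \<in> \<Union>(snd ` p1)"
              then obtain x K where "(x, K) \<in> p" "x \<in> N" "y \<in> K" by (auto simp: p1_def)
              then show "y \<in> G" using fineD[OF fine, of x K] by (auto simp: \<gamma>_def)
            qed
          qed
          finally show ?thesis .
        qed
        also have "norm (sum D p2) \<le> e * (d - c)"
        proof -
          have "norm (sum D p2) \<le> (\<Sum>(x,K)\<in>p2. e * (Sup K - Inf K))"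
          proof (rule sum_norm_le, safe)
            fix x K assume xK: "(x, K) \<in> p2"
            then have xp: "(x, K) \<in> p" and xN: "x \<notin> N" by (auto simp: p2_def)
            then obtain u v where k: "K = {u..v}" and "x \<in> K" and kcd: "K \<subseteq> {c..d}"
              using tagged_division_ofD(2,3,4)[OF p xp] by auto
            have "u \<le> v" using \<open>x \<in> K\<close> unfolding k by auto
            have ball: "K \<subseteq> ball x (r x)"
              using fineD[OF fine xp] xN by (simp add: \<gamma>_def)
            have uv: "u \<in> K" "v \<in> K" by (simp_all add: \<open>u \<le> v\<close> k)
            have "norm ((v - u) *\<^sub>R g x - (f v - f u)) =
                norm ((f u - f x - (u - x) *\<^sub>R g x) - (f v - f x - (v - x) *\<^sub>R g x))"
              by (auto simp: algebra_simps)
            also have "\<dots> \<le> norm (f u - f x - (u - x) *\<^sub>R g x) + norm (f v - f x - (v - x) *\<^sub>R g x)"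
              by (rule norm_triangle_ineq4)
            also have "\<dots> \<le> e * norm (u - x) + e * norm (v - x)"
              using ball uv kcd \<open>x \<in> K\<close> xN
              by (intro add_mono r(2)) (auto simp: dist_norm subset_iff norm_minus_commute)
            also have "\<dots> \<le> e * (Sup K - Inf K)"
              using \<open>x \<in> K\<close> \<open>u \<le> v\<close> by (auto simp: k field_simps)
            finally show "norm (D (x, K)) \<le> e * (Sup K - Inf K)"
              using \<open>u \<le> v\<close> xN by (simp add: k D_def h_def)
          qed
          also have "\<dots> \<le> (\<Sum>(x,K)\<in>p. e * (Sup K - Inf K))"
          proof (rule sum_mono2[OF finp])
            fix z assume "z \<in> p - p2"
            then obtain x K where z: "z = (x, K)" "(x, K) \<in> p" by (cases z) auto
            then obtain u v where "K = {u..v}" "x \<in> K"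
              using tagged_division_ofD(2,4)[OF p z(2)] by auto
            then show "0 \<le> (case z of (x, K) \<Rightarrow> e * (Sup K - Inf K))"
              using \<open>e > 0\<close> z by auto
          qed (auto simp: p2_def)
          also have "\<dots> = e * (d - c)"
            using additive_tagged_division_1[OF \<open>c \<le> d\<close> p, of "\<lambda>x. x"]
            by (simp add: case_prod_unfold flip: sum_distrib_left)
          finally show ?thesis .
        qed
        finally show "norm ((\<Sum>(x, k)\<in>p. measure lborel k *\<^sub>R h x) - (f d - f c)) \<le> e0 * measure lborel {c..d}"
          using \<open>c \<le> d\<close> by (simp add: e_def)
      qed
    qed
  qed
  then show ?thesis
    by (rule has_integral_spike[OF N(1), rotated]) (auto simp: h_def)
qed

lemma abs_continuous_on_mult:
  fixes f g :: "real \<Rightarrow> 'a::real_normed_algebra"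
  assumes f: "abs_continuous_on {c..d} f" and g: "abs_continuous_on {c..d} g"
  shows "abs_continuous_on {c..d} (\<lambda>x. f x * g x)"
  unfolding abs_continuous_on_def
proof (intro allI impI)
  fix e :: real assume "0 < e"
  have "bounded (f ` {c..d})" "bounded (g ` {c..d})"
    by (intro compact_imp_bounded compact_continuous_image abs_continuous_on_imp_continuous_on f g; simp)+
  then obtain B C where BC: "0 < B" "0 < C" "\<And>x. x \<in> {c..d} \<Longrightarrow> norm (f x) \<le> B" "\<And>x. x \<in> {c..d} \<Longrightarrow> norm (g x) \<le> C"
    unfolding bounded_pos by auto
  have e2: "0 < e / (2 * B)" "0 < e / (2 * C)" using BC \<open>0 < e\<close> by auto
  obtain r1 where r1: "0 < r1" "\<And>\<D> T. \<D> division_of T \<Longrightarrow> T \<subseteq> {c..d} \<Longrightarrow> (\<Sum>J\<in>\<D>. measure lborel J) < r1 \<Longrightarrow>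
       (\<Sum>J\<in>\<D>. norm (f (Sup J) - f (Inf J))) < e / (2 * C)"
    using abs_continuous_onD[OF f e2(2)] by metis
  obtain r2 where r2: "0 < r2" "\<And>\<D> T. \<D> division_of T \<Longrightarrow> T \<subseteq> {c..d} \<Longrightarrow> (\<Sum>J\<in>\<D>. measure lborel J) < r2 \<Longrightarrow>
       (\<Sum>J\<in>\<D>. norm (g (Sup J) - g (Inf J))) < e / (2 * B)"
    using abs_continuous_onD[OF g e2(1)] by metis
  show "\<exists>r>0. \<forall>\<D> T. \<D> division_of T \<and> T \<subseteq> {c..d} \<and> (\<Sum>J\<in>\<D>. measure lborel J) < r \<longrightarrow>
           (\<Sum>J\<in>\<D>. norm (f (Sup J) * g (Sup J) - f (Inf J) * g (Inf J))) < e"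
  proof (rule exI[of _ "min r1 r2"], intro conjI allI impI; (elim conjE)?)
    fix \<D> T assume D: "\<D> division_of T" and T: "T \<subseteq> {c..d}" and m: "(\<Sum>J\<in>\<D>. measure lborel J) < min r1 r2"
    have "(\<Sum>J\<in>\<D>. norm (f (Sup J) * g (Sup J) - f (Inf J) * g (Inf J)))
      \<le> (\<Sum>J\<in>\<D>. B * norm (g (Sup J) - g (Inf J)) + C * norm (f (Sup J) - f (Inf J)))"
    proof (rule sum_mono)
      fix J assume J: "J \<in> \<D>"
      then obtain u v where k: "J = {u..v}" "J \<noteq> {}"
        using division_ofD(3,4)[OF D J] by auto
      then have "u \<le> v" by auto
      have "J \<subseteq> {c..d}" using division_ofD(2)[OF D J] T by auto
      then have uv: "u \<in> {c..d}" "v \<in> {c..d}" using k by auto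
      have "f v * g v - f u * g u = f v * (g v - g u) + (f v - f u) * g u"
        by (simp add: algebra_simps)
      also have "norm \<dots> \<le> norm (f v) * norm (g v - g u) + norm (f v - f u) * norm (g u)"
        by (intro order_trans[OF norm_triangle_ineq] add_mono norm_mult_ineq)
      also have "\<dots> \<le> B * norm (g v - g u) + norm (f v - f u) * C"
        using BC uv by (intro add_mono mult_right_mono mult_left_mono) auto
      finally show "norm (f (Sup J) * g (Sup J) - f (Inf J) * g (Inf J)) \<le>
          B * norm (g (Sup J) - g (Inf J)) + C * norm (f (Sup J) - f (Inf J))"
        using \<open>u \<le> v\<close> by (simp add: k mult.commute)
    qed
    also have "\<dots> = B * (\<Sum>J\<in>\<D>. norm (g (Sup J) - g (Inf J))) + C * (\<Sum>J\<in>\<D>. norm (f (Sup J) - f (Inf J)))"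
      by (simp add: sum.distrib sum_distrib_left)
    also have "\<dots> < B * (e / (2 * B)) + C * (e / (2 * C))"
      using r1(2)[OF D T] r2(2)[OF D T] m BC by (intro add_strict_mono mult_strict_left_mono) auto
    also have "\<dots> = e" using BC by (simp add: field_simps)
    finally show "(\<Sum>J\<in>\<D>. norm (f (Sup J) * g (Sup J) - f (Inf J) * g (Inf J))) < e" .
  qed (use r1 r2 in auto)
qed

lemma abs_continuous_on_add:
  fixes f g :: "real \<Rightarrow> 'a::real_normed_vector"
  assumes f: "abs_continuous_on S f" and g: "abs_continuous_on S g"
  shows "abs_continuous_on S (\<lambda>x. f x + g x)"
  unfolding abs_continuous_on_def
proof (intro allI impI)
  fix e :: real assume "0 < e"
  then have e2: "0 < e / 2" by simp
  obtain r1 where r1: "0 < r1" "\<And>\<D> T. \<D> division_of T \<Longrightarrow> T \<subseteq> S \<Longrightarrow> (\<Sum>J\<in>\<D>. measure lborel J) < r1 \<Longrightarrow>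
       (\<Sum>J\<in>\<D>. norm (f (Sup J) - f (Inf J))) < e / 2"
    using abs_continuous_onD[OF f e2] by metis
  obtain r2 where r2: "0 < r2" "\<And>\<D> T. \<D> division_of T \<Longrightarrow> T \<subseteq> S \<Longrightarrow> (\<Sum>J\<in>\<D>. measure lborel J) < r2 \<Longrightarrow>
       (\<Sum>J\<in>\<D>. norm (g (Sup J) - g (Inf J))) < e / 2"
    using abs_continuous_onD[OF g e2] by metis
  show "\<exists>r>0. \<forall>\<D> T. \<D> division_of T \<and> T \<subseteq> S \<and> (\<Sum>J\<in>\<D>. measure lborel J) < r \<longrightarrow>
           (\<Sum>J\<in>\<D>. norm (f (Sup J) + g (Sup J) - (f (Inf J) + g (Inf J)))) < e"
  proof (rule exI[of _ "min r1 r2"], intro conjI allI impI; (elim conjE)?)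
    fix \<D> T assume D: "\<D> division_of T" and T: "T \<subseteq> S" and m: "(\<Sum>J\<in>\<D>. measure lborel J) < min r1 r2"
    have "(\<Sum>J\<in>\<D>. norm (f (Sup J) + g (Sup J) - (f (Inf J) + g (Inf J))))
      \<le> (\<Sum>J\<in>\<D>. norm (f (Sup J) - f (Inf J)) + norm (g (Sup J) - g (Inf J)))"
      by (intro sum_mono norm_diff_triangle_ineq)
    also have "\<dots> < e / 2 + e / 2"
      using r1(2)[OF D T] r2(2)[OF D T] m by (simp add: sum.distrib)
    finally show "(\<Sum>J\<in>\<D>. norm (f (Sup J) + g (Sup J) - (f (Inf J) + g (Inf J)))) < e" by simp
  qed (use r1 r2 in auto)
qed

lemma abs_continuous_on_cmult:
  fixes f :: "real \<Rightarrow> 'a::real_normed_algebra"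
  assumes "abs_continuous_on S f"
  shows "abs_continuous_on S (\<lambda>x. k * f x)"
  unfolding abs_continuous_on_def
proof (intro allI impI)
  fix e :: real assume "0 < e"
  then have e2: "0 < e / (norm k + 1)" by (simp add: add_nonneg_pos)
  obtain r where r: "0 < r" "\<And>\<D> T. \<D> division_of T \<Longrightarrow> T \<subseteq> S \<Longrightarrow> (\<Sum>J\<in>\<D>. measure lborel J) < r \<Longrightarrow>
       (\<Sum>J\<in>\<D>. norm (f (Sup J) - f (Inf J))) < e / (norm k + 1)"
    using abs_continuous_onD[OF assms e2] by metis
  show "\<exists>r>0. \<forall>\<D> T. \<D> division_of T \<and> T \<subseteq> S \<and> (\<Sum>J\<in>\<D>. measure lborel J) < r \<longrightarrow>
           (\<Sum>J\<in>\<D>. norm (k * f (Sup J) - k * f (Inf J))) < e"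
  proof (intro exI[of _ r] conjI allI impI \<open>0 < r\<close>, elim conjE)
    fix \<D> T assume D: "\<D> division_of T" and T: "T \<subseteq> S" and m: "(\<Sum>J\<in>\<D>. measure lborel J) < r"
    have "(\<Sum>J\<in>\<D>. norm (k * f (Sup J) - k * f (Inf J))) \<le> (norm k + 1) * (\<Sum>J\<in>\<D>. norm (f (Sup J) - f (Inf J)))"
      unfolding sum_distrib_left right_diff_distrib[symmetric]
      by (intro sum_mono order_trans[OF norm_mult_ineq] mult_right_mono) auto
    also have "\<dots> < (norm k + 1) * (e / (norm k + 1))"
      using r(2)[OF D T m] by (intro mult_strict_left_mono) (auto simp: add_nonneg_pos)
    also have "\<dots> = e"
      by (metis add_nonneg_pos nonzero_mult_div_cancel_left norm_ge_zero order_less_irrefl times_divide_eq_right zero_less_one)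
    finally show "(\<Sum>J\<in>\<D>. norm (k * f (Sup J) - k * f (Inf J))) < e" .
  qed
qed

lemma abs_continuous_on_cnj:
  assumes "abs_continuous_on S f"
  shows "abs_continuous_on S (\<lambda>x. cnj (f x))"
  using assms unfolding abs_continuous_on_def
  by (simp flip: complex_cnj_diff)

section \<open>Entire functions of order one half\<close>

text \<open>The Moebius map v -> v / (2 M - v) carries the half-plane Re v < M into the unit disc
  and fixes 0, so the Schwarz lemma applies. Restricting to half the radius makes the quotient at
  most 1/2, which allows solving for h and accounts for the factor 4.\<close>

lemma Borel_Caratheodory_zero:
  assumes h: "h holomorphic_on ball 0 R" "h 0 = 0" and "0 < R"
    and M: "\<And>z. z \<in> ball 0 R \<Longrightarrow> Re (h z) < M" and z: "norm z \<le> R / 2"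
  shows "norm (h z) \<le> 4 * M * norm z / R"
proof -
  have "0 < M" using M[of 0] h(2) \<open>0 < R\<close> by simp
  have lt: "norm (h u) < norm (2 * of_real M - h u)" if "u \<in> ball 0 R" for u
  proof -
    have "(norm (2 * of_real M - h u))\<^sup>2 - (norm (h u))\<^sup>2 = 4 * M * (M - Re (h u))"
      unfolding cmod_power2 by (simp add: power2_eq_square algebra_simps)
    also have "\<dots> > 0" using M[OF that] \<open>0 < M\<close> by simp
    finally show ?thesis by (intro power2_less_imp_less[of "norm (h u)"]) auto
  qed
  then have nz: "2 * of_real M - h u \<noteq> 0" if "u \<in> ball 0 R" for u
    using that by fastforce
  define k where "k u = h (of_real R * u) / (2 * of_real M - h (of_real R * u))" for u
  have in_ball: "of_real R * u \<in> ball 0 R" if "u \<in> ball 0 1" for u :: complex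
    using that \<open>0 < R\<close> by (simp add: norm_mult)
  have hol: "k holomorphic_on ball 0 1"
    unfolding k_def
  proof (intro holomorphic_on_divide holomorphic_on_diff holomorphic_on_const)
    have "(\<lambda>u. h (of_real R * u)) holomorphic_on ball 0 1"
      using in_ball by (intro holomorphic_on_compose_gen[OF _ h(1), unfolded o_def] holomorphic_intros) auto
    then show "(\<lambda>u. h (of_real R * u)) holomorphic_on ball 0 1" "(\<lambda>u. h (of_real R * u)) holomorphic_on ball 0 1" by this+
  qed (use nz in_ball in blast)
  define u where "u = z / of_real R"
  have u: "norm u \<le> 1 / 2" "z = of_real R * u"
    using z \<open>0 < R\<close> by (auto simp: u_def norm_divide field_simps)
  have "norm (k u) \<le> norm u"
  proof (rule Schwarz_Lemma(1)[OF hol])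
    show "norm (k v) < 1" if "norm v < 1" for v
      using lt[OF in_ball, of v] that by (simp add: k_def norm_divide divide_less_eq)
  qed (use u h in \<open>auto simp: k_def\<close>)
  then have ku: "norm (k u) \<le> norm u" "norm (k u) \<le> 1 / 2" using u by auto
  have uz: "z \<in> ball 0 R" using z \<open>0 < R\<close> by simp
  have "k u * (2 * of_real M - h z) = h z"
    using nz[OF uz] by (simp add: k_def u)
  then have "norm (h z) = norm (k u * (2 * of_real M) - k u * h z)"
    by (simp add: algebra_simps)
  also have "\<dots> \<le> norm (k u) * (2 * M) + norm (k u) * norm (h z)"
    using \<open>0 < M\<close> by (intro order_trans[OF norm_triangle_ineq4]) (simp add: norm_mult)
  also have "\<dots> \<le> norm u * (2 * M) + (1/2) * norm (h z)"
    using ku \<open>0 < M\<close> by (intro add_mono mult_right_mono) auto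
  finally have "norm (h z) \<le> 4 * M * norm u" by (simp add: algebra_simps)
  then show ?thesis using \<open>0 < R\<close> by (simp add: u_def norm_divide)
qed

text \<open>A logarithm g of f satisfies Re g \<le> A + A sqrt R on the disc of radius R.
  Borel-Caratheodory then bounds |g(z) - g(0)| by O(|z| / sqrt R), and R is arbitrary.\<close>

lemma zero_free_entire_constant:
  assumes hol: "f holomorphic_on UNIV" and nz: "\<And>z. f z \<noteq> 0"
    and growth: "0 \<le> A" "\<And>z. norm (f z) \<le> exp (A + A * sqrt (norm z))"
  shows "f z = f 0"
proof -
  obtain g where g: "g holomorphic_on UNIV" "\<And>z. exp (g z) = f z"
    using holomorphic_logarithm_exists[OF convex_UNIV open_UNIV hol nz, of 0] by auto
  have Re_g: "Re (g z) \<le> A + A * sqrt (norm z)" for z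
    using growth(2)[of z] by (simp flip: g(2))
  define h where "h z = g z - g 0" for z
  have bound: "norm (h z) \<le> 4 * (A + A * sqrt R - Re (g 0) + 1) * norm z / R" if "R > 0" "R \<ge> 2 * norm z" for R
  proof (rule Borel_Caratheodory_zero)
    show "h holomorphic_on ball 0 R" unfolding h_def
      by (intro holomorphic_intros holomorphic_on_subset[OF g(1)]) auto
    fix u :: complex assume "u \<in> ball 0 R"
    then have "A * sqrt (norm u) \<le> A * sqrt R"
      using growth(1) by (intro mult_left_mono) auto
    then show "Re (h u) < A + A * sqrt R - Re (g 0) + 1"
      using Re_g[of u] by (simp add: h_def)
  qed (use that in \<open>auto simp: h_def\<close>)
  have "((\<lambda>R. 4 * (A + A * sqrt R - Re (g 0) + 1) * norm z / R) \<longlongrightarrow> 0) at_top"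
    by real_asymp
  moreover have "\<forall>\<^sub>F R in at_top. norm (h z) \<le> 4 * (A + A * sqrt R - Re (g 0) + 1) * norm z / R"
    using eventually_gt_at_top[of 0] eventually_ge_at_top[of "2 * norm z"]
    by eventually_elim (use bound in auto)
  ultimately have "norm (h z) \<le> 0"
    by (intro tendsto_le[OF _ _ tendsto_const]) auto
  then have "g z = g 0" by (simp add: h_def)
  then show ?thesis by (metis g(2))
qed

text \<open>A Phragmen-Lindelof principle: growth of order one half is too slow for the sector of
  opening less than \<open>2 \<pi>\<close> that is complementary to the one on which \<open>f\<close> is bounded.\<close>

lemma entire_bounded_sector_constant:
  assumes hol: "f holomorphic_on UNIV" and k: "0 < k" "k < 1"
    and growth: "0 \<le> A" "\<And>z. norm (f z) \<le> exp (A + A * sqrt (norm z))"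
    and bnd: "\<And>z. Re z \<le> - k * norm z \<Longrightarrow> norm (f z) \<le> B"
  shows "f z = f 0"
proof -
  \<comment> \<open>Since cos (pi - s) = - k, the hypothesis bounds \<open>f\<close> exactly where
    |Arg z| \<ge> pi - s.\<close>
  define s where "s = arccos k"
  have s: "0 < s" "s < pi / 2" "cos s = k"
    using k arccos_lt_bounded[of k] arccos_less_arccos[of 0 k] by (auto simp: s_def cos_arccos)
  \<comment> \<open>The exponent must exceed 1/2, so that z^g outgrows the square root, and g (pi -
    s) must stay below pi / 2, so that Re z^g is positive on the complementary sector. The choice pi
    / (2 pi - s) achieves both because 0 < s.\<close>
  define g where "g = pi / (2 * pi - s)"
  have g: "1/2 < g" "g * (pi - s) < pi / 2" "0 \<le> g * (pi - s)"
    using s by (auto simp: g_def field_simps)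
  define c where "c = cos (g * (pi - s))"
  have "0 < c" unfolding c_def using g by (intro cos_gt_zero_pi) auto
  have Arg: "c * norm z powr g \<le> Re (z powr of_real g)" if z: "z \<noteq> 0" "Re z \<ge> - k * norm z" for z
  proof -
    have "norm z * cos (Arg z) \<ge> norm z * (- k)"
      using z by (simp add: cos_Arg mult.commute)
    then have "- k \<le> cos (Arg z)"
      using z by (subst (asm) mult_le_cancel_left) auto
    then have "cos (pi - s) \<le> cos \<bar>Arg z\<bar>"
      using z s by simp
    then have "\<bar>Arg z\<bar> \<le> pi - s"
      using s Arg_bounded[of z] by (subst (asm) cos_mono_le_eq) (auto simp: abs_le_iff)
    then have "cos (g * (pi - s)) \<le> cos (g * \<bar>Arg z\<bar>)"
      using g s by (intro cos_monotone_0_pi_le) (auto intro!: mult_left_mono)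
    also have "cos (g * \<bar>Arg z\<bar>) = cos (g * Arg z)"
      by (cases "Arg z \<ge> 0") auto
    finally have "norm z powr g * c \<le> norm z powr g * cos (g * Arg z)"
      unfolding c_def by (intro mult_left_mono) auto
    also have "\<dots> = Re (z powr of_real g)"
      using z by (simp add: powr_def Ln_Arg Re_exp algebra_simps)
    finally show ?thesis by (simp add: mult.commute)
  qed
  define B' where "B' = max B (max 1 (exp (A + A)))"
  have bound: "norm (f z) \<le> B'" for z
  proof (cases "norm z \<le> 1 \<or> Re z \<le> - k * norm z")
    case True
    have "norm (f z) \<le> exp (A + A)" if "norm z \<le> 1"
    proof -
      have "A * sqrt (norm z) \<le> A * 1" using that growth(1) by (intro mult_left_mono) auto
      then show ?thesis using growth(2)[of z] by (simp add: order_trans)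
    qed
    then show ?thesis using True bnd[of z] by (auto simp: B'_def le_max_iff_disj)
  next
    case False
    \<comment> \<open>The factor exp (- e z^g) damps \<open>f\<close> on a far arc |w| = R and has
      modulus at most 1 on the rest of the boundary. Afterwards e tends to 0 at the fixed point
      z.\<close>
    have *: "norm (f z) \<le> B' * exp (e * Re (z powr of_real g))" if "0 < e" for e
    proof -
      have "\<forall>\<^sub>F R in at_top. A + A * sqrt R - e * c * R powr g \<le> 0"
        using g \<open>0 < c\<close> \<open>0 < e\<close> by real_asymp
      then obtain R where R: "R > norm z" "A + A * sqrt R - e * c * R powr g \<le> 0"
        using eventually_happens[OF eventually_conj[OF _ eventually_gt_at_top[of "norm z"]]] by fastforce
      \<comment> \<open>Cutting out the unit disc removes the branch point of the power, and k < 1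
        keeps the negative axis outside the sector.\<close>
      define S where "S = {w. 1 \<le> norm w \<and> norm w \<le> R \<and> - k * norm w \<le> Re w}"
      define F where "F w = f w * exp (- of_real e * w powr of_real g)" for w
      have "closed S" unfolding S_def
        by (intro closed_Collect_conj closed_Collect_le continuous_intros)
      have "open {w. 1 < norm w \<and> norm w < R \<and> - k * norm w < Re w}"
        by (intro open_Collect_conj open_Collect_less continuous_intros)
      then have int: "{w. 1 < norm w \<and> norm w < R \<and> - k * norm w < Re w} \<subseteq> interior S"
        by (intro interior_maximal) (auto simp: S_def)
      have avoid: "w \<notin> \<real>\<^sub>\<le>\<^sub>0" if "w \<in> S" for w
      proof
        assume "w \<in> \<real>\<^sub>\<le>\<^sub>0"
        then have "Re w = - norm w"
          by (auto simp: complex_nonpos_Reals_iff cmod_eq_Re)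
        then have "(1 - k) * norm w \<le> 0" using that by (simp add: S_def algebra_simps)
        then show False using that k by (auto simp: S_def mult_le_0_iff)
      qed
      have hF: "F holomorphic_on S" unfolding F_def
        using avoid by (intro holomorphic_intros holomorphic_on_subset[OF hol]) auto
      have "norm (F z) \<le> B'"
      proof (rule maximum_modulus_frontier[of F S])
        show "F holomorphic_on interior S" using hF interior_subset holomorphic_on_subset by blast
        show "continuous_on (closure S) F"
          using hF \<open>closed S\<close> by (simp add: holomorphic_on_imp_continuous_on)
        show "bounded S" by (rule bounded_subset[OF bounded_cball[of 0 R]]) (auto simp: S_def)
        show "z \<in> S" using False R by (auto simp: S_def)
        fix w assume "w \<in> frontier S"
        then have w: "w \<in> S" "w \<notin> interior S"
          using \<open>closed S\<close> by (auto simp: frontier_def)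
        then have "w \<noteq> 0" by (auto simp: S_def)
        have cw: "c * norm w powr g \<le> Re (w powr of_real g)"
          using Arg[OF \<open>w \<noteq> 0\<close>] w by (simp add: S_def)
        have nF: "norm (F w) = norm (f w) * exp (- e * Re (w powr of_real g))"
          by (simp add: F_def norm_mult)
        have le1: "exp (- e * Re (w powr of_real g)) \<le> 1"
          using cw \<open>0 < c\<close> \<open>0 < e\<close> by (simp add: order_trans[OF _ cw])
        consider "norm w = 1" | "norm w = R" | "Re w = - k * norm w"
          using w int by (force simp: S_def)
        then show "norm (F w) \<le> B'"
        proof cases
          case 1
          have "norm (F w) \<le> norm (f w) * 1"
            unfolding nF using le1 by (intro mult_left_mono) auto
          also have "\<dots> \<le> B'" using growth(2)[of w] 1 by (simp add: B'_def)
          finally show ?thesis .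
        next
          case 3
          have "norm (F w) \<le> norm (f w) * 1"
            unfolding nF using le1 by (intro mult_left_mono) auto
          also have "\<dots> \<le> B'" using bnd[of w] 3 by (simp add: B'_def)
          finally show ?thesis .
        next
          case 2
          have "norm (F w) \<le> exp (A + A * sqrt R) * exp (- e * (c * R powr g))"
            unfolding nF using growth(2)[of w] cw 2 \<open>0 < e\<close> by (intro mult_mono) auto
          also have "\<dots> = exp (A + A * sqrt R - e * c * R powr g)"
            by (simp add: algebra_simps flip: exp_add)
          also have "\<dots> \<le> 1" using R by simp
          also have "\<dots> \<le> B'" by (simp add: B'_def)
          finally show ?thesis .
        qed
      qed
      then have "norm (f z) * exp (- e * Re (z powr of_real g)) \<le> B'"
        by (simp add: F_def norm_mult)
      then show ?thesis by (simp add: exp_minus field_simps)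
    qed
    have "((\<lambda>e. B' * exp (e * Re (z powr of_real g))) \<longlongrightarrow> B' * exp (0 * Re (z powr of_real g))) (at_right 0)"
      by (intro tendsto_intros)
    moreover have "\<forall>\<^sub>F e in at_right 0. norm (f z) \<le> B' * exp (e * Re (z powr of_real g))"
      using * by (auto simp: eventually_at_right_less intro: eventually_at_rightI[of 0 1])
    ultimately show ?thesis
      using tendsto_lowerbound[of _ _ "at_right 0" "norm (f z)"] by fastforce
  qed
  then have "bounded (range f)" by (auto simp: bounded_iff)
  then obtain C where "\<And>z. f z = C"
    using Liouville_theorem[OF hol] unfolding constant_on_def by auto
  then show ?thesis by simp
qed

section \<open>The differential expression\<close>

lemma abs_continuous_product_integral:
  fixes f g :: "real \<Rightarrow> complex"
  assumes f: "abs_continuous_on {c..d} f" and g: "abs_continuous_on {c..d} g" and "c \<le> d"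
    and f': "AE x in lebesgue. x \<in> {c..d} \<longrightarrow> (f has_vector_derivative f' x) (at x)"
    and g': "AE x in lebesgue. x \<in> {c..d} \<longrightarrow> (g has_vector_derivative g' x) (at x)"
  shows "((\<lambda>x. f x * g' x + f' x * g x) has_integral (f d * g d - f c * g c)) {c..d}"
proof (rule abs_continuous_fundamental_theorem[OF abs_continuous_on_mult[OF f g] \<open>c \<le> d\<close>])
  show "AE x in lebesgue. x \<in> {c..d} \<longrightarrow>
          ((\<lambda>x. f x * g x) has_vector_derivative f x * g' x + f' x * g x) (at x)"
    using f' g' by eventually_elim (simp add: has_vector_derivative_mult)
qed

lemma absolutely_integrable_continuous_mult:
  fixes h g :: "real \<Rightarrow> complex"
  assumes "continuous_on {c..d} h" "g absolutely_integrable_on {c..d}"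
  shows "(\<lambda>x. h x * g x) absolutely_integrable_on {c..d}"
proof (rule absolutely_integrable_bounded_measurable_product[where h = "(*)", OF _ _ _ _ assms(2)])
  show "bilinear ((*) :: complex \<Rightarrow> complex \<Rightarrow> complex)"
    by (rule bilinear_times)
  show "h \<in> borel_measurable (lebesgue_on {c..d})"
    by (intro continuous_imp_measurable_on_sets_lebesgue assms) auto
  show "bounded (h ` {c..d})"
    by (intro compact_imp_bounded compact_continuous_image assms) auto
qed auto

lemma absolutely_integrable_continuous_mult_real:
  fixes h g :: "real \<Rightarrow> real"
  assumes "continuous_on {c..d} h" "g absolutely_integrable_on {c..d}"
  shows "(\<lambda>x. h x * g x) absolutely_integrable_on {c..d}"
proof (rule absolutely_integrable_bounded_measurable_product_real[OF _ _ _ assms(2)])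
  show "h \<in> borel_measurable (lebesgue_on {c..d})"
    by (intro continuous_imp_measurable_on_sets_lebesgue assms) auto
  show "bounded (h ` {c..d})"
    by (intro compact_imp_bounded compact_continuous_image assms) auto
qed auto

lemma sl_expression_AE_iff:
  "sl_expression w p q I y u f \<longleftrightarrow> locally_abs_continuous I y \<and> locally_abs_continuous I u \<and>
     (AE x in lebesgue. x \<in> I \<longrightarrow>
        y differentiable (at x) \<and> u x = p x * vector_derivative y (at x) \<and> u differentiable (at x) \<and>
        f x = (- vector_derivative u (at x) + q x * y x) / complex_of_real (w x))"
  unfolding sl_expression_def quasi_derivative_def
  by (simp only: imp_conjR AE_conj_iff conj_assoc)

lemma AE_imp_subset:
  assumes "AE x in M. x \<in> I \<longrightarrow> P x" "J \<subseteq> I"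
  shows "AE x in M. x \<in> J \<longrightarrow> P x"
  using assms(1) by (rule eventually_mono) (use assms(2) in blast)

lemma sl_expression_subset:
  assumes "sl_expression w p q I y u f" "J \<subseteq> I"
  shows "sl_expression w p q J y u f"
  using assms AE_imp_subset[OF _ assms(2), where M = lebesgue]
  unfolding sl_expression_AE_iff locally_abs_continuous_def by (meson order_trans)

lemma sl_expression_cong_AE:
  assumes "sl_expression w p q I y u f" "AE x in lebesgue. x \<in> I \<longrightarrow> f x = g x"
  shows "sl_expression w p q I y u g"
proof -
  have "AE x in lebesgue. x \<in> I \<longrightarrow>
        u differentiable (at x) \<and>
        g x = (- vector_derivative u (at x) + q x * y x) / complex_of_real (w x)"
    using assms(1)[unfolded sl_expression_def, THEN conjunct2] assms(2)
    by eventually_elim auto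
  then show ?thesis using assms(1) unfolding sl_expression_def by blast
qed

lemma sl_expression_continuous:
  assumes "sl_expression w p q I y u f" "{c..d} \<subseteq> I"
  shows "continuous_on {c..d} y" "continuous_on {c..d} u"
    "abs_continuous_on {c..d} y" "abs_continuous_on {c..d} u"
proof -
  show *: "abs_continuous_on {c..d} y" "abs_continuous_on {c..d} u"
    using assms unfolding sl_expression_AE_iff locally_abs_continuous_def by blast+
  show "continuous_on {c..d} y" "continuous_on {c..d} u"
    using *[THEN abs_continuous_on_imp_continuous_on] .
qed

lemma sl_expression_lincomb:
  assumes y: "sl_expression w p q I y u f" and z: "sl_expression w p q I z v g"
  shows "sl_expression w p q I (\<lambda>x. k * y x + l * z x) (\<lambda>x. k * u x + l * v x) (\<lambda>x. k * f x + l * g x)"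
  unfolding sl_expression_AE_iff locally_abs_continuous_def
proof (intro conjI allI impI)
  fix c d assume "{c..d} \<subseteq> I"
  note * = sl_expression_continuous[OF y this] sl_expression_continuous[OF z this]
  show "abs_continuous_on {c..d} (\<lambda>x. k * y x + l * z x)"
    "abs_continuous_on {c..d} (\<lambda>x. k * u x + l * v x)"
    using * by (intro abs_continuous_on_add abs_continuous_on_cmult; simp)+
next
  have lin: "(\<lambda>x. k * h1 x + l * h2 x) differentiable at x \<and>
      vector_derivative (\<lambda>x. k * h1 x + l * h2 x) (at x) =
        k * vector_derivative h1 (at x) + l * vector_derivative h2 (at x)"
    if "h1 differentiable at x" "h2 differentiable at x" for h1 h2 :: "real \<Rightarrow> complex" and x
  proof -
    have "((\<lambda>x. k * h1 x + l * h2 x) has_vector_derivative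
        k * vector_derivative h1 (at x) + l * vector_derivative h2 (at x)) (at x)"
      using that by (intro has_vector_derivative_add has_vector_derivative_mult_right)
        (auto simp flip: vector_derivative_works)
    then show ?thesis by (auto intro: differentiableI_vector vector_derivative_at)
  qed
  have "AE x in lebesgue. x \<in> I \<longrightarrow>
        y differentiable (at x) \<and> u x = p x * vector_derivative y (at x) \<and> u differentiable (at x) \<and>
        f x = (- vector_derivative u (at x) + q x * y x) / complex_of_real (w x)"
    using y unfolding sl_expression_AE_iff by blast
  moreover have "AE x in lebesgue. x \<in> I \<longrightarrow>
        z differentiable (at x) \<and> v x = p x * vector_derivative z (at x) \<and> v differentiable (at x) \<and>
        g x = (- vector_derivative v (at x) + q x * z x) / complex_of_real (w x)"
    using z unfolding sl_expression_AE_iff by blast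
  ultimately show "AE x in lebesgue. x \<in> I \<longrightarrow>
        (\<lambda>x. k * y x + l * z x) differentiable (at x) \<and>
        k * u x + l * v x = p x * vector_derivative (\<lambda>x. k * y x + l * z x) (at x) \<and>
        (\<lambda>x. k * u x + l * v x) differentiable (at x) \<and>
        k * f x + l * g x = (- vector_derivative (\<lambda>x. k * u x + l * v x) (at x) + q x * (k * y x + l * z x)) / complex_of_real (w x)"
  proof (eventually_elim, intro impI)
    fix x
    assume elim: "x \<in> I \<longrightarrow>
        y differentiable (at x) \<and> u x = p x * vector_derivative y (at x) \<and> u differentiable (at x) \<and>
        f x = (- vector_derivative u (at x) + q x * y x) / complex_of_real (w x)"
      "x \<in> I \<longrightarrow>
        z differentiable (at x) \<and> v x = p x * vector_derivative z (at x) \<and> v differentiable (at x) \<and>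
        g x = (- vector_derivative v (at x) + q x * z x) / complex_of_real (w x)"
      and "x \<in> I"
    then have d: "y differentiable (at x)" "u differentiable (at x)" "z differentiable (at x)" "v differentiable (at x)"
      and e: "u x = p x * vector_derivative y (at x)" "v x = p x * vector_derivative z (at x)"
        "f x = (- vector_derivative u (at x) + q x * y x) / complex_of_real (w x)"
        "g x = (- vector_derivative v (at x) + q x * z x) / complex_of_real (w x)"
      using elim by blast+
    have "k * f x + l * g x = (- (k * vector_derivative u (at x) + l * vector_derivative v (at x)) + q x * (k * y x + l * z x)) / complex_of_real (w x)"
      unfolding e(3,4) times_divide_eq_right add_divide_distrib[symmetric] by (simp add: algebra_simps)
    then show "(\<lambda>x. k * y x + l * z x) differentiable (at x) \<and>
        k * u x + l * v x = p x * vector_derivative (\<lambda>x. k * y x + l * z x) (at x) \<and>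
        (\<lambda>x. k * u x + l * v x) differentiable (at x) \<and>
        k * f x + l * g x = (- vector_derivative (\<lambda>x. k * u x + l * v x) (at x) + q x * (k * y x + l * z x)) / complex_of_real (w x)"
      using lin[OF d(1,3)] lin[OF d(2,4)] e(1,2) by (simp add: algebra_simps)
  qed
qed

locale sturm_liouville =
  fixes w :: "real \<Rightarrow> real" and p q :: "real \<Rightarrow> complex" and I :: "real set"
  assumes w_pos: "AE x in lebesgue. x \<in> I \<longrightarrow> 0 < w x"
    and p_nz: "AE x in lebesgue. x \<in> I \<longrightarrow> p x \<noteq> 0"
    and w_int: "locally_integrable I w"
    and p_int: "locally_integrable I (\<lambda>x. 1 / p x)"
    and q_int: "locally_integrable I q"
begin

lemma coefficients_integrable:
  assumes "{c..d} \<subseteq> I"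
  shows "w absolutely_integrable_on {c..d}" "(\<lambda>x. 1 / p x) absolutely_integrable_on {c..d}"
    "q absolutely_integrable_on {c..d}" "(\<lambda>x. complex_of_real (w x)) absolutely_integrable_on {c..d}"
    "(\<lambda>x. cmod (1 / p x)) absolutely_integrable_on {c..d}"
    "(\<lambda>x. cmod (q x)) absolutely_integrable_on {c..d}"
    "(\<lambda>x. \<bar>w x\<bar>) absolutely_integrable_on {c..d}"
proof -
  show *: "w absolutely_integrable_on {c..d}" "(\<lambda>x. 1 / p x) absolutely_integrable_on {c..d}"
    "q absolutely_integrable_on {c..d}"
    using assms w_int p_int q_int unfolding locally_integrable_def by auto
  show "(\<lambda>x. complex_of_real (w x)) absolutely_integrable_on {c..d}"
    using absolutely_integrable_linear[OF *(1) bounded_linear_of_real] by (simp add: o_def)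
  show "(\<lambda>x. cmod (1 / p x)) absolutely_integrable_on {c..d}"
    "(\<lambda>x. cmod (q x)) absolutely_integrable_on {c..d}"
    "(\<lambda>x. \<bar>w x\<bar>) absolutely_integrable_on {c..d}"
    using *[THEN absolutely_integrable_norm] by (simp_all add: o_def)
qed

lemma sl_expression_AE:
  assumes "sl_expression w p q J y u f" "J \<subseteq> I"
  shows "AE x in lebesgue. x \<in> J \<longrightarrow> 0 < w x \<and> p x \<noteq> 0 \<and> u x = p x * vector_derivative y (at x) \<and>
           (y has_vector_derivative u x / p x) (at x) \<and>
           (u has_vector_derivative q x * y x - complex_of_real (w x) * f x) (at x)"
  using w_pos p_nz assms(1)[unfolded sl_expression_AE_iff, THEN conjunct2, THEN conjunct2]
proof (eventually_elim, intro impI)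
  fix x
  assume elim: "x \<in> I \<longrightarrow> 0 < w x" "x \<in> I \<longrightarrow> p x \<noteq> 0" "x \<in> J \<longrightarrow>
        y differentiable (at x) \<and> u x = p x * vector_derivative y (at x) \<and> u differentiable (at x) \<and>
        f x = (- vector_derivative u (at x) + q x * y x) / complex_of_real (w x)" and "x \<in> J"
  then have x: "0 < w x" "p x \<noteq> 0" "y differentiable at x" "u x = p x * vector_derivative y (at x)"
    "u differentiable at x" "f x = (- vector_derivative u (at x) + q x * y x) / complex_of_real (w x)"
    using elim assms(2) by auto
  have "u x / p x = vector_derivative y (at x)" "q x * y x - complex_of_real (w x) * f x = vector_derivative u (at x)"
    using x by (auto simp: field_simps)
  then show "0 < w x \<and> p x \<noteq> 0 \<and> u x = p x * vector_derivative y (at x) \<and>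
           (y has_vector_derivative u x / p x) (at x) \<and>
           (u has_vector_derivative q x * y x - complex_of_real (w x) * f x) (at x)"
    using x(1-5) by (simp add: vector_derivative_works)
qed

lemma sl_expression_has_derivative_AE:
  assumes "sl_expression w p q J y u f" "J \<subseteq> I" "{c..d} \<subseteq> J"
  shows "AE x in lebesgue. x \<in> {c..d} \<longrightarrow> (y has_vector_derivative u x / p x) (at x)"
    "AE x in lebesgue. x \<in> {c..d} \<longrightarrow>
       (u has_vector_derivative q x * y x - complex_of_real (w x) * f x) (at x)"
proof -
  note * = AE_imp_subset[OF sl_expression_AE[OF assms(1,2)] assms(3)]
  show "AE x in lebesgue. x \<in> {c..d} \<longrightarrow> (y has_vector_derivative u x / p x) (at x)"
    using * by (rule eventually_mono) blast
  show "AE x in lebesgue. x \<in> {c..d} \<longrightarrow>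
       (u has_vector_derivative q x * y x - complex_of_real (w x) * f x) (at x)"
    using * by (rule eventually_mono) blast
qed

lemma sl_expression_integral:
  assumes y: "sl_expression w p q J y u f" "J \<subseteq> I" "{c..d} \<subseteq> J" "c \<le> d"
  shows "((\<lambda>x. u x / p x) has_integral (y d - y c)) {c..d}"
    "((\<lambda>x. q x * y x - complex_of_real (w x) * f x) has_integral (u d - u c)) {c..d}"
  using abs_continuous_fundamental_theorem[OF sl_expression_continuous(3)[OF y(1,3)] y(4)
          sl_expression_has_derivative_AE(1)[OF y(1-3)]]
        abs_continuous_fundamental_theorem[OF sl_expression_continuous(4)[OF y(1,3)] y(4)
          sl_expression_has_derivative_AE(2)[OF y(1-3)]] .

text \<open>In the derivative of y v - u z the terms with 1 / p cancel, and so do those with q; only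
  the right-hand sides f and g, weighted by w, survive.\<close>

lemma lagrange_identity:
  assumes y: "sl_expression w p q J y u f" and z: "sl_expression w p q J z v g"
    and J: "J \<subseteq> I" "{c..d} \<subseteq> J" "c \<le> d"
  shows "((\<lambda>x. complex_of_real (w x) * (f x * z x - y x * g x)) has_integral
           (sl_bracket y u z v d - sl_bracket y u z v c)) {c..d}"
proof -
  note cy = sl_expression_continuous[OF y J(2)] and cz = sl_expression_continuous[OF z J(2)]
  note dy = sl_expression_has_derivative_AE[OF y J(1,2)] and dz = sl_expression_has_derivative_AE[OF z J(1,2)]
  have "((\<lambda>x. (y x * (q x * z x - complex_of_real (w x) * g x) + u x / p x * v x) -
               (u x * (v x / p x) + (q x * y x - complex_of_real (w x) * f x) * z x))
      has_integral ((y d * v d - y c * v c) - (u d * z d - u c * z c))) {c..d}"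
    by (intro has_integral_diff abs_continuous_product_integral[OF cy(3) cz(4) J(3) dy(1) dz(2)]
          abs_continuous_product_integral[OF cy(4) cz(3) J(3) dy(2) dz(1)])
  moreover have "(y x * (q x * z x - complex_of_real (w x) * g x) + u x / p x * v x) -
      (u x * (v x / p x) + (q x * y x - complex_of_real (w x) * f x) * z x) =
      complex_of_real (w x) * (f x * z x - y x * g x)" for x
    by (simp add: algebra_simps)
  moreover have "(y d * v d - y c * v c) - (u d * z d - u c * z c) =
      sl_bracket y u z v d - sl_bracket y u z v c"
    by (simp add: sl_bracket_def)
  ultimately show ?thesis by simp
qed

text \<open>Integration by parts for u times the conjugate of y. Where p is nonzero, u conj(u / p) =
  p |u / p|^2; rotating by \<open>cis \<eta>\<close> and taking real parts will make this term
  nonnegative for an admissible pair.\<close>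

lemma energy_identity:
  assumes y: "sl_expression w p q J y u f" and J: "J \<subseteq> I" "{c..d} \<subseteq> J" "c \<le> d"
  shows "((\<lambda>x. u x * cnj (u x / p x) + (q x * y x - complex_of_real (w x) * f x) * cnj (y x)) has_integral
           (u d * cnj (y d) - u c * cnj (y c))) {c..d}"
proof (rule abs_continuous_product_integral[OF _ abs_continuous_on_cnj J(3)])
  show "abs_continuous_on {c..d} u" "abs_continuous_on {c..d} y"
    using sl_expression_continuous[OF y J(2)] by auto
  show "AE x in lebesgue. x \<in> {c..d} \<longrightarrow> (u has_vector_derivative q x * y x - complex_of_real (w x) * f x) (at x)"
    by (rule sl_expression_has_derivative_AE[OF y J(1,2)])
  show "AE x in lebesgue. x \<in> {c..d} \<longrightarrow> ((\<lambda>x. cnj (y x)) has_vector_derivative cnj (u x / p x)) (at x)"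
    using sl_expression_has_derivative_AE(1)[OF y J(1,2)]
    by (rule eventually_mono) (blast intro: has_vector_derivative_cnj)
qed

lemma wronskian_constant:
  assumes "sl_solution w p q J l y u" "sl_solution w p q J l z v" "J \<subseteq> I" "{c..d} \<subseteq> J" "c \<le> d"
  shows "sl_bracket y u z v d = sl_bracket y u z v c"
proof -
  have "((\<lambda>x. 0) has_integral (sl_bracket y u z v d - sl_bracket y u z v c)) {c..d}"
    by (rule has_integral_eq[OF _ lagrange_identity[OF assms(1,2)[unfolded sl_solution_def] assms(3-5)]])
       (simp add: algebra_simps)
  then show ?thesis by (simp add: has_integral_0_eq)
qed

end

section \<open>Dependence of solutions on the spectral parameter\<close>

lemma continuous_mult_integral_bound:
  fixes h g :: "real \<Rightarrow> complex"
  assumes h: "continuous_on {c..d} h" and g: "g absolutely_integrable_on {c..d}"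
    and M: "\<And>x. x \<in> {c..d} \<Longrightarrow> norm (h x) \<le> M" and x: "x \<in> {c..d}"
  shows "norm (integral {c..x} (\<lambda>x. h x * g x)) \<le> M * integral {c..d} (\<lambda>x. norm (g x))"
proof -
  have sub: "{c..x} \<subseteq> {c..d}" using x by auto
  have "0 \<le> M" using M[OF x] norm_ge_zero[of "h x"] by linarith
  have ng: "(\<lambda>x. norm (g x)) absolutely_integrable_on {c..d}"
    using absolutely_integrable_norm[OF g] by (simp add: o_def)
  have hg: "(\<lambda>x. h x * g x) absolutely_integrable_on {c..x}"
    by (intro absolutely_integrable_continuous_mult continuous_on_subset[OF h sub]
        absolutely_integrable_on_subinterval[OF g sub])
  have 1: "(\<lambda>x. norm (g x)) integrable_on {c..x}"
    using absolutely_integrable_on_subinterval[OF ng sub] set_lebesgue_integral_eq_integral(1) by blast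
  have "norm (integral {c..x} (\<lambda>x. h x * g x)) \<le> integral {c..x} (\<lambda>x. M * norm (g x))"
  proof (rule integral_norm_bound_integral)
    show "(\<lambda>x. h x * g x) integrable_on {c..x}"
      using hg set_lebesgue_integral_eq_integral(1) by blast
    show "norm (h y * g y) \<le> M * norm (g y)" if "y \<in> {c..x}" for y
      using M[of y] that sub by (auto simp: norm_mult intro: mult_right_mono)
  qed (use 1 in \<open>intro integrable_on_mult_right\<close>)
  also have "\<dots> = M * integral {c..x} (\<lambda>x. norm (g x))" by simp
  also have "\<dots> \<le> M * integral {c..d} (\<lambda>x. norm (g x))"
    using sub \<open>0 \<le> M\<close> 1 ng set_lebesgue_integral_eq_integral(1)
    by (intro mult_left_mono integral_subset_le) auto
  finally show ?thesis .
qed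

text \<open>A quadratic remainder, uniform in x, expresses complex differentiability in l in a form
  that survives integration over S.\<close>

definition uniformly_differentiable_family :: "real set \<Rightarrow> (real \<Rightarrow> complex \<Rightarrow> complex) \<Rightarrow> bool" where
  "uniformly_differentiable_family S F \<longleftrightarrow>
     (\<forall>l. continuous_on S (\<lambda>x. F x l)) \<and>
     (\<forall>l. \<exists>D C \<delta>. continuous_on S D \<and> 0 < \<delta> \<and>
        (\<forall>l'. norm (l' - l) < \<delta> \<longrightarrow> (\<forall>x\<in>S. norm (F x l' - F x l - (l' - l) * D x) \<le> C * (norm (l' - l))\<^sup>2)))"

lemma has_field_derivative_quadratic_error:
  fixes f :: "complex \<Rightarrow> complex"
  assumes "0 < \<delta>" and bound: "\<And>l'. norm (l' - l) < \<delta> \<Longrightarrow> norm (f l' - f l - (l' - l) * D) \<le> C * (norm (l' - l))\<^sup>2"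
  shows "(f has_field_derivative D) (at l)"
  unfolding has_field_derivative_def has_derivative_at_alt
proof (intro conjI allI impI)
  show "bounded_linear ((*) D)" by (rule bounded_linear_mult_right)
  fix e :: real assume "0 < e"
  define C' where "C' = max C 1"
  show "\<exists>d>0. \<forall>y. norm (y - l) < d \<longrightarrow> norm (f y - f l - D * (y - l)) \<le> e * norm (y - l)"
  proof (intro exI[of _ "min \<delta> (e / C')"] conjI allI impI)
    fix y assume y: "norm (y - l) < min \<delta> (e / C')"
    have "norm (f y - f l - D * (y - l)) \<le> C * (norm (y - l))\<^sup>2"
      using bound[of y] y by (simp add: mult.commute)
    also have "\<dots> \<le> (C' * norm (y - l)) * norm (y - l)"
      by (simp add: C'_def power2_eq_square mult.assoc mult_right_mono)
    also have "\<dots> \<le> e * norm (y - l)"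
      using y by (intro mult_right_mono) (auto simp: C'_def field_simps)
    finally show "norm (f y - f l - D * (y - l)) \<le> e * norm (y - l)" .
  qed (use \<open>0 < \<delta>\<close> \<open>0 < e\<close> in \<open>auto simp: C'_def\<close>)
qed

lemma uniformly_differentiable_family_holomorphic:
  assumes "uniformly_differentiable_family S F" "x \<in> S"
  shows "F x holomorphic_on A"
proof -
  have "\<exists>D. (F x has_field_derivative D) (at l)" for l
  proof -
    obtain D C \<delta> where "0 < \<delta>" "\<And>l'. norm (l' - l) < \<delta> \<Longrightarrow> \<forall>x\<in>S. norm (F x l' - F x l - (l' - l) * D x) \<le> C * (norm (l' - l))\<^sup>2"
      using assms(1) unfolding uniformly_differentiable_family_def by metis
    then have "(F x has_field_derivative D x) (at l)"
      using assms(2) by (intro has_field_derivative_quadratic_error[of \<delta>]) auto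
    then show ?thesis ..
  qed
  then show ?thesis
    by (meson field_differentiable_def field_differentiable_at_within holomorphic_on_def)
qed

lemma uniformly_differentiable_family_lipschitz:
  assumes "uniformly_differentiable_family {c..d} F"
  obtains C \<delta> where "0 < \<delta>" "0 < C"
    "\<And>l' x. norm (l' - l) < \<delta> \<Longrightarrow> x \<in> {c..d} \<Longrightarrow> norm (F x l' - F x l) \<le> C * norm (l' - l)"
proof -
  obtain D C \<delta> where D: "continuous_on {c..d} D" "0 < \<delta>"
     "\<And>l'. norm (l' - l) < \<delta> \<Longrightarrow> \<forall>x\<in>{c..d}. norm (F x l' - F x l - (l' - l) * D x) \<le> C * (norm (l' - l))\<^sup>2"
    using assms(1) unfolding uniformly_differentiable_family_def by metis
  have "bounded (D ` {c..d})"
    by (intro compact_imp_bounded compact_continuous_image D) auto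
  then obtain B where B: "0 < B" "\<And>x. x \<in> {c..d} \<Longrightarrow> norm (D x) \<le> B"
    unfolding bounded_pos by auto
  show thesis
  proof (rule that[of "min \<delta> 1" "\<bar>C\<bar> + B"])
    fix l' x assume l': "norm (l' - l) < min \<delta> 1" and x: "x \<in> {c..d}"
    have "norm (F x l' - F x l) \<le> norm (F x l' - F x l - (l' - l) * D x) + norm ((l' - l) * D x)"
      using norm_triangle_ineq[of "F x l' - F x l - (l' - l) * D x" "(l' - l) * D x"] by simp
    also have "\<dots> \<le> C * (norm (l' - l))\<^sup>2 + norm (l' - l) * B"
      using D(3)[of l'] l' x B by (intro add_mono) (auto simp: norm_mult intro: mult_left_mono)
    also have "C * (norm (l' - l))\<^sup>2 \<le> \<bar>C\<bar> * norm (l' - l)"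
      using l' unfolding power2_eq_square by (intro mult_mono mult_left_le) auto
    finally show "norm (F x l' - F x l) \<le> (\<bar>C\<bar> + B) * norm (l' - l)"
      by (simp add: algebra_simps)
  qed (use D B in auto)
qed

text \<open>Integrated against g, the quadratic remainder stays quadratic, with the integral of D g
  as derivative.\<close>

lemma uniformly_differentiable_family_integral_holomorphic:
  assumes F: "uniformly_differentiable_family {c..d} F" and g: "g absolutely_integrable_on {c..d}" and "c \<le> d"
  shows "(\<lambda>l. integral {c..d} (\<lambda>x. F x l * g x)) holomorphic_on A"
proof -
  have int: "(\<lambda>x. h x * g x) integrable_on {c..d}" if "continuous_on {c..d} h" for h
    using absolutely_integrable_continuous_mult[OF that g] set_lebesgue_integral_eq_integral(1) by blast
  have "\<exists>D. ((\<lambda>l. integral {c..d} (\<lambda>x. F x l * g x)) has_field_derivative D) (at l)" for l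
  proof -
    obtain D C \<delta> where D: "continuous_on {c..d} D" "0 < \<delta>"
       "\<And>l'. norm (l' - l) < \<delta> \<Longrightarrow> \<forall>x\<in>{c..d}. norm (F x l' - F x l - (l' - l) * D x) \<le> C * (norm (l' - l))\<^sup>2"
      using F unfolding uniformly_differentiable_family_def by metis
    have c: "continuous_on {c..d} (\<lambda>x. F x l)" for l
      using F unfolding uniformly_differentiable_family_def by blast
    have "((\<lambda>l. integral {c..d} (\<lambda>x. F x l * g x)) has_field_derivative integral {c..d} (\<lambda>x. D x * g x)) (at l)"
    proof (rule has_field_derivative_quadratic_error[OF D(2)])
      fix l' assume l': "norm (l' - l) < \<delta>"
      have "integral {c..d} (\<lambda>x. F x l' * g x) - integral {c..d} (\<lambda>x. F x l * g x) - (l' - l) * integral {c..d} (\<lambda>x. D x * g x)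
        = integral {c..d} (\<lambda>x. F x l' * g x - F x l * g x - (l' - l) * (D x * g x))"
        using int[OF c[of l']] int[OF c[of l]] int[OF D(1)]
        by (simp add: integral_diff integral_mult_right integrable_diff integrable_on_mult_right)
      also have "\<dots> = integral {c..d} (\<lambda>x. (F x l' - F x l - (l' - l) * D x) * g x)"
        by (simp add: algebra_simps)
      also have "norm \<dots> \<le> C * (norm (l' - l))\<^sup>2 * integral {c..d} (\<lambda>x. norm (g x))"
        using D(3)[OF l'] \<open>c \<le> d\<close>
        by (intro continuous_mult_integral_bound[OF _ g] continuous_intros c D) auto
      finally show "norm (integral {c..d} (\<lambda>x. F x l' * g x) - integral {c..d} (\<lambda>x. F x l * g x) -
          (l' - l) * integral {c..d} (\<lambda>x. D x * g x)) \<le> C * integral {c..d} (\<lambda>x. norm (g x)) * (norm (l' - l))\<^sup>2"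
        by (simp add: algebra_simps)
    qed
    then show ?thesis ..
  qed
  then show ?thesis
    by (meson field_differentiable_def field_differentiable_at_within holomorphic_on_def)
qed

section \<open>The fundamental system and variation of constants\<close>

locale sl_fundamental = sturm_liouville w p q I for w p q I +
  fixes a :: real and \<alpha> :: complex
    and \<theta> \<theta>1 \<phi> \<phi>1 :: "real \<Rightarrow> complex \<Rightarrow> complex"
  assumes I_interval: "is_interval I" and a_least: "a \<in> I" "\<And>x. x \<in> I \<Longrightarrow> a \<le> x"
    and theta_sol: "\<And>l. sl_solution w p q I l (\<lambda>x. \<theta> x l) (\<lambda>x. \<theta>1 x l)"
    and theta_init: "\<And>l. \<theta> a l = cos \<alpha>" "\<And>l. \<theta>1 a l = sin \<alpha>"
    and phi_sol: "\<And>l. sl_solution w p q I l (\<lambda>x. \<phi> x l) (\<lambda>x. \<phi>1 x l)"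
    and phi_init: "\<And>l. \<phi> a l = sin \<alpha>" "\<And>l. \<phi>1 a l = - cos \<alpha>"
begin

lemma interval_subset: "is_interval J \<Longrightarrow> c \<in> J \<Longrightarrow> d \<in> J \<Longrightarrow> {c..d} \<subseteq> J"
  for c d :: real
  unfolding is_interval_1 by (meson atLeastAtMost_iff subsetI)

lemma initial_interval: "x \<in> I \<Longrightarrow> {a..x} \<subseteq> I"
  using interval_subset[OF I_interval a_least(1)] .

lemma bracket_constant:
  assumes "sl_solution w p q J l y u" "sl_solution w p q J l z v" "J \<subseteq> I" "is_interval J" "c \<in> J" "d \<in> J"
  shows "sl_bracket y u z v d = sl_bracket y u z v c"
  using wronskian_constant[OF assms(1-3)] interval_subset[OF assms(4)] assms(5,6)
  by (metis nle_le)

lemma solution_restrict: "sl_solution w p q J l y u \<Longrightarrow> J' \<subseteq> J \<Longrightarrow> sl_solution w p q J' l y u"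
  unfolding sl_solution_def by (rule sl_expression_subset)

text \<open>Constancy of the bracket reduces this to x = a, where sin^2 + cos^2 = 1 holds for
  complex \<alpha> as well.\<close>

lemma theta_phi_bracket:
  assumes "x \<in> I"
  shows "\<theta> x l * \<phi>1 x l - \<theta>1 x l * \<phi> x l = - 1"
proof -
  have "sl_bracket (\<lambda>x. \<theta> x l) (\<lambda>x. \<theta>1 x l) (\<lambda>x. \<phi> x l) (\<lambda>x. \<phi>1 x l) x =
      sl_bracket (\<lambda>x. \<theta> x l) (\<lambda>x. \<theta>1 x l) (\<lambda>x. \<phi> x l) (\<lambda>x. \<phi>1 x l) a"
    by (rule bracket_constant[OF theta_sol phi_sol order_refl I_interval a_least(1) assms])
  also have "\<dots> = - (cos \<alpha> * cos \<alpha> + sin \<alpha> * sin \<alpha>)"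
    unfolding sl_bracket_def theta_init phi_init
    by (simp only: mult_minus_right minus_add_distrib diff_conv_add_uminus)
  also have "cos \<alpha> * cos \<alpha> + sin \<alpha> * sin \<alpha> = 1"
    by (metis add.commute power2_eq_square sin_cos_squared_add)
  finally show ?thesis unfolding sl_bracket_def .
qed

text \<open>Cramer's rule with determinant -1. It is stated for arbitrary numbers y and u, so that
  it also applies to a difference of solutions belonging to two different parameters.\<close>

lemma expand_in_theta_phi:
  assumes "x \<in> I"
  shows "y = - (y * \<phi>1 x l - u * \<phi> x l) * \<theta> x l + (y * \<theta>1 x l - u * \<theta> x l) * \<phi> x l"
    "u = - (y * \<phi>1 x l - u * \<phi> x l) * \<theta>1 x l + (y * \<theta>1 x l - u * \<theta> x l) * \<phi>1 x l"
proof -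
  have "- (y * \<phi>1 x l - u * \<phi> x l) * \<theta> x l + (y * \<theta>1 x l - u * \<theta> x l) * \<phi> x l =
      - y * (\<theta> x l * \<phi>1 x l - \<theta>1 x l * \<phi> x l)"
    by (simp add: algebra_simps)
  then show "y = - (y * \<phi>1 x l - u * \<phi> x l) * \<theta> x l + (y * \<theta>1 x l - u * \<theta> x l) * \<phi> x l"
    using theta_phi_bracket[OF assms] by simp
  have "- (y * \<phi>1 x l - u * \<phi> x l) * \<theta>1 x l + (y * \<theta>1 x l - u * \<theta> x l) * \<phi>1 x l =
      - u * (\<theta> x l * \<phi>1 x l - \<theta>1 x l * \<phi> x l)"
    by (simp add: algebra_simps)
  then show "u = - (y * \<phi>1 x l - u * \<phi> x l) * \<theta>1 x l + (y * \<theta>1 x l - u * \<theta> x l) * \<phi>1 x l"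
    using theta_phi_bracket[OF assms] by simp
qed

text \<open>The coefficients are brackets of y with \<phi> and \<theta>, hence constant on J. The
  base point c is free because J will also be a tail of I that does not contain a.\<close>

lemma solution_expansion:
  assumes y: "sl_solution w p q J l y u" and J: "J \<subseteq> I" "is_interval J" "c \<in> J"
  obtains A B where "\<And>x. x \<in> J \<Longrightarrow> y x = A * \<theta> x l + B * \<phi> x l"
    "\<And>x. x \<in> J \<Longrightarrow> u x = A * \<theta>1 x l + B * \<phi>1 x l"
    "A = - (y c * \<phi>1 c l - u c * \<phi> c l)" "B = y c * \<theta>1 c l - u c * \<theta> c l"
proof -
  define A B where "A = - (y c * \<phi>1 c l - u c * \<phi> c l)" and "B = y c * \<theta>1 c l - u c * \<theta> c l"
  have *: "y x * \<phi>1 x l - u x * \<phi> x l = - A \<and> y x * \<theta>1 x l - u x * \<theta> x l = B" if "x \<in> J" for x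
    using bracket_constant[OF y solution_restrict[OF phi_sol J(1)] J that]
      bracket_constant[OF y solution_restrict[OF theta_sol J(1)] J that]
    by (simp add: A_def B_def sl_bracket_def)
  have "y x = A * \<theta> x l + B * \<phi> x l \<and> u x = A * \<theta>1 x l + B * \<phi>1 x l" if "x \<in> J" for x
  proof -
    from that J have "x \<in> I" by blast
    note expand_in_theta_phi[OF this, where y = "y x" and u = "u x" and l = l,
      unfolded *[OF that, THEN conjunct1] *[OF that, THEN conjunct2]]
    then show ?thesis by simp
  qed
  then show thesis using that A_def B_def by blast
qed

text \<open>Variation of constants, with the potential perturbed by \<open>(l' - l) w\<close>.\<close>

lemma solution_perturbation:
  assumes Y: "\<And>l. sl_solution w p q I l (\<lambda>x. Y x l) (\<lambda>x. U x l)"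
    and init: "\<And>l. Y a l = Y0" "\<And>l. U a l = U0" and x: "x \<in> I"
  shows "Y x l' - Y x l = (l' - l) *
      (\<phi> x l * integral {a..x} (\<lambda>t. Y t l' * \<theta> t l * of_real (w t)) -
       \<theta> x l * integral {a..x} (\<lambda>t. Y t l' * \<phi> t l * of_real (w t)))"
    "U x l' - U x l = (l' - l) *
      (\<phi>1 x l * integral {a..x} (\<lambda>t. Y t l' * \<theta> t l * of_real (w t)) -
       \<theta>1 x l * integral {a..x} (\<lambda>t. Y t l' * \<phi> t l * of_real (w t)))"
proof -
  \<comment> \<open>Lagrange's identity for Y(.,l') against a solution z at l. The data at a do not
    depend on the parameter, so the bracket at a is also that of Y(.,l) with z, which is constant
    and can be moved to x.\<close>
  have *: "(Y x l' - Y x l) * z1 x - (U x l' - U x l) * z x =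
      (l' - l) * integral {a..x} (\<lambda>t. Y t l' * z t * of_real (w t))"
    if z: "sl_solution w p q I l z z1" for z z1
  proof -
    have "((\<lambda>t. complex_of_real (w t) * (l' * Y t l' * z t - Y t l' * (l * z t))) has_integral
        (sl_bracket (\<lambda>x. Y x l') (\<lambda>x. U x l') z z1 x - sl_bracket (\<lambda>x. Y x l') (\<lambda>x. U x l') z z1 a)) {a..x}"
      using lagrange_identity[OF Y[unfolded sl_solution_def] z[unfolded sl_solution_def] order_refl
          initial_interval[OF x] a_least(2)[OF x]] .
    moreover have "sl_bracket (\<lambda>x. Y x l') (\<lambda>x. U x l') z z1 a = sl_bracket (\<lambda>x. Y x l) (\<lambda>x. U x l) z z1 x"
      using bracket_constant[OF Y[of l] z order_refl I_interval a_least(1) x]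
      by (simp add: sl_bracket_def init)
    moreover have "(\<lambda>t. complex_of_real (w t) * (l' * Y t l' * z t - Y t l' * (l * z t))) =
        (\<lambda>t. (l' - l) * (Y t l' * z t * of_real (w t)))"
      by (simp add: algebra_simps)
    ultimately have "((\<lambda>t. (l' - l) * (Y t l' * z t * of_real (w t))) has_integral
        (sl_bracket (\<lambda>x. Y x l') (\<lambda>x. U x l') z z1 x - sl_bracket (\<lambda>x. Y x l) (\<lambda>x. U x l) z z1 x)) {a..x}"
      by simp
    from integral_unique[OF this, unfolded integral_mult_right] show ?thesis
      by (simp add: sl_bracket_def algebra_simps)
  qed
  note e = expand_in_theta_phi[OF x, where l = l and y = "Y x l' - Y x l" and u = "U x l' - U x l"]
  show "Y x l' - Y x l = (l' - l) *
      (\<phi> x l * integral {a..x} (\<lambda>t. Y t l' * \<theta> t l * of_real (w t)) -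
       \<theta> x l * integral {a..x} (\<lambda>t. Y t l' * \<phi> t l * of_real (w t)))"
    using e(1) unfolding *[OF theta_sol] *[OF phi_sol] by (simp add: algebra_simps)
  show "U x l' - U x l = (l' - l) *
      (\<phi>1 x l * integral {a..x} (\<lambda>t. Y t l' * \<theta> t l * of_real (w t)) -
       \<theta>1 x l * integral {a..x} (\<lambda>t. Y t l' * \<phi> t l * of_real (w t)))"
    using e(2) unfolding *[OF theta_sol] *[OF phi_sol] by (simp add: algebra_simps)
qed

lemma solution_continuous:
  assumes "sl_solution w p q I l y u" "c \<in> I"
  shows "continuous_on {a..c} y" "continuous_on {a..c} u"
  using sl_expression_continuous[OF assms(1)[unfolded sl_solution_def] initial_interval[OF assms(2)]] by auto

text \<open>The variation of constants formula has Y(.,l') on its right-hand side, so it is used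
  three times: to bound Y(.,l') near l by absorption, to obtain a Lipschitz estimate from this
  bound, and, after replacing Y(.,l') by Y(.,l) under the integrals, to obtain the quadratic
  remainder.\<close>

lemma solution_family_uniformly_differentiable:
  assumes Y: "\<And>l. sl_solution w p q I l (\<lambda>x. Y x l) (\<lambda>x. U x l)"
    and init: "\<And>l. Y a l = Y0" "\<And>l. U a l = U0" and c: "c \<in> I"
  shows "uniformly_differentiable_family {a..c} Y" "uniformly_differentiable_family {a..c} U"
proof -
  define g where "g t = complex_of_real (w t)" for t
  define W where "W = integral {a..c} (\<lambda>t. norm (g t))"
  have g: "g absolutely_integrable_on {a..c}"
    unfolding g_def using coefficients_integrable[OF initial_interval[OF c]] by simp
  have W: "0 \<le> W" unfolding W_def by (intro integral_nonneg) (use absolutely_integrable_norm[OF g] set_lebesgue_integral_eq_integral(1) in \<open>auto simp: o_def\<close>)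
  have xI: "x \<in> I" if "x \<in> {a..c}" for x using initial_interval[OF c] that by blast
  note cY = solution_continuous[OF Y c] and ct = solution_continuous[OF theta_sol c]
    and cp = solution_continuous[OF phi_sol c]
  have bdd: "\<exists>S>0. \<forall>x\<in>{a..c}. norm (f x) \<le> S" if "continuous_on {a..c} f" for f :: "real \<Rightarrow> complex"
    using compact_imp_bounded[OF compact_continuous_image[OF that]] unfolding bounded_pos by auto
  \<comment> \<open>\<open>F\<close> stands for the solution or its quasi-derivative; the two
    formulas differ only in the outer factors \<open>P\<close> and \<open>T\<close>, while the
    integrals always contain Y.\<close>
  have approx: "\<exists>D C \<delta>. continuous_on {a..c} D \<and> 0 < \<delta> \<and>
        (\<forall>l'. norm (l' - l) < \<delta> \<longrightarrow> (\<forall>x\<in>{a..c}. norm (F x l' - F x l - (l' - l) * D x) \<le> C * (norm (l' - l))\<^sup>2))"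
    if vp: "\<And>l l' x. x \<in> I \<Longrightarrow> F x l' - F x l = (l' - l) *
      (P x l * integral {a..x} (\<lambda>t. Y t l' * \<theta> t l * of_real (w t)) -
       T x l * integral {a..x} (\<lambda>t. Y t l' * \<phi> t l * of_real (w t)))"
    and cont: "continuous_on {a..c} (\<lambda>x. P x l)" "continuous_on {a..c} (\<lambda>x. T x l)" for F P T l
  proof -
    note vp' = vp[folded g_def] and vY = solution_perturbation(1)[OF Y init, folded g_def]
    obtain St where St: "St > 0" "\<And>x. x \<in> {a..c} \<Longrightarrow> norm (\<theta> x l) \<le> St" using bdd[OF ct(1)] by blast
    obtain Sp where Sp: "Sp > 0" "\<And>x. x \<in> {a..c} \<Longrightarrow> norm (\<phi> x l) \<le> Sp" using bdd[OF cp(1)] by blast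
    obtain SP where SP: "SP > 0" "\<And>x. x \<in> {a..c} \<Longrightarrow> norm (P x l) \<le> SP" using bdd[OF cont(1)] by blast
    obtain ST where ST: "ST > 0" "\<And>x. x \<in> {a..c} \<Longrightarrow> norm (T x l) \<le> ST" using bdd[OF cont(2)] by blast
    obtain SY where SY: "SY > 0" "\<And>x. x \<in> {a..c} \<Longrightarrow> norm (Y x l) \<le> SY" using bdd[OF cY(1)] by blast
    define A where "A = Sp * (St * W) + St * (Sp * W)"
    define B where "B = SP * (St * W) + ST * (Sp * W)"
    have AB: "0 \<le> A" "0 \<le> B" unfolding A_def B_def using W St Sp SP ST by auto
    have intb: "norm (integral {a..x} (\<lambda>t. h t * z t * g t)) \<le> M * (S * W)"
      if "continuous_on {a..c} h" "continuous_on {a..c} z" "\<And>x. x \<in> {a..c} \<Longrightarrow> norm (h x) \<le> M"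
        "\<And>x. x \<in> {a..c} \<Longrightarrow> norm (z x) \<le> S" "x \<in> {a..c}" for h z :: "real \<Rightarrow> complex" and M S x
    proof -
      have *: "norm (h t * z t) \<le> M * S" if "t \<in> {a..c}" for t
        unfolding norm_mult using that \<open>\<And>x. x \<in> {a..c} \<Longrightarrow> norm (h x) \<le> M\<close>[OF that]
          \<open>\<And>x. x \<in> {a..c} \<Longrightarrow> norm (z x) \<le> S\<close>[OF that]
        by (intro mult_mono order_trans[OF norm_ge_zero]) auto
      then show ?thesis
        using continuous_mult_integral_bound[OF continuous_on_mult[OF that(1,2)] g * that(5)]
        unfolding W_def by (simp add: mult.assoc)
    qed
    have estA: "norm (\<phi> x l * integral {a..x} (\<lambda>t. h t * \<theta> t l * g t) - \<theta> x l * integral {a..x} (\<lambda>t. h t * \<phi> t l * g t)) \<le> A * M"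
      if h: "continuous_on {a..c} h" "\<And>x. x \<in> {a..c} \<Longrightarrow> norm (h x) \<le> M" and x: "x \<in> {a..c}" for h M x
    proof -
      have "norm (\<phi> x l * integral {a..x} (\<lambda>t. h t * \<theta> t l * g t) - \<theta> x l * integral {a..x} (\<lambda>t. h t * \<phi> t l * g t))
         \<le> Sp * (M * (St * W)) + St * (M * (Sp * W))"
        by (intro order_trans[OF norm_triangle_ineq4] add_mono order_trans[OF norm_mult_ineq] mult_mono
            intb[OF h(1) ct(1) h(2) St(2) x] intb[OF h(1) cp(1) h(2) Sp(2) x] Sp(2)[OF x] St(2)[OF x])
          (use Sp St in auto)
      then show ?thesis by (simp add: A_def algebra_simps)
    qed
    have estB: "norm (P x l * integral {a..x} (\<lambda>t. h t * \<theta> t l * g t) - T x l * integral {a..x} (\<lambda>t. h t * \<phi> t l * g t)) \<le> B * M"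
      if h: "continuous_on {a..c} h" "\<And>x. x \<in> {a..c} \<Longrightarrow> norm (h x) \<le> M" and x: "x \<in> {a..c}" for h M x
    proof -
      have "norm (P x l * integral {a..x} (\<lambda>t. h t * \<theta> t l * g t) - T x l * integral {a..x} (\<lambda>t. h t * \<phi> t l * g t))
         \<le> SP * (M * (St * W)) + ST * (M * (Sp * W))"
        by (intro order_trans[OF norm_triangle_ineq4] add_mono order_trans[OF norm_mult_ineq] mult_mono
            intb[OF h(1) ct(1) h(2) St(2) x] intb[OF h(1) cp(1) h(2) Sp(2) x] SP(2)[OF x] ST(2)[OF x])
          (use SP ST in auto)
      then show ?thesis by (simp add: B_def algebra_simps)
    qed
    define D where "D x = P x l * integral {a..x} (\<lambda>t. Y t l * \<theta> t l * g t) - T x l * integral {a..x} (\<lambda>t. Y t l * \<phi> t l * g t)" for x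
    have int: "(\<lambda>t. h t * z t * g t) integrable_on {a..x}"
      if "continuous_on {a..c} h" "continuous_on {a..c} z" "x \<in> {a..c}" for h z x
    proof -
      have "(\<lambda>t. h t * z t * g t) absolutely_integrable_on {a..c}"
        using absolutely_integrable_continuous_mult[OF continuous_on_mult[OF that(1,2)] g] .
      then have "(\<lambda>t. h t * z t * g t) absolutely_integrable_on {a..x}"
        using that(3) by (elim absolutely_integrable_on_subinterval) auto
      then show ?thesis using set_lebesgue_integral_eq_integral(1) by blast
    qed
    have contD: "continuous_on {a..c} D" unfolding D_def
      using int[OF cY(1) ct(1)] int[OF cY(1) cp(1)] a_least(2)[OF c]
      by (intro continuous_intros cont indefinite_integral_continuous_1) auto
    \<comment> \<open>Within this radius |l' - l| A \<le> 1/2, so the term containing the maximum of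
      |Y(.,l')| can be absorbed into the left-hand side.\<close>
    define \<delta> where "\<delta> = 1 / (2 * (A + 1))"
    have \<delta>: "0 < \<delta>" using AB by (simp add: \<delta>_def)
    have main: "norm (F x l' - F x l - (l' - l) * D x) \<le> (B * (A * (2 * SY))) * (norm (l' - l))\<^sup>2"
      if l': "norm (l' - l) < \<delta>" and x: "x \<in> {a..c}" for l' x
    proof -
      obtain S' where S': "\<And>x. x \<in> {a..c} \<Longrightarrow> norm (Y x l') \<le> S'" using bdd[OF cY(1)[of l']] by blast
      have small: "norm (l' - l) * A \<le> 1/2"
      proof -
        have "norm (l' - l) * A \<le> \<delta> * (A + 1)" using l' AB \<delta> by (intro mult_mono) auto
        also have "\<dots> = 1/2" using AB by (simp add: \<delta>_def)
        finally show ?thesis .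
      qed
      have step: "norm (Y x l' - Y x l) \<le> norm (l' - l) * (A * M)"
        if "\<And>x. x \<in> {a..c} \<Longrightarrow> norm (Y x l') \<le> M" "x \<in> {a..c}" for M x
        unfolding vY[OF xI[OF that(2)], of l' l] norm_mult
        by (intro mult_left_mono estA[OF cY(1) that]) auto
      have ex: "\<exists>m\<in>{a..c}. \<forall>x\<in>{a..c}. norm (Y x l') \<le> norm (Y m l')"
        using continuous_attains_sup[of "{a..c}" "\<lambda>x. norm (Y x l')"] a_least(2)[OF c] continuous_on_norm[OF cY(1)[of l']] by auto
      then obtain m where m: "m \<in> {a..c}" "\<And>x. x \<in> {a..c} \<Longrightarrow> norm (Y x l') \<le> norm (Y m l')" by blast
      have "norm (Y m l') \<le> norm (Y m l) + norm (Y m l' - Y m l)"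
        using norm_triangle_ineq[of "Y m l" "Y m l' - Y m l"] by simp
      also have "\<dots> \<le> SY + norm (l' - l) * (A * norm (Y m l'))"
        using SY(2)[OF m(1)] step[OF m(2) m(1)] by simp
      also have "\<dots> \<le> SY + (1/2) * norm (Y m l')"
        using mult_right_mono[OF small, of "norm (Y m l')"] by (simp add: mult.assoc)
      finally have m2: "norm (Y m l') \<le> 2 * SY" by simp
      then have Y2: "norm (Y x l') \<le> 2 * SY" if "x \<in> {a..c}" for x using m(2)[OF that] by linarith
      have diff: "norm (Y x l' - Y x l) \<le> norm (l' - l) * (A * (2 * SY))" if "x \<in> {a..c}" for x
        using step[OF Y2 that] .
      have "F x l' - F x l - (l' - l) * D x = (l' - l) *
          (P x l * (integral {a..x} (\<lambda>t. Y t l' * \<theta> t l * g t) - integral {a..x} (\<lambda>t. Y t l * \<theta> t l * g t)) -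
           T x l * (integral {a..x} (\<lambda>t. Y t l' * \<phi> t l * g t) - integral {a..x} (\<lambda>t. Y t l * \<phi> t l * g t)))"
        unfolding vp'[OF xI[OF x], of l' l] D_def by (simp only: right_diff_distrib) simp
      also have "integral {a..x} (\<lambda>t. Y t l' * \<theta> t l * g t) - integral {a..x} (\<lambda>t. Y t l * \<theta> t l * g t) =
          integral {a..x} (\<lambda>t. (Y t l' - Y t l) * \<theta> t l * g t)"
        unfolding left_diff_distrib by (rule integral_diff[symmetric]; intro int cY ct x)
      also have "integral {a..x} (\<lambda>t. Y t l' * \<phi> t l * g t) - integral {a..x} (\<lambda>t. Y t l * \<phi> t l * g t) =
          integral {a..x} (\<lambda>t. (Y t l' - Y t l) * \<phi> t l * g t)"
        unfolding left_diff_distrib by (rule integral_diff[symmetric]; intro int cY cp x)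
      finally have "norm (F x l' - F x l - (l' - l) * D x) \<le> norm (l' - l) * (B * (norm (l' - l) * (A * (2 * SY))))"
        using estB[OF continuous_on_diff[OF cY(1)[of l'] cY(1)[of l]] diff x]
        by (simp only: norm_mult) (intro mult_left_mono; simp)
      then show ?thesis by (simp add: power2_eq_square algebra_simps)
    qed
    show ?thesis using contD \<delta> main by blast
  qed
  show "uniformly_differentiable_family {a..c} Y"
    unfolding uniformly_differentiable_family_def
    using cY(1) approx[OF solution_perturbation(1)[OF Y init] cp(1) ct(1)] by blast
  show "uniformly_differentiable_family {a..c} U"
    unfolding uniformly_differentiable_family_def
    using cY(2) approx[OF solution_perturbation(2)[OF Y init] cp(2) ct(2)] by blast
qed

lemmas theta_family = solution_family_uniformly_differentiable[OF theta_sol theta_init]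
lemmas phi_family = solution_family_uniformly_differentiable[OF phi_sol phi_init]

end

section \<open>Growth of solutions and boundary values\<close>

lemma continuous_AE_zero_imp_zero:
  fixes h :: "real \<Rightarrow> complex"
  assumes h: "continuous_on {c..d} h" and "c < d" and ae: "AE x in lebesgue. x \<in> {c..d} \<longrightarrow> h x = 0"
    and x: "x \<in> {c..d}"
  shows "h x = 0"
proof -
  obtain N where N: "negligible N" "\<And>x. x \<notin> N \<Longrightarrow> x \<in> {c..d} \<Longrightarrow> h x = 0"
    using AE_lebesgue_negligibleE[OF ae] by metis
  have "((\<lambda>x. cmod (h x)) has_integral 0) {c..d}"
    by (rule has_integral_spike[OF N(1) _ has_integral_0]) (use N in auto)
  then have "cmod (h x) = 0"
    using has_integral_0_cbox_imp_0[of c d "\<lambda>x. cmod (h x)" x] h x \<open>c < d\<close>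
    by (auto intro: continuous_intros)
  then show ?thesis by simp
qed

lemma square_norm_add_le: "(cmod (x + y))\<^sup>2 \<le> 2 * (cmod x)\<^sup>2 + 2 * (cmod y)\<^sup>2"
proof -
  have "(cmod (x + y))\<^sup>2 \<le> (cmod x + cmod y)\<^sup>2"
    by (intro power_mono norm_triangle_ineq) auto
  also have "\<dots> \<le> 2 * (cmod x)\<^sup>2 + 2 * (cmod y)\<^sup>2"
    using sum_squares_bound[of "cmod x" "cmod y"] by (simp add: power2_eq_square algebra_simps)
  finally show ?thesis .
qed

lemma nonneg_has_integral_0_AE:
  fixes f :: "real \<Rightarrow> real"
  assumes f: "(f has_integral 0) S" and nonneg: "\<And>x. x \<in> S \<Longrightarrow> 0 \<le> f x"
  shows "AE x in lebesgue. x \<in> S \<longrightarrow> f x = 0"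
proof -
  have ai: "set_integrable lebesgue S f"
    using f nonneg by (intro nonnegative_absolutely_integrable_1) auto
  then have "integral\<^sup>L lebesgue (\<lambda>x. indicator S x *\<^sub>R f x) = 0"
    using set_lebesgue_integral_eq_integral(2)[OF ai] integral_unique[OF f]
    by (simp add: set_lebesgue_integral_def)
  then have "AE x in lebesgue. indicator S x *\<^sub>R f x = 0"
    using ai nonneg unfolding set_integrable_def
    by (subst (asm) integral_nonneg_eq_0_iff_AE) (auto simp: indicator_def)
  then show ?thesis by (rule eventually_mono) (auto simp: indicator_def)
qed

section \<open>Weighted mean squares and increments on compact intervals\<close>

context sturm_liouville
begin

text \<open>The absolute value makes the integrand nonnegative at every point, whereas w is positive
  only almost everywhere.\<close>

definition weighted_square :: "real \<Rightarrow> real \<Rightarrow> (real \<Rightarrow> complex) \<Rightarrow> real" where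
  "weighted_square c d h = integral {c..d} (\<lambda>t. \<bar>w t\<bar> * (cmod (h t))\<^sup>2)"

lemma coefficients_integrable_on:
  assumes "{c..d} \<subseteq> I"
  shows "(\<lambda>x. cmod (1 / p x)) integrable_on {c..d}" "(\<lambda>x. cmod (q x)) integrable_on {c..d}"
    "(\<lambda>x. \<bar>w x\<bar>) integrable_on {c..d}"
  using coefficients_integrable[OF assms] set_lebesgue_integral_eq_integral(1) by blast+

lemma weighted_integrable_on:
  assumes "continuous_on {c..d} h" "{c..d} \<subseteq> I"
  shows "(\<lambda>t. \<bar>w t\<bar> * h t) integrable_on {c..d}"
  using absolutely_integrable_continuous_mult_real[OF assms(1) coefficients_integrable(7)[OF assms(2)]]
    set_lebesgue_integral_eq_integral(1) by (fastforce simp: mult.commute)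

lemma weighted_square_integrable_on:
  assumes "continuous_on {c..d} h" "{c..d} \<subseteq> I"
  shows "(\<lambda>t. \<bar>w t\<bar> * (cmod (h t))\<^sup>2) integrable_on {c..d}"
  by (intro weighted_integrable_on continuous_intros assms)

lemma weighted_square_nonneg:
  assumes "continuous_on {c..d} h" "{c..d} \<subseteq> I"
  shows "0 \<le> weighted_square c d h"
  unfolding weighted_square_def by (intro integral_nonneg weighted_square_integrable_on assms) auto

lemma weighted_square_add_le:
  assumes "continuous_on {c..d} h" "continuous_on {c..d} k" "{c..d} \<subseteq> I"
  shows "weighted_square c d (\<lambda>t. h t + k t) \<le> 2 * weighted_square c d h + 2 * weighted_square c d k"
proof -
  have "weighted_square c d (\<lambda>t. h t + k t) \<le>
      integral {c..d} (\<lambda>t. 2 * (\<bar>w t\<bar> * (cmod (h t))\<^sup>2) + 2 * (\<bar>w t\<bar> * (cmod (k t))\<^sup>2))"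
    unfolding weighted_square_def
  proof (rule integral_le)
    fix t
    show "\<bar>w t\<bar> * (cmod (h t + k t))\<^sup>2 \<le> 2 * (\<bar>w t\<bar> * (cmod (h t))\<^sup>2) + 2 * (\<bar>w t\<bar> * (cmod (k t))\<^sup>2)"
      using mult_left_mono[OF square_norm_add_le[of "h t" "k t"] abs_ge_zero[of "w t"]] by (simp add: algebra_simps)
  qed (intro weighted_square_integrable_on continuous_intros integrable_add integrable_on_mult_right assms)+
  also have "\<dots> = 2 * weighted_square c d h + 2 * weighted_square c d k"
    unfolding weighted_square_def
    using weighted_square_integrable_on[OF assms(1,3)] weighted_square_integrable_on[OF assms(2,3)]
    by (simp add: integral_add integral_mult_right integrable_on_mult_right)
  finally show ?thesis .
qed

lemma weight_integral_pos:
  assumes "c < d" "{c..d} \<subseteq> I"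
  shows "0 < integral {c..d} (\<lambda>t. \<bar>w t\<bar>)" "0 < integral {c..d} (\<lambda>t. cmod (1 / p t))"
proof -
  have *: "0 < integral {c..d} g" if g: "g integrable_on {c..d}" "\<And>t. 0 \<le> g t"
    "AE x in lebesgue. x \<in> I \<longrightarrow> g x \<noteq> 0" for g :: "real \<Rightarrow> real"
  proof (rule ccontr)
    assume "\<not> 0 < integral {c..d} g"
    then have "integral {c..d} g = 0" using integral_nonneg[OF g(1)] g(2) by fastforce
    then have "(g has_integral 0) {c..d}" using g(1) by (metis integrable_integral)
    then have "AE x in lebesgue. x \<in> {c..d} \<longrightarrow> g x = 0"
      using g(2) by (intro nonneg_has_integral_0_AE)
    with g(3) have "AE x in lebesgue. x \<notin> {c..d}"
      by eventually_elim (use assms in blast)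
    then have "negligible {c..d}"
      by (simp add: AE_iff_null_sets negligible_iff_null_sets)
    then show False using \<open>c < d\<close> negligible_interval(1)[of c d] by simp
  qed
  show "0 < integral {c..d} (\<lambda>t. \<bar>w t\<bar>)"
    using w_pos by (intro * coefficients_integrable_on assms) (auto elim: eventually_mono)
  show "0 < integral {c..d} (\<lambda>t. cmod (1 / p t))"
    using p_nz by (intro * coefficients_integrable_on assms) (auto elim: eventually_mono)
qed

lemma weighted_square_eq_0D:
  assumes h: "continuous_on {c..d} h" and cd: "c < d" "{c..d} \<subseteq> I" and 0: "weighted_square c d h = 0"
    and x: "x \<in> {c..d}"
  shows "h x = 0"
proof (rule continuous_AE_zero_imp_zero[OF h \<open>c < d\<close> _ x])
  have "((\<lambda>t. \<bar>w t\<bar> * (cmod (h t))\<^sup>2) has_integral 0) {c..d}"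
    using 0 weighted_square_integrable_on[OF h cd(2)] unfolding weighted_square_def
    by (metis integrable_integral)
  then have "AE x in lebesgue. x \<in> {c..d} \<longrightarrow> \<bar>w x\<bar> * (cmod (h x))\<^sup>2 = 0"
    by (rule nonneg_has_integral_0_AE) auto
  with w_pos show "AE x in lebesgue. x \<in> {c..d} \<longrightarrow> h x = 0"
    by eventually_elim (use cd(2) in auto)
qed

text \<open>From y = 0 the relation y' = u / p gives u = 0 almost everywhere, by continuity
  everywhere, and then u' = q y - w f gives f = 0. It serves both to identify quasi-derivatives and
  to make right-hand sides vanish.\<close>

lemma sl_expression_zero:
  assumes y: "sl_expression w p q J y u f" and J: "J \<subseteq> I" "{c..d} \<subseteq> J" "c < d"
    and zero: "\<And>x. x \<in> {c..d} \<Longrightarrow> y x = 0"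
  shows "\<And>x. x \<in> {c..d} \<Longrightarrow> u x = 0" "AE x in lebesgue. x \<in> {c..d} \<longrightarrow> f x = 0"
proof -
  have N: "negligible {c, d}" by simp
  \<comment> \<open>The derivatives are two-sided and y is not known to vanish beyond the interval,
    so the endpoints are discarded.\<close>
  then have ends: "AE x in lebesgue. x \<notin> {c, d}"
    unfolding negligible_iff_null_sets by (rule AE_not_in)
  have der: "(h has_vector_derivative 0) (at x)" if "\<And>x. x \<in> {c..d} \<Longrightarrow> h x = 0" "x \<in> {c<..<d}" for h :: "real \<Rightarrow> complex" and x
    by (rule has_vector_derivative_transform_within_open[of "\<lambda>x. 0" _ _ "{c<..<d}"]) (use that in auto)
  have "AE x in lebesgue. x \<in> {c..d} \<longrightarrow> u x = 0"
    using sl_expression_AE[OF y J(1)] ends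
  proof (eventually_elim, intro impI)
    fix x assume x: "x \<in> J \<longrightarrow> 0 < w x \<and> p x \<noteq> 0 \<and> u x = p x * vector_derivative y (at x) \<and>
           (y has_vector_derivative u x / p x) (at x) \<and>
           (u has_vector_derivative q x * y x - complex_of_real (w x) * f x) (at x)"
       "x \<notin> {c, d}" "x \<in> {c..d}"
    then have "u x / p x = 0"
      using der[of y x] zero J by (intro vector_derivative_unique_at[of y _ x]) auto
    then show "u x = 0" using x J by auto
  qed
  then show u0: "u x = 0" if "x \<in> {c..d}" for x
    using continuous_AE_zero_imp_zero[OF sl_expression_continuous(2)[OF y J(2)] J(3)] that by blast
  show "AE x in lebesgue. x \<in> {c..d} \<longrightarrow> f x = 0"
    using sl_expression_AE[OF y J(1)] ends
  proof (eventually_elim, intro impI)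
    fix x assume x: "x \<in> J \<longrightarrow> 0 < w x \<and> p x \<noteq> 0 \<and> u x = p x * vector_derivative y (at x) \<and>
           (y has_vector_derivative u x / p x) (at x) \<and>
           (u has_vector_derivative q x * y x - complex_of_real (w x) * f x) (at x)"
       "x \<notin> {c, d}" "x \<in> {c..d}"
    then have "q x * y x - complex_of_real (w x) * f x = 0"
      using der[of u x] u0 J by (intro vector_derivative_unique_at[of u _ x]) auto
    then show "f x = 0" using x J zero[of x] by auto
  qed
qed

lemma increment_bounds:
  assumes y: "sl_expression w p q J y u f" and J: "J \<subseteq> I" "{c..d} \<subseteq> J" "c \<le> d"
    and bounds: "\<And>t. t \<in> {c..d} \<Longrightarrow> cmod (u t) \<le> U" "\<And>t. t \<in> {c..d} \<Longrightarrow> cmod (y t) \<le> Y"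
      "\<And>t. t \<in> {c..d} \<Longrightarrow> cmod (f t) \<le> F"
  shows "cmod (y d - y c) \<le> U * integral {c..d} (\<lambda>t. cmod (1 / p t))"
    "cmod (u d - u c) \<le> Y * integral {c..d} (\<lambda>t. cmod (q t)) + F * integral {c..d} (\<lambda>t. \<bar>w t\<bar>)"
proof -
  have cd: "{c..d} \<subseteq> I" using J by blast
  note int = sl_expression_integral[OF y J] and ci = coefficients_integrable_on[OF cd]
  have "cmod (integral {c..d} (\<lambda>x. u x / p x)) \<le> integral {c..d} (\<lambda>t. U * cmod (1 / p t))"
  proof (rule integral_norm_bound_integral)
    show "(\<lambda>x. u x / p x) integrable_on {c..d}" using int(1) by blast
    show "cmod (u x / p x) \<le> U * cmod (1 / p x)" if "x \<in> {c..d}" for x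
      using bounds(1)[OF that] by (simp add: norm_divide divide_right_mono)
  qed (intro integrable_on_mult_right ci)
  then show "cmod (y d - y c) \<le> U * integral {c..d} (\<lambda>t. cmod (1 / p t))"
    using integral_unique[OF int(1)] by simp
  have "cmod (integral {c..d} (\<lambda>x. q x * y x - complex_of_real (w x) * f x))
      \<le> integral {c..d} (\<lambda>t. Y * cmod (q t) + F * \<bar>w t\<bar>)"
  proof (rule integral_norm_bound_integral)
    show "(\<lambda>x. q x * y x - complex_of_real (w x) * f x) integrable_on {c..d}" using int(2) by blast
    show "cmod (q x * y x - complex_of_real (w x) * f x) \<le> Y * cmod (q x) + F * \<bar>w x\<bar>" if "x \<in> {c..d}" for x
    proof -
      have "cmod (q x * y x - complex_of_real (w x) * f x) \<le> cmod (q x) * cmod (y x) + \<bar>w x\<bar> * cmod (f x)"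
        by (metis norm_mult norm_of_real norm_triangle_ineq4)
      also have "\<dots> \<le> cmod (q x) * Y + \<bar>w x\<bar> * F"
        using bounds(2,3)[OF that] by (intro add_mono mult_left_mono) auto
      finally show ?thesis by (simp add: mult.commute)
    qed
  qed (intro integrable_add integrable_on_mult_right ci)
  also have "\<dots> = Y * integral {c..d} (\<lambda>t. cmod (q t)) + F * integral {c..d} (\<lambda>t. \<bar>w t\<bar>)"
    using ci by (simp add: integral_add integral_mult_right integrable_on_mult_right)
  finally show "cmod (u d - u c) \<le> Y * integral {c..d} (\<lambda>t. cmod (q t)) + F * integral {c..d} (\<lambda>t. \<bar>w t\<bar>)"
    using integral_unique[OF int(2)] by simp
qed

text \<open>Scaling \<open>y\<close> by \<open>k \<approx> sqrt \<bar>l\<bar>\<close> balances the two components of the system, which is what makes the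
  growth of solutions of order one half in \<open>l\<close>.\<close>

lemma solution_growth_step:
  assumes y: "sl_solution w p q J l y u" and J: "J \<subseteq> I" "{s..x} \<subseteq> J" "s \<le> x"
    and k: "1 \<le> k" "cmod l \<le> k\<^sup>2"
    and small: "k * integral {s..x} (\<lambda>t. cmod (1 / p t) + cmod (q t) + \<bar>w t\<bar>) \<le> 1 / 2"
  shows "k * cmod (y x) + cmod (u x) \<le> 2 * (k * cmod (y s) + cmod (u s))"
proof -
  define V where "V t = k * cmod (y t) + cmod (u t)" for t
  define P Q W where "P m = integral {s..m} (\<lambda>t. cmod (1 / p t))" and "Q m = integral {s..m} (\<lambda>t. cmod (q t))"
    and "W m = integral {s..m} (\<lambda>t. \<bar>w t\<bar>)" for m
  note ye = y[unfolded sl_solution_def]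
  note cont = sl_expression_continuous(1,2)[OF ye J(2)]
  have "continuous_on {s..x} V" unfolding V_def by (intro continuous_intros cont)
  \<comment> \<open>This takes the place of Gronwall's inequality: at the maximum m of V the
    integrated system gives V m \<le> V s + V m / 2.\<close>
  then obtain m where m: "m \<in> {s..x}" "\<And>t. t \<in> {s..x} \<Longrightarrow> V t \<le> V m"
    using continuous_attains_sup[of "{s..x}" V] J by auto
  have sm: "s \<le> m" "{s..m} \<subseteq> {s..x}" using m by auto
  have sm': "{s..m} \<subseteq> J" "{s..m} \<subseteq> I" using sm(2) J by blast+
  have sxI: "{s..x} \<subseteq> I" using J by blast
  have bu: "cmod (u t) \<le> V m" and by': "cmod (y t) \<le> V m / k" and bf: "cmod (l * y t) \<le> k * V m" if "t \<in> {s..m}" for t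
  proof -
    have "k * cmod (y t) + cmod (u t) \<le> V m" using m(2)[of t] sm that by (auto simp: V_def)
    moreover have "0 \<le> k * cmod (y t)" using k by simp
    ultimately have "cmod (u t) \<le> V m" "k * cmod (y t) \<le> V m"
      using norm_ge_zero[of "u t"] by linarith+
    then show "cmod (u t) \<le> V m" and *: "cmod (y t) \<le> V m / k"
      using k by (auto simp: field_simps)
    have "cmod l * cmod (y t) \<le> k\<^sup>2 * (V m / k)" using k * by (intro mult_mono) auto
    then show "cmod (l * y t) \<le> k * V m" using k by (simp add: norm_mult power2_eq_square)
  qed
  note inc = increment_bounds[OF ye J(1) sm'(1) sm(1) bu by' bf, folded P_def Q_def W_def]
  have Vm: "0 \<le> V m" using k by (simp add: V_def)
  have int: "integral {s..m} (\<lambda>t. cmod (1 / p t) + cmod (q t) + \<bar>w t\<bar>) = P m + Q m + W m"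
    unfolding P_def Q_def W_def using coefficients_integrable_on[OF sm'(2)]
    by (simp add: integral_add integrable_add)
  have nonneg: "0 \<le> P m" "0 \<le> Q m" "0 \<le> W m"
    unfolding P_def Q_def W_def using coefficients_integrable_on[OF sm'(2)] by (auto intro: integral_nonneg)
  have "P m + Q m + W m \<le> integral {s..x} (\<lambda>t. cmod (1 / p t) + cmod (q t) + \<bar>w t\<bar>)"
    unfolding int[symmetric] by (intro integral_subset_le sm sm' integrable_add coefficients_integrable_on sxI) auto
  then have small': "k * (P m + Q m + W m) \<le> 1 / 2"
    using small k by (smt (verit) mult_left_mono)
  have "V m \<le> V s + (k * cmod (y m - y s) + cmod (u m - u s))"
    using norm_triangle_ineq[of "y s" "y m - y s"] norm_triangle_ineq[of "u s" "u m - u s"] k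
      mult_left_mono[of "cmod (y m)" "cmod (y s) + cmod (y m - y s)" k]
    by (simp add: V_def algebra_simps)
  also have "k * cmod (y m - y s) \<le> k * (V m * P m)"
    using inc(1) k by (intro mult_left_mono) auto
  also have "cmod (u m - u s) \<le> k * (V m * Q m) + k * (V m * W m)"
  proof -
    have "V m / k \<le> V m" "V m \<le> V m * k"
      using k Vm by (auto simp: divide_le_eq mult_le_cancel_left1)
    then have "V m / k * Q m \<le> V m * k * Q m"
      using nonneg by (intro mult_right_mono) linarith+
    then show ?thesis using inc(2) by (simp add: algebra_simps)
  qed
  also have "V s + (k * (V m * P m) + (k * (V m * Q m) + k * (V m * W m))) = V s + (k * (P m + Q m + W m)) * V m"
    by (simp add: algebra_simps)
  also have "\<dots> \<le> V s + (1/2) * V m"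
    using small' Vm by (intro add_left_mono mult_right_mono) auto
  finally have "V m \<le> 2 * V s" by simp
  moreover have "V x \<le> V m" using m(2)[of x] J by simp
  ultimately show ?thesis by (simp add: V_def)
qed

end

context sturm_liouville
begin

text \<open>V at most doubles while \<open>k * G\<close> grows by 1/2, and \<open>k * G\<close> ends
  at \<open>k * L\<close> with k = 1 + sqrt |l|. The number of doublings is therefore about 2 k L,
  which is linear in sqrt |l|.\<close>

lemma solution_growth:
  assumes J: "{a..c} \<subseteq> I" "a \<le> c" and "0 \<le> C"
  obtains A where "0 \<le> A"
    "\<And>l y u x. sl_solution w p q {a..c} l y u \<Longrightarrow> cmod (y a) \<le> C \<Longrightarrow> cmod (u a) \<le> C \<Longrightarrow> x \<in> {a..c} \<Longrightarrow>
       cmod (y x) \<le> exp (A + A * sqrt (cmod l)) \<and> cmod (u x) \<le> exp (A + A * sqrt (cmod l))"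
proof -
  define g where "g t = cmod (1 / p t) + cmod (q t) + \<bar>w t\<bar>" for t
  define G where "G x = integral {a..x} g" for x
  have g: "g integrable_on {a..c}" unfolding g_def
    by (intro integrable_add coefficients_integrable_on J)
  have gsub: "g integrable_on {s..x}" if "a \<le> s" "x \<le> c" for s x
    using g that by (elim integrable_on_subinterval) auto
  have G_diff: "integral {s..x} g = G x - G s" if "a \<le> s" "s \<le> x" "x \<le> c" for s x
    using Henstock_Kurzweil_Integration.integral_combine[OF that(1,2) gsub[of a x]] that unfolding G_def by simp
  have G_mono: "G s \<le> G x" if "a \<le> s" "s \<le> x" "x \<le> c" for s x
    using G_diff[OF that] integral_nonneg[OF gsub[of s x]] that by (simp add: g_def)
  have G0: "G a = 0" "0 \<le> G c" using G_mono[of a c] J by (auto simp: G_def)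
  define L where "L = G c"
  \<comment> \<open>The constant part of the exponent is 2 L + 2 from the doublings, 1 from the
    estimate 1 + k \<le> exp k, and C from C \<le> exp C. The coefficient of sqrt |l| is only 2 L +
    1.\<close>
  define A where "A = 2 * L + 3 + C"
  show thesis
  proof (rule that[of A])
    show "0 \<le> A" using G0 \<open>0 \<le> C\<close> by (simp add: A_def L_def)
    fix l y u x
    assume y: "sl_solution w p q {a..c} l y u" and init: "cmod (y a) \<le> C" "cmod (u a) \<le> C" and x: "x \<in> {a..c}"
    define k where "k = 1 + sqrt (cmod l)"
    have k: "1 \<le> k" "cmod l \<le> k\<^sup>2" by (auto simp: k_def power2_eq_square algebra_simps)
    define V where "V t = k * cmod (y t) + cmod (u t)" for t
    have V: "0 \<le> V t" for t using k by (simp add: V_def)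
    have step: "V x \<le> 2 * V s" if "a \<le> s" "s \<le> x" "x \<le> c" "k * (G x - G s) \<le> 1/2" for s x
      unfolding V_def using that
      by (intro solution_growth_step[OF y J(1) _ that(2) k]) (auto simp: G_diff[unfolded g_def])
    have claim: "\<forall>x\<in>{a..c}. k * G x \<le> (real n + 1) / 2 \<longrightarrow> V x \<le> 2 ^ (n + 1) * V a" for n
    proof (induction n)
      case 0
      show ?case using step[of a] G0 by auto
    next
      case (Suc n)
      show ?case
      proof (intro ballI impI)
        fix x assume x: "x \<in> {a..c}" and le: "k * G x \<le> (real (Suc n) + 1) / 2"
        show "V x \<le> 2 ^ (Suc n + 1) * V a"
        proof (cases "k * G x \<le> (real n + 1) / 2")
          case True
          then have "V x \<le> 2 ^ (n + 1) * V a" using Suc x by blast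
          also have "\<dots> \<le> 2 ^ (Suc n + 1) * V a" using V by (intro mult_right_mono) auto
          finally show ?thesis .
        next
          case False
          have "continuous_on {a..x} (\<lambda>t. k * G t)"
            unfolding G_def using x
            by (intro continuous_intros indefinite_integral_continuous_1 gsub) auto
          \<comment> \<open>The point where the budget of the induction hypothesis is exactly used
            up; between it and x the function \<open>k * G\<close> grows by at most 1/2.\<close>
          then obtain s where s: "a \<le> s" "s \<le> x" "k * G s = (real n + 1) / 2"
            using IVT'[of "\<lambda>t. k * G t" a "(real n + 1) / 2" x] False x G0 by auto
          have "V x \<le> 2 * V s"
            using s x le by (intro step) (auto simp: algebra_simps)
          also have "V s \<le> 2 ^ (n + 1) * V a" using Suc s x by auto
          finally show ?thesis by simp
        qed
      qed
    qed
    define n where "n = nat \<lceil>2 * k * L\<rceil>"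
    have kL: "0 \<le> k * L" using k G0 by (simp add: L_def)
    have n: "2 * k * L \<le> real n" "real n \<le> 2 * k * L + 1"
      using kL by (auto simp: n_def of_nat_nat)
    have "k * G x \<le> k * L" using x k G_mono[of x c] by (intro mult_left_mono) (auto simp: L_def)
    also have "\<dots> \<le> (real n + 1) / 2" using n by simp
    finally have "V x \<le> 2 ^ (n + 1) * V a" using claim x by blast
    also have "\<dots> \<le> exp (2 * k * L + 2) * (exp (1 + sqrt (cmod l)) * exp C)"
    proof (intro mult_mono)
      have "(2::real) ^ (n + 1) \<le> exp 1 ^ (n + 1)"
        using exp_ge_add_one_self[of 1] by (intro power_mono) auto
      also have "\<dots> = exp (real (n + 1))" by (metis exp_of_nat_mult mult.right_neutral)
      also have "\<dots> \<le> exp (2 * k * L + 2)" using n by simp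
      finally show "(2::real) ^ (n + 1) \<le> exp (2 * k * L + 2)" .
      have "V a \<le> k * C + C" unfolding V_def using init k by (intro add_mono mult_left_mono) auto
      also have "\<dots> = (1 + (1 + sqrt (cmod l))) * C" by (simp add: k_def algebra_simps)
      also have "\<dots> \<le> exp (1 + sqrt (cmod l)) * exp C"
      proof (intro mult_mono exp_ge_add_one_self)
        show "C \<le> exp C" using exp_ge_add_one_self[of C] by linarith
      qed (use \<open>0 \<le> C\<close> in auto)
      finally show "V a \<le> exp (1 + sqrt (cmod l)) * exp C" .
    qed (use V in auto)
    also have "\<dots> = exp (A + (2 * L + 1) * sqrt (cmod l))"
      by (simp add: A_def k_def algebra_simps flip: exp_add)
    also have "\<dots> \<le> exp (A + A * sqrt (cmod l))"
      using \<open>0 \<le> C\<close> by (simp add: A_def mult_right_mono)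
    finally have *: "V x \<le> exp (A + A * sqrt (cmod l))" .
    moreover have "cmod (y x) \<le> k * cmod (y x)" using mult_right_mono[OF k(1), of "cmod (y x)"] by simp
    then have "cmod (y x) \<le> V x" "cmod (u x) \<le> V x"
      using k unfolding V_def by (auto simp: add_increasing add_increasing2)
    ultimately show "cmod (y x) \<le> exp (A + A * sqrt (cmod l)) \<and> cmod (u x) \<le> exp (A + A * sqrt (cmod l))"
      by linarith
  qed
qed

text \<open>On the interval where \<open>\<bar>l\<bar> \<integral> 1/\<bar>p\<bar> \<integral> w\<close> is of unit size a function subject to a boundary condition at
  \<open>c\<close> is nearly constant, so \<open>\<bar>y c\<bar>\<^sup>2\<close> is bounded by its mean square there.\<close>

lemma boundary_value_estimate:
  assumes J: "{a..c} \<subseteq> I" "a < c" and B: "0 \<le> B" and "0 < e"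
  obtains R where "0 < R"
    "\<And>l y u h H. R \<le> cmod l \<Longrightarrow> sl_expression w p q {a..c} y u (\<lambda>x. l * (y x + h x)) \<Longrightarrow>
       (\<And>x. x \<in> {a..c} \<Longrightarrow> cmod (h x) \<le> H) \<Longrightarrow> cmod (u c) \<le> B * cmod (y c) \<Longrightarrow>
       (cmod (y c))\<^sup>2 \<le> e * cmod l * weighted_square a c y + 2 * H\<^sup>2"
proof -
  define P W where "P x = integral {x..c} (\<lambda>t. cmod (1 / p t))" and "W x = integral {x..c} (\<lambda>t. \<bar>w t\<bar>)" for x
  define Q where "Q = integral {a..c} (\<lambda>t. cmod (q t))"
  note ci = coefficients_integrable_on[OF J(1)]
  have contP: "continuous_on {a..c} P" and contW: "continuous_on {a..c} W"
    unfolding P_def W_def by (intro indefinite_integral_continuous_1' ci)+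
  have P_mono: "P y \<le> P x" "W y \<le> W x" "0 \<le> P y" "0 \<le> W y" if "a \<le> x" "x \<le> y" "y \<le> c" for x y
  proof -
    have sub: "{x..c} \<subseteq> I" "{y..c} \<subseteq> I" "{y..c} \<subseteq> {x..c}" using that J by (auto simp: subset_iff)
    show "P y \<le> P x" "W y \<le> W x" unfolding P_def W_def
      by (intro integral_subset_le sub coefficients_integrable_on; simp)+
    show "0 \<le> P y" "0 \<le> W y" unfolding P_def W_def
      by (intro integral_nonneg coefficients_integrable_on sub; simp)+
  qed
  have Q: "0 \<le> Q" unfolding Q_def by (intro integral_nonneg ci) auto
  \<comment> \<open>The first bound gives P (B + Q) \<le> 1/16, which keeps the variation of y
    small; the second turns the final factor 16 * 8 into e.\<close>
  define s where "s = min (1 / (16 * (B + Q + 1))) (e / 128)"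
  have s: "0 < s" using B Q \<open>0 < e\<close> by (simp add: s_def)
  have "P c = 0" "W c = 0" by (auto simp: P_def W_def)
  obtain d where d: "0 < d" "\<And>x. x \<in> {a..c} \<Longrightarrow> dist x c < d \<Longrightarrow> dist (P x) (P c) < s"
    using contP[unfolded continuous_on_iff, rule_format, of c s] s J(2) by auto
  define x1 where "x1 = max ((a + c) / 2) (c - d / 2)"
  have x1: "a < x1" "x1 < c" using J(2) d(1) by (auto simp: x1_def less_max_iff_disj)
  have Px1: "P x1 \<le> s" using d(2)[of x1] x1 d(1) \<open>P c = 0\<close> J
    by (force simp: dist_real_def x1_def split: if_splits)
  have x1I: "{x1..c} \<subseteq> I" using J x1 by (auto simp: subset_iff)
  have pos: "0 < W x1" "0 < P x1"
    using weight_integral_pos[OF x1(2) x1I] by (auto simp: P_def W_def)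
  \<comment> \<open>The smallest |l| for which the intermediate value theorem finds a point of
    {x1..c} with |l| P W = 1/16.\<close>
  define R where "R = 1 / (16 * (P x1 * W x1))"
  show thesis
  proof (rule that[of R])
    show "0 < R" using pos by (simp add: R_def)
    fix l y u h H
    assume R: "R \<le> cmod l" and ye: "sl_expression w p q {a..c} y u (\<lambda>x. l * (y x + h x))"
      and h: "\<And>x. x \<in> {a..c} \<Longrightarrow> cmod (h x) \<le> H" and bc: "cmod (u c) \<le> B * cmod (y c)"
    have "1 / 16 \<le> cmod l * P x1 * W x1" using R pos by (simp add: R_def field_simps)
    moreover have "continuous_on {x1..c} (\<lambda>x. cmod l * P x * W x)"
      using x1 by (intro continuous_intros continuous_on_subset[OF contP] continuous_on_subset[OF contW]) auto
    \<comment> \<open>The interval {x..c} is short enough for y to be nearly constant on it, and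
      long enough for its mean square to control the boundary value: since 16 |l| P W = 1,
      multiplying a bound on W |y c|^2 by 16 |l| P gives one on |y c|^2.\<close>
    ultimately obtain x where x: "x1 \<le> x" "x \<le> c" "cmod l * P x * W x = 1 / 16"
      using IVT2'[of "\<lambda>x. cmod l * P x * W x" c "1/16" x1] \<open>P c = 0\<close> x1 by auto
    have xa: "a \<le> x" using x x1 by simp
    have xc: "x < c" using x \<open>P c = 0\<close> by (cases "x = c") auto
    have sub: "{x..c} \<subseteq> {a..c}" using xa by auto
    note cont = sl_expression_continuous(1,2)[OF ye order_refl]
    have contx: "continuous_on {x..c} y" using cont(1) sub continuous_on_subset by blast
    obtain m where m: "m \<in> {x..c}" "\<And>t. t \<in> {x..c} \<Longrightarrow> cmod (y t) \<le> cmod (y m)"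
      using continuous_attains_sup[of "{x..c}" "\<lambda>t. cmod (y t)"] x(2) continuous_on_norm[OF contx] by auto
    define Y where "Y = cmod (y m)"
    have H: "0 \<le> H" using order_trans[OF norm_ge_zero h[of c]] J(2) by simp
    have Px: "0 \<le> P x" "P x \<le> s" "0 \<le> W x" using P_mono[of x c] P_mono[of x1 x] P_mono[of x x] x xa x1 Px1 by auto
    \<comment> \<open>A bound for the quasi-derivative on {x..c}, obtained by integrating u'
      backwards from c, where the boundary inequality limits u by B |y c|.\<close>
    define U where "U = B * Y + (Y * Q + cmod l * (Y + H) * W x)"
    have bf: "cmod (l * (y t + h t)) \<le> cmod l * (Y + H)" if "t \<in> {x..c}" for t
    proof -
      have "cmod (y t + h t) \<le> Y + H"
        using m(2)[OF that] h[of t] that sub norm_triangle_ineq[of "y t" "h t"] by (auto simp: Y_def)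
      then show ?thesis by (simp add: norm_mult mult_left_mono)
    qed
    have bu: "cmod (u t) \<le> U" if t: "t \<in> {x..c}" for t
    proof -
      have tc: "t \<le> c" "{t..c} \<subseteq> {a..c}" "{t..c} \<subseteq> {x..c}" "{t..c} \<subseteq> I" using t xa J by auto
      obtain U0 where U0: "\<And>t. t \<in> {a..c} \<Longrightarrow> cmod (u t) \<le> U0"
        using compact_imp_bounded[OF compact_continuous_image[OF cont(2) compact_Icc]] unfolding bounded_iff by blast
      have "cmod (u c - u t) \<le> Y * integral {t..c} (\<lambda>t. cmod (q t)) + (cmod l * (Y + H)) * integral {t..c} (\<lambda>t. \<bar>w t\<bar>)"
        by (rule increment_bounds(2)[OF ye J(1) tc(2,1), of U0])
           (use U0 m bf tc in \<open>auto simp: Y_def subset_iff\<close>)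
      also have "\<dots> \<le> Y * Q + (cmod l * (Y + H)) * W x"
        unfolding Q_def W_def[symmetric] using tc H P_mono(2)[of x t] t xa
        by (intro add_mono mult_left_mono integral_subset_le coefficients_integrable_on J) (auto simp: Y_def)
      finally have "cmod (u t) \<le> cmod (u c) + (Y * Q + cmod l * (Y + H) * W x)"
        using norm_triangle_ineq4[of "u c" "u c - u t"] by simp
      also have "cmod (u c) \<le> B * Y"
        using bc mult_left_mono[OF m(2)[of c] B] x by (simp add: Y_def)
      finally show ?thesis by (simp add: U_def)
    qed
    have PU: "P x * U \<le> Y / 8 + H / 16"
    proof -
      have "P x * (B + Q) \<le> s * (B + Q + 1)" using Px B Q s by (intro mult_mono) auto
      also have "\<dots> \<le> 1 / (16 * (B + Q + 1)) * (B + Q + 1)" using B Q by (intro mult_right_mono) (auto simp: s_def)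
      also have "\<dots> = 1 / 16" using B Q by (simp add: field_simps)
      finally have "P x * (B + Q) * Y \<le> 1 / 16 * Y" by (intro mult_right_mono) (auto simp: Y_def)
      moreover have "P x * U = P x * (B + Q) * Y + (cmod l * P x * W x) * (Y + H)"
        by (simp add: U_def algebra_simps)
      ultimately show ?thesis using x(3) by (simp add: field_simps)
    qed
    have U: "0 \<le> U" using order_trans[OF norm_ge_zero bu[of c]] x by simp
    have diff: "cmod (y c - y t) \<le> Y / 8 + H / 16" if t: "t \<in> {x..c}" for t
    proof -
      have tc: "t \<le> c" "{t..c} \<subseteq> {a..c}" "{t..c} \<subseteq> {x..c}" using t xa by auto
      have "cmod (y c - y t) \<le> U * P t" unfolding P_def
        by (rule increment_bounds(1)[OF ye J(1) tc(2,1), of U Y "cmod l * (Y + H)"])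
           (use bu m bf tc in \<open>auto simp: Y_def subset_iff\<close>)
      also have "\<dots> \<le> P x * U" using P_mono(1)[of x t] t xa U by (simp add: mult.commute[of _ U] mult_left_mono)
      finally show ?thesis using PU by linarith
    qed
    \<comment> \<open>On {x..c} the function y stays within Y / 8 + H / 16 of y c. This bounds the
      maximum Y by |y c|, and then |y c| by |y t|, up to multiples of H.\<close>
    have bound: "cmod (y c) \<le> 2 * cmod (y t) + H" if t: "t \<in> {x..c}" for t
    proof -
      have "Y \<le> cmod (y c) + (Y / 8 + H / 16)"
        using diff[OF m(1)] norm_triangle_ineq4[of "y c" "y c - y m"] by (simp add: Y_def)
      moreover have "cmod (y c) \<le> cmod (y t) + (Y / 8 + H / 16)"
        using diff[OF t] norm_triangle_ineq[of "y t" "y c - y t"] by simp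
      ultimately show ?thesis using H norm_ge_zero[of "y t"] by linarith
    qed
    have bound2: "(cmod (y c))\<^sup>2 - 2 * H\<^sup>2 \<le> 8 * (cmod (y t))\<^sup>2" if t: "t \<in> {x..c}" for t
    proof -
      have "(cmod (y c))\<^sup>2 \<le> (2 * cmod (y t) + H)\<^sup>2"
        using bound[OF t] by (intro power_mono) auto
      also have "\<dots> \<le> 8 * (cmod (y t))\<^sup>2 + 2 * H\<^sup>2"
        using zero_le_power2[of "2 * cmod (y t) - H"] by (simp add: power2_eq_square algebra_simps)
      finally show ?thesis by simp
    qed
    have xI: "{x..c} \<subseteq> I" using sub J by blast
    have "W x * ((cmod (y c))\<^sup>2 - 2 * H\<^sup>2) = integral {x..c} (\<lambda>t. \<bar>w t\<bar> * ((cmod (y c))\<^sup>2 - 2 * H\<^sup>2))"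
      by (simp add: W_def)
    also have "\<dots> \<le> integral {x..c} (\<lambda>t. \<bar>w t\<bar> * (8 * (cmod (y t))\<^sup>2))"
      using bound2 xI by (intro integral_le weighted_integrable_on mult_left_mono continuous_intros contx) auto
    also have "\<dots> \<le> integral {a..c} (\<lambda>t. \<bar>w t\<bar> * (8 * (cmod (y t))\<^sup>2))"
      using sub by (intro integral_subset_le weighted_integrable_on continuous_intros contx cont xI J) auto
    also have "\<dots> = 8 * weighted_square a c y"
      unfolding weighted_square_def by (subst integral_mult_right[symmetric]) (simp add: algebra_simps)
    finally have W8: "W x * ((cmod (y c))\<^sup>2 - 2 * H\<^sup>2) \<le> 8 * weighted_square a c y" .
    have N0: "0 \<le> weighted_square a c y" by (intro weighted_square_nonneg cont J)
    have "(cmod (y c))\<^sup>2 - 2 * H\<^sup>2 = 16 * cmod l * P x * (W x * ((cmod (y c))\<^sup>2 - 2 * H\<^sup>2))"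
    proof -
      have "16 * cmod l * P x * (W x * ((cmod (y c))\<^sup>2 - 2 * H\<^sup>2)) =
          16 * (cmod l * P x * W x) * ((cmod (y c))\<^sup>2 - 2 * H\<^sup>2)" by simp
      then show ?thesis unfolding x(3) by simp
    qed
    also have "\<dots> \<le> 16 * cmod l * P x * (8 * weighted_square a c y)"
      using W8 Px by (intro mult_left_mono) auto
    also have "\<dots> \<le> 16 * cmod l * (e / 128) * (8 * weighted_square a c y)"
      using Px N0 by (intro mult_left_mono mult_right_mono) (auto simp: s_def)
    finally show "(cmod (y c))\<^sup>2 \<le> e * cmod l * weighted_square a c y + 2 * H\<^sup>2" by simp
  qed
qed

end

section \<open>Zeros of the boundary form\<close>

context sturm_liouville
begin

text \<open>In the real part of \<open>cis \<eta>\<close> times the energy identity the terms with p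
  and q - K w are nonnegative and the boundary term at a is zero. The cross term with h is split by
  |h| |y| \<le> |y|^2 / 16 + 4 H^2, the origin of both constants. The inhomogeneity h will be
  \<phi>(.,0), for y = \<phi>(.,l) - \<phi>(.,0).\<close>

lemma energy_lower_bound:
  assumes acc: "AE x in lebesgue. x \<in> I \<longrightarrow>
      0 \<le> Re (cis \<eta> * p x) \<and> 0 \<le> Re (cis \<eta> * (q x - K * complex_of_real (w x)))"
    and J: "{a..c} \<subseteq> I" "a \<le> c"
    and y: "sl_expression w p q {a..c} y u (\<lambda>x. l * (y x + h x))" and ya: "y a = 0"
    and h: "\<And>x. x \<in> {a..c} \<Longrightarrow> cmod (h x) \<le> H"
  shows "(- Re ((l - K) * cis \<eta>) - cmod l / 16) * weighted_square a c y
      - 4 * cmod l * H\<^sup>2 * integral {a..c} (\<lambda>t. \<bar>w t\<bar>) \<le> Re (cis \<eta> * (u c * cnj (y c)))"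
proof -
  define d where "d = - Re ((l - K) * cis \<eta>) - cmod l / 16"
  define E where "E x = u x * cnj (u x / p x) + (q x * y x - complex_of_real (w x) * (l * (y x + h x))) * cnj (y x)" for x
  note cont = sl_expression_continuous(1)[OF y order_refl]
  have "((\<lambda>x. cis \<eta> * E x) has_integral cis \<eta> * (u c * cnj (y c))) {a..c}"
    using has_integral_mult_right[OF energy_identity[OF y J(1) order_refl J(2)], of "cis \<eta>"]
    by (simp add: E_def ya)
  from has_integral_linear[OF this bounded_linear_Re]
  have E: "((\<lambda>x. Re (cis \<eta> * E x)) has_integral Re (cis \<eta> * (u c * cnj (y c)))) {a..c}"
    by (simp add: o_def)
  define g where "g x = d * (\<bar>w x\<bar> * (cmod (y x))\<^sup>2) - (4 * cmod l * H\<^sup>2) * \<bar>w x\<bar>" for x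
  have "(g has_integral d * weighted_square a c y - (4 * cmod l * H\<^sup>2) * integral {a..c} (\<lambda>t. \<bar>w t\<bar>)) {a..c}"
    unfolding g_def weighted_square_def
    by (intro has_integral_diff has_integral_mult_right integrable_integral weighted_square_integrable_on
        coefficients_integrable_on J cont)
  moreover
  have "AE x in lebesgue. x \<in> {a..c} \<longrightarrow> g x \<le> Re (cis \<eta> * E x)"
    using acc AE_imp_subset[OF w_pos J(1)] AE_imp_subset[OF p_nz J(1)]
  proof (eventually_elim, intro impI)
    fix x assume *: "x \<in> I \<longrightarrow> 0 \<le> Re (cis \<eta> * p x) \<and> 0 \<le> Re (cis \<eta> * (q x - K * complex_of_real (w x)))"
      "x \<in> {a..c} \<longrightarrow> 0 < w x" "x \<in> {a..c} \<longrightarrow> p x \<noteq> 0" "x \<in> {a..c}"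
    then have x: "0 \<le> Re (cis \<eta> * p x)" "0 \<le> Re (cis \<eta> * (q x - K * complex_of_real (w x)))" "0 < w x" "p x \<noteq> 0"
      using J by auto
    have Re1: "Re (z * of_real r) = Re z * r" and Re2: "Re (of_real r * z) = r * Re z" for z r by simp_all
    have "u x * cnj (u x / p x) = p x * of_real ((cmod (u x / p x))\<^sup>2)"
      using x(4) by (simp only: complex_norm_square) simp
    then have eqE: "E x = p x * of_real ((cmod (u x / p x))\<^sup>2) + (q x - K * of_real (w x)) * of_real ((cmod (y x))\<^sup>2)
        + of_real (w x) * (- ((l - K) * of_real ((cmod (y x))\<^sup>2)) - l * h x * cnj (y x))"
      unfolding E_def by (simp only: complex_norm_square) (simp add: algebra_simps)
    have "cis \<eta> * E x = (cis \<eta> * p x) * of_real ((cmod (u x / p x))\<^sup>2)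
        + (cis \<eta> * (q x - K * of_real (w x))) * of_real ((cmod (y x))\<^sup>2)
        + of_real (w x) * (- (((l - K) * cis \<eta>) * of_real ((cmod (y x))\<^sup>2)) - cis \<eta> * (l * h x * cnj (y x)))"
      unfolding eqE by (simp add: algebra_simps)
    then have ReE: "Re (cis \<eta> * E x) = Re (cis \<eta> * p x) * (cmod (u x / p x))\<^sup>2
        + Re (cis \<eta> * (q x - K * of_real (w x))) * (cmod (y x))\<^sup>2
        + w x * (- (Re ((l - K) * cis \<eta>)) * (cmod (y x))\<^sup>2 - Re (cis \<eta> * (l * h x * cnj (y x))))"
      by (simp only: plus_complex.sel minus_complex.sel uminus_complex.sel Re1 Re2 mult_minus_left)
    have "Re (cis \<eta> * (l * h x * cnj (y x))) \<le> cmod l * (cmod (h x) * cmod (y x))"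
      using complex_Re_le_cmod[of "cis \<eta> * (l * h x * cnj (y x))"] by (simp add: norm_mult)
    also have "\<dots> \<le> cmod l * ((cmod (y x))\<^sup>2 / 16 + 4 * H\<^sup>2)"
    proof (rule mult_left_mono)
      have "cmod (h x) * cmod (y x) \<le> H * cmod (y x)" using h *(4) by (intro mult_right_mono) auto
      also have "\<dots> \<le> (cmod (y x))\<^sup>2 / 16 + 4 * H\<^sup>2"
        using zero_le_power2[of "cmod (y x) / 4 - 2 * H"] by (simp add: power2_eq_square algebra_simps)
      finally show "cmod (h x) * cmod (y x) \<le> (cmod (y x))\<^sup>2 / 16 + 4 * H\<^sup>2" .
    qed simp
    finally have "w x * (d * (cmod (y x))\<^sup>2 - 4 * cmod l * H\<^sup>2) \<le>
        w x * (- (Re ((l - K) * cis \<eta>)) * (cmod (y x))\<^sup>2 - Re (cis \<eta> * (l * h x * cnj (y x))))"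
      using x(3) by (intro mult_left_mono) (auto simp: d_def algebra_simps)
    moreover have "0 \<le> Re (cis \<eta> * p x) * (cmod (u x / p x))\<^sup>2" "0 \<le> Re (cis \<eta> * (q x - K * of_real (w x))) * (cmod (y x))\<^sup>2"
      using x by (intro mult_nonneg_nonneg; simp)+
    ultimately have "w x * (d * (cmod (y x))\<^sup>2 - 4 * cmod l * H\<^sup>2) \<le> Re (cis \<eta> * E x)"
      unfolding ReE by linarith
    then show "g x \<le> Re (cis \<eta> * E x)" using x(3) by (simp add: g_def algebra_simps)
  qed
  then obtain N where N: "negligible N" "\<And>x. x \<notin> N \<Longrightarrow> x \<in> {a..c} \<Longrightarrow> g x \<le> Re (cis \<eta> * E x)"
    by (rule AE_lebesgue_negligibleE) blast
  \<comment> \<open>\<open>has_integral_le\<close> compares the integrands at every point, so the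
    larger one is altered on the null set N.\<close>
  have "((\<lambda>x. if x \<in> N then g x else Re (cis \<eta> * E x)) has_integral Re (cis \<eta> * (u c * cnj (y c)))) {a..c}"
    by (rule has_integral_spike[OF N(1) _ E]) auto
  ultimately have "d * weighted_square a c y - (4 * cmod l * H\<^sup>2) * integral {a..c} (\<lambda>t. \<bar>w t\<bar>) \<le> Re (cis \<eta> * (u c * cnj (y c)))"
    by (rule has_integral_le) (use N(2) in auto)
  then show ?thesis by (simp add: d_def)
qed

end

context sl_fundamental
begin

text \<open>If \<phi> vanished on {a..c}, so would its quasi-derivative, and the bracket with
  \<theta> could not be -1.\<close>

lemma phi_nonzero:
  assumes "c \<in> I" "a < c"
  shows "weighted_square a c (\<lambda>x. \<phi> x l) \<noteq> 0"
proof
  assume 0: "weighted_square a c (\<lambda>x. \<phi> x l) = 0"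
  have zero: "\<phi> x l = 0" if "x \<in> {a..c}" for x
    using weighted_square_eq_0D[OF solution_continuous(1)[OF phi_sol assms(1)] assms(2) initial_interval[OF assms(1)] 0 that] .
  have "\<phi>1 c l = 0"
    by (rule sl_expression_zero(1)[OF phi_sol[unfolded sl_solution_def] order_refl initial_interval[OF assms(1)] assms(2) zero])
       (use assms in auto)
  then show False using theta_phi_bracket[OF assms(1), of l] zero[of c] assms by simp
qed

text \<open>If the boundary form had no zero it would be constant, by its growth. Then \<open>\<phi>(\<cdot>, l) - \<phi>(\<cdot>, 0)\<close>
  satisfies the boundary condition at \<open>c\<close> for every \<open>l\<close>, and accretivity bounds its mean square for \<open>l\<close> in
  a sector; a Phragmen-Lindelof argument makes \<open>\<phi>(\<cdot>, l)\<close> independent of \<open>l\<close>.\<close>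

lemma boundary_form_has_zero:
  assumes acc: "AE x in lebesgue. x \<in> I \<longrightarrow>
      0 \<le> Re (cis \<eta> * p x) \<and> 0 \<le> Re (cis \<eta> * (q x - K * complex_of_real (w x)))"
    and c: "c \<in> I" "a < c"
  shows "\<exists>l. \<phi> c l * cos \<beta> + \<phi>1 c l * sin \<beta> = 0"
proof (rule ccontr)
  assume nz: "\<nexists>l. \<phi> c l * cos \<beta> + \<phi>1 c l * sin \<beta> = 0"
  define \<Delta> where "\<Delta> l = \<phi> c l * cos \<beta> + \<phi>1 c l * sin \<beta>" for l
  note J = initial_interval[OF c(1)]
  have ac: "a \<in> {a..c}" "c \<in> {a..c}" using c by auto
  note cont = solution_continuous[OF phi_sol c(1)]
  have phi_sub: "sl_solution w p q {a..c} l (\<lambda>x. \<phi> x l) (\<lambda>x. \<phi>1 x l)" for l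
    by (rule solution_restrict[OF phi_sol J])
  obtain A where A: "0 \<le> A" "\<And>l x. x \<in> {a..c} \<Longrightarrow>
       cmod (\<phi> x l) \<le> exp (A + A * sqrt (cmod l)) \<and> cmod (\<phi>1 x l) \<le> exp (A + A * sqrt (cmod l))"
  proof (rule solution_growth[OF J less_imp_le[OF c(2)]])
    show "0 \<le> cmod (sin \<alpha>) + cmod (cos \<alpha>)" by simp
    fix A assume "0 \<le> A" and *: "\<And>l y u x. sl_solution w p q {a..c} l y u \<Longrightarrow> cmod (y a) \<le> cmod (sin \<alpha>) + cmod (cos \<alpha>) \<Longrightarrow>
        cmod (u a) \<le> cmod (sin \<alpha>) + cmod (cos \<alpha>) \<Longrightarrow> x \<in> {a..c} \<Longrightarrow>
       cmod (y x) \<le> exp (A + A * sqrt (cmod l)) \<and> cmod (u x) \<le> exp (A + A * sqrt (cmod l))"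
    show thesis
      by (rule that[OF \<open>0 \<le> A\<close> *[OF phi_sub]]) (auto simp: phi_init)
  qed
  have grow: "exp (A + A * sqrt (cmod l)) * M \<le> exp ((A + M) + (A + M) * sqrt (cmod l))" if "0 \<le> M" for M l
  proof -
    have "M \<le> exp (M + M * sqrt (cmod l))"
    proof -
      have "0 \<le> M * sqrt (cmod l)" using that by simp
      then show ?thesis using exp_ge_add_one_self[of "M + M * sqrt (cmod l)"] by linarith
    qed
    then have "exp (A + A * sqrt (cmod l)) * M \<le> exp (A + A * sqrt (cmod l)) * exp (M + M * sqrt (cmod l))"
      by (intro mult_left_mono) auto
    then show ?thesis by (simp add: algebra_simps flip: exp_add)
  qed
  have \<Delta>_const: "\<Delta> l = \<Delta> 0" for l
  proof (rule zero_free_entire_constant)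
    show "\<Delta> holomorphic_on UNIV" unfolding \<Delta>_def
      by (intro holomorphic_intros uniformly_differentiable_family_holomorphic[OF phi_family(1)[OF c(1)] ac(2)]
          uniformly_differentiable_family_holomorphic[OF phi_family(2)[OF c(1)] ac(2)])
    show "\<Delta> z \<noteq> 0" for z using nz by (auto simp: \<Delta>_def)
    define M where "M = cmod (cos \<beta>) + cmod (sin \<beta>)"
    have M: "0 \<le> M" by (simp add: M_def)
    show "0 \<le> A + M" using A M by simp
    show "cmod (\<Delta> z) \<le> exp ((A + M) + (A + M) * sqrt (cmod z))" for z
    proof -
      have "cmod (\<Delta> z) \<le> cmod (\<phi> c z) * cmod (cos \<beta>) + cmod (\<phi>1 c z) * cmod (sin \<beta>)"
        unfolding \<Delta>_def by (intro order_trans[OF norm_triangle_ineq]) (simp add: norm_mult)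
      also have "\<dots> \<le> exp (A + A * sqrt (cmod z)) * cmod (cos \<beta>) + exp (A + A * sqrt (cmod z)) * cmod (sin \<beta>)"
        using A(2)[OF ac(2)] by (intro add_mono mult_right_mono) auto
      also have "\<dots> = exp (A + A * sqrt (cmod z)) * M" by (simp add: M_def algebra_simps)
      finally show ?thesis using grow[OF M, of z] by linarith
    qed
  qed
  \<comment> \<open>The modulus of the cotangent. If \<open>sin \<beta> = 0\<close>, division gives
    0; the boundary condition then reads y c = 0, a case that is treated separately below.\<close>
  define B where "B = cmod (cos \<beta> / sin \<beta>)"
  define e where "e = 1 / (16 * (B + 1))"
  have B: "0 \<le> B" "0 < e" "B * e \<le> 1 / 16"
  proof -
    show "0 \<le> B" by (simp add: B_def)
    then show "0 < e" "B * e \<le> 1 / 16" by (auto simp: e_def field_simps)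
  qed
  obtain R where R: "0 < R"
    "\<And>l y u h H. R \<le> cmod l \<Longrightarrow> sl_expression w p q {a..c} y u (\<lambda>x. l * (y x + h x)) \<Longrightarrow>
       (\<And>x. x \<in> {a..c} \<Longrightarrow> cmod (h x) \<le> H) \<Longrightarrow> cmod (u c) \<le> B * cmod (y c) \<Longrightarrow>
       (cmod (y c))\<^sup>2 \<le> e * cmod l * weighted_square a c y + 2 * H\<^sup>2"
  proof (rule boundary_value_estimate[OF J c(2) B(1,2)])
    fix R assume "0 < R" and *: "\<And>l y u h H. R \<le> cmod l \<Longrightarrow> sl_expression w p q {a..c} y u (\<lambda>x. l * (y x + h x)) \<Longrightarrow>
       (\<And>x. x \<in> {a..c} \<Longrightarrow> cmod (h x) \<le> H) \<Longrightarrow> cmod (u c) \<le> B * cmod (y c) \<Longrightarrow>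
       (cmod (y c))\<^sup>2 \<le> e * cmod l * weighted_square a c y + 2 * H\<^sup>2"
    show thesis by (rule that[OF \<open>0 < R\<close>]) (rule *; assumption)
  qed
  obtain H where H: "\<And>x. x \<in> {a..c} \<Longrightarrow> cmod (\<phi> x 0) \<le> H"
    using compact_imp_bounded[OF compact_continuous_image[OF cont(1) compact_Icc]] unfolding bounded_iff by blast
  define W where "W = integral {a..c} (\<lambda>t. \<bar>w t\<bar>)"
  have W: "0 \<le> W" unfolding W_def by (intro integral_nonneg coefficients_integrable_on J) auto
  \<comment> \<open>R serves the boundary value estimate, 4 |K| makes |K| \<le> |l| / 4, and 1 lets
    constants be absorbed into multiples of |l|.\<close>
  define R1 where "R1 = max R (max 1 (4 * cmod K))"
  define S where "S = 2 * (8 * (4 * H\<^sup>2 * W + 2 * B * H\<^sup>2)) + 2 * weighted_square a c (\<lambda>x. \<phi> x 0)"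
  \<comment> \<open>On this sector the energy estimate yields at least (1/4 - 1/16) |l| N, N being
    the mean square of the difference y. The boundary term returns at most |l| N / 16 plus terms
    bounded by a multiple of |l|. What remains is |l| N / 8, and |l| cancels.\<close>
  have sector: "weighted_square a c (\<lambda>x. \<phi> x l) \<le> S"
    if l: "R1 \<le> cmod l" "Re (l * cis \<eta>) \<le> - (1/2) * cmod l" for l
  proof -
    define y u where "y x = \<phi> x l - \<phi> x 0" and "u x = \<phi>1 x l - \<phi>1 x 0" for x
    have cy: "continuous_on {a..c} y" unfolding y_def by (intro continuous_intros cont)
    have "sl_expression w p q {a..c} (\<lambda>x. 1 * \<phi> x l + - 1 * \<phi> x 0) (\<lambda>x. 1 * \<phi>1 x l + - 1 * \<phi>1 x 0)
         (\<lambda>x. 1 * (l * \<phi> x l) + - 1 * (0 * \<phi> x 0))"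
      using sl_expression_lincomb[OF phi_sub[of l, unfolded sl_solution_def] phi_sub[of 0, unfolded sl_solution_def], where k = 1 and l = "- 1"] .
    moreover have "(\<lambda>x. 1 * \<phi> x l + - 1 * \<phi> x 0) = y" "(\<lambda>x. 1 * \<phi>1 x l + - 1 * \<phi>1 x 0) = u"
      "(\<lambda>x. 1 * (l * \<phi> x l) + - 1 * (0 * \<phi> x 0)) = (\<lambda>x. l * (y x + \<phi> x 0))"
      by (simp_all add: y_def u_def fun_eq_iff)
    ultimately have ye: "sl_expression w p q {a..c} y u (\<lambda>x. l * (y x + \<phi> x 0))"
      by (simp only:)
    define N where "N = weighted_square a c y"
    have N: "0 \<le> N" unfolding N_def by (rule weighted_square_nonneg[OF cy J])
    have bc: "y c * cos \<beta> + u c * sin \<beta> = 0"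
      using \<Delta>_const[of l] by (simp add: \<Delta>_def y_def u_def algebra_simps)
    have upper: "Re (cis \<eta> * (u c * cnj (y c))) \<le> B * (e * cmod l * N + 2 * H\<^sup>2)"
    proof (cases "y c = 0")
      case True
      then show ?thesis using B N by simp
    next
      case False
      have s: "sin \<beta> \<noteq> 0"
      proof
        assume "sin \<beta> = 0"
        then have "cos \<beta> \<noteq> 0" using sin_cos_squared_add[of \<beta>] by auto
        then show False using bc False \<open>sin \<beta> = 0\<close> by simp
      qed
      have "u c = - (cos \<beta> / sin \<beta>) * y c"
        using bc s by (simp add: field_simps add_eq_0_iff)
      then have uB: "cmod (u c) = B * cmod (y c)" by (simp add: B_def norm_mult norm_divide)
      have "Re (cis \<eta> * (u c * cnj (y c))) \<le> cmod (cis \<eta> * (u c * cnj (y c)))" by (rule complex_Re_le_cmod)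
      also have "\<dots> = B * (cmod (y c))\<^sup>2" using uB by (simp add: norm_mult power2_eq_square)
      also have "\<dots> \<le> B * (e * cmod l * N + 2 * H\<^sup>2)"
        unfolding N_def using l uB
        by (intro mult_left_mono[OF R(2)[OF _ ye H]] B) (auto simp: R1_def)
      finally show ?thesis .
    qed
    have "(- Re ((l - K) * cis \<eta>) - cmod l / 16) * N - 4 * cmod l * H\<^sup>2 * W \<le> Re (cis \<eta> * (u c * cnj (y c)))"
      unfolding N_def W_def using c
      by (intro energy_lower_bound[OF acc J _ ye _ H]) (auto simp: y_def phi_init)
    also note upper
    finally have main: "(- Re ((l - K) * cis \<eta>) - cmod l / 16) * N - 4 * cmod l * H\<^sup>2 * W \<le> B * (e * cmod l * N + 2 * H\<^sup>2)" .
    have "Re (K * cis \<eta>) \<ge> - cmod K" using abs_Re_le_cmod[of "K * cis \<eta>"] by (simp add: norm_mult)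
    then have "- Re ((l - K) * cis \<eta>) \<ge> cmod l / 2 - cmod K" using l(2) by (simp add: algebra_simps)
    moreover have "cmod l \<ge> 4 * cmod K" "1 \<le> cmod l" using l by (auto simp: R1_def)
    ultimately have "(cmod l / 4 - cmod l / 16) * N \<le> (- Re ((l - K) * cis \<eta>) - cmod l / 16) * N"
      using N by (intro mult_right_mono) linarith+
    moreover have "B * (e * cmod l * N + 2 * H\<^sup>2) \<le> (1/16) * cmod l * N + cmod l * (2 * B * H\<^sup>2)"
    proof -
      have "(B * e) * (cmod l * N) \<le> (1/16) * (cmod l * N)" using B N by (intro mult_right_mono) auto
      moreover have "1 * (2 * B * H\<^sup>2) \<le> cmod l * (2 * B * H\<^sup>2)"
        using \<open>1 \<le> cmod l\<close> B by (intro mult_right_mono) auto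
      ultimately show ?thesis by (simp add: algebra_simps)
    qed
    ultimately have "cmod l * (N / 8) \<le> cmod l * (4 * H\<^sup>2 * W + 2 * B * H\<^sup>2)"
      using main by (simp add: algebra_simps)
    then have "N / 8 \<le> 4 * H\<^sup>2 * W + 2 * B * H\<^sup>2"
      using \<open>1 \<le> cmod l\<close> by (subst (asm) mult_le_cancel_left_pos) auto
    then have N8: "N \<le> 8 * (4 * H\<^sup>2 * W + 2 * B * H\<^sup>2)" by simp
    have "weighted_square a c (\<lambda>x. y x + \<phi> x 0) \<le> 2 * N + 2 * weighted_square a c (\<lambda>x. \<phi> x 0)"
      unfolding N_def by (rule weighted_square_add_le[OF cy cont(1) J])
    also have "(\<lambda>x. y x + \<phi> x 0) = (\<lambda>x. \<phi> x l)" by (simp add: y_def)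
    finally show ?thesis using N8 by (simp add: S_def)
  qed
  \<comment> \<open>Pairing with a fixed continuous h produces a scalar entire function of l, to
    which the Phragmen-Lindelof lemma applies. The mean square bound enters through |\<phi> h| \<le>
    (|\<phi>|^2 + |h|^2) / 2.\<close>
  have F_const: "integral {a..c} (\<lambda>x. \<phi> x l * (h x * of_real \<bar>w x\<bar>)) = integral {a..c} (\<lambda>x. \<phi> x 0 * (h x * of_real \<bar>w x\<bar>))"
    if h: "continuous_on {a..c} h" for h :: "real \<Rightarrow> complex" and l
  proof -
    define g where "g x = h x * complex_of_real \<bar>w x\<bar>" for x
    have g: "g absolutely_integrable_on {a..c}" unfolding g_def
      using absolutely_integrable_linear[OF coefficients_integrable(7)[OF J] bounded_linear_of_real]
      by (intro absolutely_integrable_continuous_mult h) (simp add: o_def)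
    \<comment> \<open>The rotation turns the sector Re (l cis \<eta>) \<le> - |l| / 2 into the one
      about the negative real axis with k = 1/2.\<close>
    define F where "F z = integral {a..c} (\<lambda>x. \<phi> x (z * cis (- \<eta>)) * g x)" for z
    define M where "M = integral {a..c} (\<lambda>x. norm (g x))"
    have M: "0 \<le> M" unfolding M_def
      using absolutely_integrable_norm[OF g] set_lebesgue_integral_eq_integral(1)
      by (intro integral_nonneg) (auto simp: o_def)
    have bound: "cmod (F z) \<le> exp ((A + M) + (A + M) * sqrt (cmod z))" for z
    proof -
      have "cmod (F z) \<le> exp (A + A * sqrt (cmod (z * cis (- \<eta>)))) * M"
        unfolding F_def M_def using A(2) c
        by (intro continuous_mult_integral_bound[OF cont(1) g]) auto
      then show ?thesis using grow[OF M, of z] by (simp add: norm_mult)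
    qed
    have "F z = F 0" for z
    proof (rule entire_bounded_sector_constant[where k = "1/2" and A = "A + M"])
      have "(\<lambda>l. integral {a..c} (\<lambda>x. \<phi> x l * g x)) holomorphic_on UNIV"
        using c by (intro uniformly_differentiable_family_integral_holomorphic phi_family g) auto
      then show "F holomorphic_on UNIV" unfolding F_def
        by (intro holomorphic_on_compose_gen[where g = "\<lambda>l. integral {a..c} (\<lambda>x. \<phi> x l * g x)" and f = "\<lambda>z. z * cis (- \<eta>)", unfolded o_def] holomorphic_intros) auto
      fix z assume z: "Re z \<le> - (1/2) * cmod z"
      define S' where "S' = (S + weighted_square a c h) / 2"
      show "cmod (F z) \<le> max S' (exp ((A + M) + (A + M) * sqrt R1))"
      proof (cases "R1 \<le> cmod z")
        case True
        define l where "l = z * cis (- \<eta>)"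
        have "l * cis \<eta> = z" by (simp add: l_def mult.assoc cis_mult)
        moreover have "cmod l = cmod z" by (simp add: l_def norm_mult)
        ultimately have wl: "weighted_square a c (\<lambda>x. \<phi> x l) \<le> S" using z True by (intro sector) auto
        have ig: "(\<lambda>x. \<phi> x l * g x) integrable_on {a..c}"
          using absolutely_integrable_continuous_mult[OF cont(1) g] set_lebesgue_integral_eq_integral(1) by blast
        have "cmod (F z) \<le> integral {a..c} (\<lambda>x. (\<bar>w x\<bar> * (cmod (\<phi> x l))\<^sup>2 + \<bar>w x\<bar> * (cmod (h x))\<^sup>2) * (1/2))"
          unfolding F_def l_def[symmetric]
        proof (rule integral_norm_bound_integral[OF ig])
          fix x
          have "cmod (\<phi> x l) * cmod (h x) \<le> ((cmod (\<phi> x l))\<^sup>2 + (cmod (h x))\<^sup>2) * (1/2)"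
            using sum_squares_bound[of "cmod (\<phi> x l)" "cmod (h x)"] by simp
          from mult_left_mono[OF this abs_ge_zero[of "w x"]]
          show "cmod (\<phi> x l * g x) \<le> (\<bar>w x\<bar> * (cmod (\<phi> x l))\<^sup>2 + \<bar>w x\<bar> * (cmod (h x))\<^sup>2) * (1/2)"
            by (simp add: g_def norm_mult algebra_simps)
        qed (intro integrable_on_mult_left integrable_add weighted_square_integrable_on cont h J)
        also have "\<dots> = (weighted_square a c (\<lambda>x. \<phi> x l) + weighted_square a c h) * (1/2)"
          unfolding weighted_square_def
          by (subst integral_mult_left, subst integral_add) (intro weighted_square_integrable_on cont h J refl)+
        finally show ?thesis using wl by (intro max.coboundedI1) (simp add: S'_def)
      next
        case False
        then have "(A + M) + (A + M) * sqrt (cmod z) \<le> (A + M) + (A + M) * sqrt R1"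
          using A M by (intro add_left_mono mult_left_mono) auto
        then have "exp ((A + M) + (A + M) * sqrt (cmod z)) \<le> exp ((A + M) + (A + M) * sqrt R1)" by simp
        with bound[of z] show ?thesis by linarith
      qed
    qed (use A M bound in auto)
    from this[of "l * cis \<eta>"] show ?thesis
      by (simp add: F_def g_def mult.assoc cis_mult)
  qed
  \<comment> \<open>Tested with h = conj y, the equality of the pairings at l = 1 and l = 0 says
    that the mean square of y itself is 0.\<close>
  define y where "y x = \<phi> x 1 - \<phi> x 0" for x
  have cy: "continuous_on {a..c} y" unfolding y_def by (intro continuous_intros cont)
  have "weighted_square a c y = 0"
  proof -
    have int: "(\<lambda>x. \<phi> x l * (cnj (y x) * of_real \<bar>w x\<bar>)) integrable_on {a..c}" for l
      using absolutely_integrable_linear[OF coefficients_integrable(7)[OF J] bounded_linear_of_real]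
      by (intro set_lebesgue_integral_eq_integral(1) absolutely_integrable_continuous_mult cont continuous_intros cy)
         (simp add: o_def)
    have "integral {a..c} (\<lambda>x. \<phi> x 1 * (cnj (y x) * of_real \<bar>w x\<bar>) - \<phi> x 0 * (cnj (y x) * of_real \<bar>w x\<bar>)) = 0"
      unfolding integral_diff[OF int int] using F_const[of "\<lambda>x. cnj (y x)" 1] cy by (simp add: continuous_intros)
    moreover have "\<phi> x 1 * (cnj (y x) * of_real \<bar>w x\<bar>) - \<phi> x 0 * (cnj (y x) * of_real \<bar>w x\<bar>) =
        complex_of_real (\<bar>w x\<bar> * (cmod (y x))\<^sup>2)" for x
      unfolding of_real_mult complex_norm_square by (simp add: y_def algebra_simps)
    ultimately have "integral {a..c} (\<lambda>x. complex_of_real (\<bar>w x\<bar> * (cmod (y x))\<^sup>2)) = 0"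
      by (simp only:)
    moreover have "integral {a..c} (\<lambda>x. complex_of_real (\<bar>w x\<bar> * (cmod (y x))\<^sup>2)) = complex_of_real (weighted_square a c y)"
      unfolding weighted_square_def
      using integral_linear[OF weighted_square_integrable_on[OF cy J] bounded_linear_of_real] by (simp add: o_def)
    ultimately show ?thesis by simp
  qed
  then have zero: "y x = 0" if "x \<in> {a..c}" for x
    using weighted_square_eq_0D[OF cy c(2) J _ that] by blast
  \<comment> \<open>The differential expression maps this difference to 1 * \<phi>(.,1) - 0 *
    \<phi>(.,0). As the difference is zero, \<phi>(.,1) has to vanish, which
    \<open>phi_nonzero\<close> forbids.\<close>
  have "sl_expression w p q {a..c} (\<lambda>x. 1 * \<phi> x 1 + - 1 * \<phi> x 0) (\<lambda>x. 1 * \<phi>1 x 1 + - 1 * \<phi>1 x 0)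
         (\<lambda>x. 1 * (1 * \<phi> x 1) + - 1 * (0 * \<phi> x 0))"
    using sl_expression_lincomb[OF phi_sub[of 1, unfolded sl_solution_def] phi_sub[of 0, unfolded sl_solution_def], where k = 1 and l = "- 1"] .
  moreover have "(\<lambda>x. 1 * \<phi> x 1 + - 1 * \<phi> x 0) = y" "(\<lambda>x. 1 * (1 * \<phi> x 1) + - 1 * (0 * \<phi> x 0)) = (\<lambda>x. \<phi> x 1)"
    by (simp_all add: y_def fun_eq_iff)
  ultimately have ye: "sl_expression w p q {a..c} y (\<lambda>x. 1 * \<phi>1 x 1 + - 1 * \<phi>1 x 0) (\<lambda>x. \<phi> x 1)"
    by (simp only:)
  have "AE x in lebesgue. x \<in> {a..c} \<longrightarrow> \<phi> x 1 = 0"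
    using sl_expression_zero(2)[OF ye J order_refl c(2) zero] .
  then have "\<phi> x 1 = 0" if "x \<in> {a..c}" for x
    using continuous_AE_zero_imp_zero[OF cont(1) c(2) _ that] by blast
  then have "weighted_square a c (\<lambda>x. \<phi> x 1) = integral {a..c} (\<lambda>t. 0)"
    unfolding weighted_square_def by (intro integral_cong) auto
  then show False using phi_nonzero[OF c, of 1] by simp
qed

end

section \<open>The weighted space\<close>

lemma L2w_cong:
  assumes "h \<in> L2w I w" "\<And>x. x \<in> I \<Longrightarrow> h x = k x"
  shows "k \<in> L2w I w"
proof -
  have "(\<lambda>x. indicator I x *\<^sub>R h x) = (\<lambda>x. indicator I x *\<^sub>R k x)"
    "(\<lambda>x. indicator I x *\<^sub>R ((cmod (h x))\<^sup>2 * w x)) = (\<lambda>x. indicator I x *\<^sub>R ((cmod (k x))\<^sup>2 * w x))"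
    using assms(2) by (auto simp: indicator_def fun_eq_iff)
  then show ?thesis
    using assms(1) by (simp add: L2w_def set_borel_measurable_def set_integrable_def)
qed

locale sl_exhaustion = sl_fundamental w p q I a \<alpha> \<theta> \<theta>1 \<phi> \<phi>1 for w p q I a \<alpha> \<theta> \<theta>1 \<phi> \<phi>1 +
  fixes bn :: "nat \<Rightarrow> real"
  assumes bn_in: "\<And>n. bn n \<in> I" "\<And>n. a < bn n" and bn_mono: "incseq bn"
    and bn_cofinal: "\<And>x. x \<in> I \<Longrightarrow> \<exists>n. x \<le> bn n"
begin

text \<open>Local integrability gives measurability on compact intervals only; the exhaustion by
  {a..bn n} carries it over to I.\<close>

lemma weight_measurable: "(\<lambda>x. indicator I x * w x) \<in> borel_measurable lebesgue"
proof (rule borel_measurable_LIMSEQ_real)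
  show "(\<lambda>x. indicator {a..bn n} x * w x) \<in> borel_measurable lebesgue" for n
    using coefficients_integrable(1)[OF initial_interval[OF bn_in(1)]]
    unfolding set_integrable_def by (simp add: borel_measurable_integrable)
  fix x
  have "\<forall>\<^sub>F n in sequentially. indicator {a..bn n} x * w x = indicator I x * w x"
  proof (cases "x \<in> I")
    case True
    then obtain n0 where "x \<le> bn n0" using bn_cofinal by blast
    then have "x \<in> {a..bn n}" if "n \<ge> n0" for n
      using a_least(2)[OF True] incseqD[OF bn_mono that] by simp
    then show ?thesis using True unfolding eventually_sequentially by (intro exI[of _ n0]) auto
  next
    case False
    then have "x \<notin> {a..bn n}" for n using initial_interval[OF bn_in(1)[of n]] by blast
    then show ?thesis using False by simp
  qed
  then show "(\<lambda>n. indicator {a..bn n} x * w x) \<longlonglongrightarrow> indicator I x * w x"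
    by (rule tendsto_eventually)
qed

lemma L2wD:
  assumes "h \<in> L2w I w"
  shows "(\<lambda>x. indicator I x *\<^sub>R h x) \<in> borel_measurable lebesgue"
    "integrable lebesgue (\<lambda>x. indicator I x * ((cmod (h x))\<^sup>2 * w x))"
  using assms by (simp_all add: L2w_def set_borel_measurable_def set_integrable_def)

lemma L2wI:
  assumes meas: "(\<lambda>x. indicator I x *\<^sub>R h x) \<in> borel_measurable lebesgue"
    and g: "integrable lebesgue g" and le: "AE x in lebesgue. x \<in> I \<longrightarrow> (cmod (h x))\<^sup>2 * w x \<le> g x"
    and g0: "AE x in lebesgue. 0 \<le> g x"
  shows "h \<in> L2w I w"
proof -
  have eq: "(\<lambda>x. indicator I x * ((cmod (h x))\<^sup>2 * w x)) = (\<lambda>x. (cmod (indicator I x *\<^sub>R h x))\<^sup>2 * (indicator I x * w x))"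
    by (auto simp: indicator_def)
  have "integrable lebesgue (\<lambda>x. indicator I x * ((cmod (h x))\<^sup>2 * w x))"
  proof (rule Bochner_Integration.integrable_bound[OF g])
    show "(\<lambda>x. indicator I x * ((cmod (h x))\<^sup>2 * w x)) \<in> borel_measurable lebesgue"
      unfolding eq using meas weight_measurable by measurable
    show "AE x in lebesgue. norm (indicator I x * ((cmod (h x))\<^sup>2 * w x)) \<le> norm (g x)"
      using le w_pos g0
      by eventually_elim (auto simp: indicator_def abs_mult)
  qed
  then show ?thesis using meas by (simp add: L2w_def set_borel_measurable_def set_integrable_def)
qed

text \<open>The square of \<open>L2w_norm\<close>, which avoids square roots in quadratic estimates.
  A function whose integral diverges gets the default value 0, so upper bounds come with membership
  in \<open>L2w\<close>.\<close>

definition N2 :: "(real \<Rightarrow> complex) \<Rightarrow> real" where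
  "N2 h = integral\<^sup>L lebesgue (\<lambda>x. indicator I x * ((cmod (h x))\<^sup>2 * w x))"

lemma L2w_norm_eq: "L2w_norm I w h = sqrt (N2 h)"
  by (simp add: L2w_norm_def N2_def set_lebesgue_integral_def)

lemma weight_AE_nonneg: "AE x in lebesgue. 0 \<le> indicator I x * ((cmod (h x))\<^sup>2 * w x)"
  using w_pos by eventually_elim (auto simp: indicator_def)

lemma N2_nonneg: "0 \<le> N2 h"
  unfolding N2_def using weight_AE_nonneg by (rule integral_nonneg_AE)

lemma N2_cong_AE:
  assumes "AE x in lebesgue. x \<in> I \<longrightarrow> h x = k x" "h \<in> L2w I w" "k \<in> L2w I w"
  shows "N2 h = N2 k"
  unfolding N2_def
proof (rule integral_cong_AE)
  show "AE x in lebesgue. indicator I x * ((cmod (h x))\<^sup>2 * w x) = indicator I x * ((cmod (k x))\<^sup>2 * w x)"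
    using assms(1) by eventually_elim (auto simp: indicator_def)
qed (use L2wD(2)[OF assms(2)] L2wD(2)[OF assms(3)] in \<open>auto intro: borel_measurable_integrable\<close>)

lemma N2_zero: "(\<And>x. x \<in> I \<Longrightarrow> h x = 0) \<Longrightarrow> N2 h = 0"
proof -
  assume "\<And>x. x \<in> I \<Longrightarrow> h x = 0"
  then have "(\<lambda>x. indicator I x * ((cmod (h x))\<^sup>2 * w x)) = (\<lambda>x. 0)" by (auto simp: indicator_def)
  then show ?thesis by (simp add: N2_def)
qed

lemma N2_cmult: "N2 (\<lambda>x. A * h x) = (cmod A)\<^sup>2 * N2 h"
proof -
  have "N2 (\<lambda>x. A * h x) = integral\<^sup>L lebesgue (\<lambda>x. (cmod A)\<^sup>2 * (indicator I x * ((cmod (h x))\<^sup>2 * w x)))"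
    unfolding N2_def by (simp add: norm_mult power_mult_distrib mult.assoc mult.left_commute)
  then show ?thesis by (simp add: N2_def)
qed

lemma N2_add:
  assumes h: "h \<in> L2w I w" and k: "k \<in> L2w I w"
  shows "(\<lambda>x. h x + k x) \<in> L2w I w" "N2 (\<lambda>x. h x + k x) \<le> 2 * N2 h + 2 * N2 k"
proof -
  define g where "g x = 2 * (indicator I x * ((cmod (h x))\<^sup>2 * w x)) + 2 * (indicator I x * ((cmod (k x))\<^sup>2 * w x))" for x
  have g: "integrable lebesgue g" unfolding g_def
    using L2wD(2)[OF h] L2wD(2)[OF k] by simp
  have le: "AE x in lebesgue. x \<in> I \<longrightarrow> (cmod (h x + k x))\<^sup>2 * w x \<le> g x"
    using w_pos
  proof (eventually_elim, intro impI)
    fix x assume x: "x \<in> I \<longrightarrow> 0 < w x" "x \<in> I"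
    then have "(cmod (h x + k x))\<^sup>2 * w x \<le> (2 * (cmod (h x))\<^sup>2 + 2 * (cmod (k x))\<^sup>2) * w x"
      by (intro mult_right_mono square_norm_add_le) auto
    then show "(cmod (h x + k x))\<^sup>2 * w x \<le> g x" using x by (simp add: g_def algebra_simps)
  qed
  have g0: "AE x in lebesgue. 0 \<le> g x"
    using weight_AE_nonneg[of h] weight_AE_nonneg[of k] by eventually_elim (simp add: g_def)
  have "(\<lambda>x. indicator I x *\<^sub>R h x + indicator I x *\<^sub>R k x) \<in> borel_measurable lebesgue"
    using L2wD(1)[OF h] L2wD(1)[OF k] by measurable
  then show mem: "(\<lambda>x. h x + k x) \<in> L2w I w"
    using g le g0 by (intro L2wI) (auto simp: scaleR_add_right)
  have "N2 (\<lambda>x. h x + k x) \<le> integral\<^sup>L lebesgue g"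
    unfolding N2_def
  proof (rule integral_mono_AE[OF L2wD(2)[OF mem] g])
    show "AE x in lebesgue. indicator I x * ((cmod (h x + k x))\<^sup>2 * w x) \<le> g x"
      using le g0 by eventually_elim (auto simp: indicator_def)
  qed
  also have "\<dots> = 2 * N2 h + 2 * N2 k"
    unfolding g_def N2_def using L2wD(2)[OF h] L2wD(2)[OF k] by simp
  finally show "N2 (\<lambda>x. h x + k x) \<le> 2 * N2 h + 2 * N2 k" .
qed

lemma L2w_cmult:
  assumes h: "h \<in> L2w I w"
  shows "(\<lambda>x. A * h x) \<in> L2w I w"
proof (rule L2wI[of _ "\<lambda>x. (cmod A)\<^sup>2 * (indicator I x * ((cmod (h x))\<^sup>2 * w x))"])
  have "(\<lambda>x. A * (indicator I x *\<^sub>R h x)) \<in> borel_measurable lebesgue"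
    using L2wD(1)[OF h] by measurable
  then show "(\<lambda>x. indicator I x *\<^sub>R (A * h x)) \<in> borel_measurable lebesgue" by simp
  show "integrable lebesgue (\<lambda>x. (cmod A)\<^sup>2 * (indicator I x * ((cmod (h x))\<^sup>2 * w x)))"
    using L2wD(2)[OF h] by simp
  show "AE x in lebesgue. x \<in> I \<longrightarrow> (cmod (A * h x))\<^sup>2 * w x \<le> (cmod A)\<^sup>2 * (indicator I x * ((cmod (h x))\<^sup>2 * w x))"
    by (simp add: norm_mult power_mult_distrib)
  show "AE x in lebesgue. 0 \<le> (cmod A)\<^sup>2 * (indicator I x * ((cmod (h x))\<^sup>2 * w x))"
    using weight_AE_nonneg[of h] by eventually_elim (auto intro: mult_nonneg_nonneg)
qed

lemma L2w_lincomb: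
  "h \<in> L2w I w \<Longrightarrow> k \<in> L2w I w \<Longrightarrow> (\<lambda>x. A * h x + B * k x) \<in> L2w I w"
  by (intro N2_add L2w_cmult)

lemma weighted_square_has_integral:
  assumes h: "continuous_on {a..c} h" and c: "c \<in> I"
  shows "integrable lebesgue (\<lambda>x. indicator {a..c} x * ((cmod (h x))\<^sup>2 * w x))"
    "integral\<^sup>L lebesgue (\<lambda>x. indicator {a..c} x * ((cmod (h x))\<^sup>2 * w x)) = weighted_square a c h"
proof -
  have ai: "set_integrable lebesgue {a..c} (\<lambda>x. (cmod (h x))\<^sup>2 * w x)"
    by (intro absolutely_integrable_continuous_mult_real continuous_intros h coefficients_integrable initial_interval c)
  then show "integrable lebesgue (\<lambda>x. indicator {a..c} x * ((cmod (h x))\<^sup>2 * w x))"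
    by (simp add: set_integrable_def)
  obtain N where N: "negligible N" "\<And>x. x \<notin> N \<Longrightarrow> x \<in> I \<Longrightarrow> 0 < w x"
    using AE_lebesgue_negligibleE[OF w_pos] by metis
  have "integral\<^sup>L lebesgue (\<lambda>x. indicator {a..c} x * ((cmod (h x))\<^sup>2 * w x)) = integral {a..c} (\<lambda>x. (cmod (h x))\<^sup>2 * w x)"
    using set_lebesgue_integral_eq_integral(2)[OF ai] by (simp add: set_lebesgue_integral_def)
  also have "\<dots> = weighted_square a c h"
    unfolding weighted_square_def using N initial_interval[OF c]
    by (intro integral_spike[OF N(1)]) (force simp: mult.commute subset_iff)
  finally show "integral\<^sup>L lebesgue (\<lambda>x. indicator {a..c} x * ((cmod (h x))\<^sup>2 * w x)) = weighted_square a c h" .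
qed

lemma weighted_square_le_N2:
  assumes h: "continuous_on {a..c} h" and c: "c \<in> I" and L2: "h \<in> L2w I w"
  shows "weighted_square a c h \<le> N2 h"
  unfolding weighted_square_has_integral(2)[OF h c, symmetric] N2_def
proof (rule integral_mono_AE[OF weighted_square_has_integral(1)[OF h c] L2wD(2)[OF L2]])
  show "AE x in lebesgue. indicator {a..c} x * ((cmod (h x))\<^sup>2 * w x) \<le> indicator I x * ((cmod (h x))\<^sup>2 * w x)"
    using weight_AE_nonneg[of h] by eventually_elim (use initial_interval[OF c] in \<open>auto simp: indicator_def subset_iff\<close>)
qed

lemma L2w_truncate:
  assumes h: "continuous_on {a..c} h" and c: "c \<in> I"
  shows "(\<lambda>x. if x \<le> c then h x else 0) \<in> L2w I w"
proof (rule L2wI[OF _ weighted_square_has_integral(1)[OF h c]])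
  have eq: "(\<lambda>x. indicator I x *\<^sub>R (if x \<le> c then h x else 0)) = (\<lambda>x. indicator {a..c} x *\<^sub>R h x)"
    using initial_interval[OF c] a_least(2) by (auto simp: indicator_def fun_eq_iff)
  have "h absolutely_integrable_on {a..c}" by (rule absolutely_integrable_continuous_real[OF h])
  then show "(\<lambda>x. indicator I x *\<^sub>R (if x \<le> c then h x else 0)) \<in> borel_measurable lebesgue"
    unfolding eq set_integrable_def by (rule borel_measurable_integrable)
  show "AE x in lebesgue. x \<in> I \<longrightarrow> (cmod (if x \<le> c then h x else 0))\<^sup>2 * w x \<le> indicator {a..c} x * ((cmod (h x))\<^sup>2 * w x)"
    using a_least(2) by (auto simp: indicator_def)
  show "AE x in lebesgue. 0 \<le> indicator {a..c} x * ((cmod (h x))\<^sup>2 * w x)"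
    using w_pos by eventually_elim (use initial_interval[OF c] in \<open>auto simp: indicator_def subset_iff\<close>)
qed

text \<open>Square integrability is decided near the singular end: h differs from k by a continuous
  function truncated to {a..c}.\<close>

lemma L2w_extend:
  assumes h: "continuous_on {a..c} h" "continuous_on {a..c} k" and c: "c \<in> I" and k: "k \<in> L2w I w"
    and eq: "\<And>x. x \<in> I \<Longrightarrow> c \<le> x \<Longrightarrow> h x = k x"
  shows "h \<in> L2w I w"
proof (rule L2w_cong)
  show "(\<lambda>x. k x + (if x \<le> c then h x - k x else 0)) \<in> L2w I w"
    by (intro N2_add k L2w_truncate c continuous_intros h)
  show "k x + (if x \<le> c then h x - k x else 0) = h x" if "x \<in> I" for x
    using eq[OF that] by auto
qed

lemma L2w_tail:
  assumes h: "h \<in> L2w I w" "continuous_on {a..c} h" and c: "c \<in> I"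
  shows "(\<lambda>x. if x \<le> c then 0 else h x) \<in> L2w I w"
proof (rule L2w_cong)
  show "(\<lambda>x. h x + (if x \<le> c then - h x else 0)) \<in> L2w I w"
    by (intro N2_add h L2w_truncate c continuous_intros)
qed auto

text \<open>Dominated convergence: each point of I is eventually passed by the sequence, and from
  then on the truncated integrand is 0 there.\<close>

lemma N2_tail_tendsto_0:
  assumes h: "h \<in> L2w I w" "\<And>n. continuous_on {a..bn n} h"
  shows "(\<lambda>n. N2 (\<lambda>x. if x \<le> bn n then 0 else h x)) \<longlonglongrightarrow> 0"
proof -
  have "(\<lambda>n. N2 (\<lambda>x. if x \<le> bn n then 0 else h x)) \<longlonglongrightarrow> integral\<^sup>L lebesgue (\<lambda>x::real. 0::real)"
    unfolding N2_def
  proof (rule integral_dominated_convergence)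
    show "integrable lebesgue (\<lambda>x. indicator I x * ((cmod (h x))\<^sup>2 * w x))" by (rule L2wD(2)[OF h(1)])
    show "(\<lambda>x. indicator I x * ((cmod (if x \<le> bn n then 0 else h x))\<^sup>2 * w x)) \<in> borel_measurable lebesgue" for n
      using L2wD(2)[OF L2w_tail[OF h bn_in(1)]] by (rule borel_measurable_integrable)
    show "AE x in lebesgue. norm (indicator I x * ((cmod (if x \<le> bn n then 0 else h x))\<^sup>2 * w x)) \<le>
        indicator I x * ((cmod (h x))\<^sup>2 * w x)" for n
      using w_pos by eventually_elim (auto simp: indicator_def)
    show "AE x in lebesgue. (\<lambda>n. indicator I x * ((cmod (if x \<le> bn n then 0 else h x))\<^sup>2 * w x)) \<longlonglongrightarrow> 0"
    proof (rule AE_I2)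
      fix x
      have "\<forall>\<^sub>F n in sequentially. indicator I x * ((cmod (if x \<le> bn n then 0 else h x))\<^sup>2 * w x) = 0"
      proof (cases "x \<in> I")
        case True
        then obtain n0 where "x \<le> bn n0" using bn_cofinal by blast
        then have "x \<le> bn n" if "n \<ge> n0" for n using incseqD[OF bn_mono that] by simp
        then show ?thesis unfolding eventually_sequentially by (intro exI[of _ n0]) auto
      qed simp
      then show "(\<lambda>n. indicator I x * ((cmod (if x \<le> bn n then 0 else h x))\<^sup>2 * w x)) \<longlonglongrightarrow> 0"
        by (rule tendsto_eventually)
    qed
  qed simp
  then show ?thesis by simp
qed

end

section \<open>The singular operator and its resolvent\<close>

text \<open>\<open>D y u\<close> stands for the boundary condition at the singular endpoint: a linear condition that
  depends only on the values near that endpoint.\<close>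

locale sl_operator = sl_exhaustion w p q I a \<alpha> \<theta> \<theta>1 \<phi> \<phi>1 bn for w p q I a \<alpha> \<theta> \<theta>1 \<phi> \<phi>1 bn +
  fixes D :: "(real \<Rightarrow> complex) \<Rightarrow> (real \<Rightarrow> complex) \<Rightarrow> bool"
  assumes D_lincomb: "\<And>y u z v A B. D y u \<Longrightarrow> D z v \<Longrightarrow> D (\<lambda>x. A * y x + B * z x) (\<lambda>x. A * u x + B * v x)"
    and D_local: "\<And>y u z v c. D y u \<Longrightarrow> c \<in> I \<Longrightarrow> (\<And>x. x \<in> I \<Longrightarrow> c \<le> x \<Longrightarrow> y x = z x \<and> u x = v x) \<Longrightarrow> D z v"
begin

definition bc_op :: "(real \<Rightarrow> complex) \<Rightarrow> (real \<Rightarrow> complex) \<Rightarrow> bool" where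
  "bc_op y f \<longleftrightarrow> y \<in> L2w I w \<and> f \<in> L2w I w \<and>
     (\<exists>u. sl_expression w p q I y u f \<and> cos \<alpha> * y a + sin \<alpha> * u a = 0 \<and> D y u)"

definition weyl :: "complex \<Rightarrow> complex \<Rightarrow> bool" where
  "weyl l z \<longleftrightarrow> (\<lambda>x. \<theta> x l + z * \<phi> x l) \<in> L2w I w \<and>
     D (\<lambda>x. \<theta> x l + z * \<phi> x l) (\<lambda>x. \<theta>1 x l + z * \<phi>1 x l)"

lemma phi_eigenfunctionI:
  assumes L2: "(\<lambda>x. \<phi> x l) \<in> L2w I w" and D: "D (\<lambda>x. \<phi> x l) (\<lambda>x. \<phi>1 x l)"
  shows "bc_op (\<lambda>x. \<phi> x l) (\<lambda>x. l * \<phi> x l)"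
  using L2 D L2w_cmult[OF L2, of l] phi_sol[of l, unfolded sl_solution_def]
  unfolding bc_op_def by (intro conjI exI[of _ "\<lambda>x. \<phi>1 x l"]) (auto simp: phi_init)

lemma phi_N2_pos:
  assumes "(\<lambda>x. \<phi> x l) \<in> L2w I w"
  shows "0 < N2 (\<lambda>x. \<phi> x l)"
proof -
  note c = bn_in(1)[of 0]
  have "weighted_square a (bn 0) (\<lambda>x. \<phi> x l) \<le> N2 (\<lambda>x. \<phi> x l)"
    by (intro weighted_square_le_N2 solution_continuous(1)[OF phi_sol] c assms)
  moreover have "0 \<le> weighted_square a (bn 0) (\<lambda>x. \<phi> x l)"
    by (intro weighted_square_nonneg solution_continuous(1)[OF phi_sol] c initial_interval)
  ultimately show ?thesis using phi_nonzero[OF c bn_in(2), of l] by linarith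
qed

text \<open>By the initial values of \<phi>, the coefficient of \<theta> is exactly the boundary
  form cos \<alpha> y(a) + sin \<alpha> u(a).\<close>

lemma boundary_condition_expansion:
  assumes y: "sl_solution w p q {a..c} l y u" and c: "c \<in> I" "a < c"
    and bc: "cos \<alpha> * y a + sin \<alpha> * u a = 0"
  obtains B where "\<And>x. x \<in> {a..c} \<Longrightarrow> y x = B * \<phi> x l" "\<And>x. x \<in> {a..c} \<Longrightarrow> u x = B * \<phi>1 x l"
proof -
  have "is_interval {a..c}" by (rule is_interval_cc)
  moreover have "a \<in> {a..c}" using c by simp
  ultimately obtain A B where AB: "\<And>x. x \<in> {a..c} \<Longrightarrow> y x = A * \<theta> x l + B * \<phi> x l"
    "\<And>x. x \<in> {a..c} \<Longrightarrow> u x = A * \<theta>1 x l + B * \<phi>1 x l"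
    "A = - (y a * \<phi>1 a l - u a * \<phi> a l)"
    using solution_expansion[OF y initial_interval[OF c(1)]] by metis
  have "A = 0" using AB(3) bc by (simp add: phi_init algebra_simps)
  show thesis by (rule that[of B]) (use AB(1,2) \<open>A = 0\<close> in simp_all)
qed

text \<open>The condition at a leaves only a multiple of \<phi>(.,\<mu>), and the factor is nonzero
  because the norm of the eigenfunction is. Rescaling then transfers integrability and, by linearity
  and locality of \<open>D\<close>, the condition at the singular end.\<close>

lemma eigenvalue_phi:
  assumes "op_eigenvalue I w bc_op \<mu>"
  shows "bc_op (\<lambda>x. \<phi> x \<mu>) (\<lambda>x. \<mu> * \<phi> x \<mu>)"
proof -
  obtain y f where yf: "bc_op y f" "L2w_norm I w y \<noteq> 0" "AE x in lebesgue. x \<in> I \<longrightarrow> f x = \<mu> * y x"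
    using assms unfolding op_eigenvalue_def by blast
  obtain u where u: "sl_expression w p q I y u f" "cos \<alpha> * y a + sin \<alpha> * u a = 0" "D y u" "y \<in> L2w I w"
    using yf(1) unfolding bc_op_def by blast
  have sol: "sl_solution w p q I \<mu> y u"
    unfolding sl_solution_def by (rule sl_expression_cong_AE[OF u(1) yf(3)])
  obtain A B where AB: "\<And>x. x \<in> I \<Longrightarrow> y x = A * \<theta> x \<mu> + B * \<phi> x \<mu>"
    "\<And>x. x \<in> I \<Longrightarrow> u x = A * \<theta>1 x \<mu> + B * \<phi>1 x \<mu>" "A = - (y a * \<phi>1 a \<mu> - u a * \<phi> a \<mu>)"
    using solution_expansion[OF sol order_refl I_interval a_least(1)] by metis
  have "A = 0" using AB(3) u(2) by (simp add: phi_init algebra_simps)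
  have "B \<noteq> 0"
  proof
    assume "B = 0"
    then have "N2 y = 0" using AB(1) \<open>A = 0\<close> by (intro N2_zero) simp
    then show False using yf(2) by (simp add: L2w_norm_eq)
  qed
  have "(\<lambda>x. \<phi> x \<mu>) \<in> L2w I w"
    using \<open>A = 0\<close> \<open>B \<noteq> 0\<close> AB(1) by (intro L2w_cong[OF L2w_cmult[OF u(4), of "1 / B"]]) simp
  moreover have "D (\<lambda>x. \<phi> x \<mu>) (\<lambda>x. \<phi>1 x \<mu>)"
    using \<open>A = 0\<close> \<open>B \<noteq> 0\<close> AB
    by (intro D_local[OF D_lincomb[OF u(3) u(3), of "1 / B" 0] a_least(1)]) simp
  ultimately show ?thesis by (rule phi_eigenfunctionI)
qed

text \<open>The bracket of \<open>\<phi>(\<cdot>, \<mu>)\<close> with the Weyl solution at \<open>l\<close>, evaluated at \<open>c\<close>, is the coefficient of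
  \<open>\<phi>(\<cdot>, l)\<close> in \<open>(\<mu> - l) y - \<phi>(\<cdot>, \<mu>)\<close> on \<open>[a, c]\<close>, where \<open>y\<close> is the image under the resolvent at \<open>l\<close> of the
  truncation of \<open>\<phi>(\<cdot>, \<mu>)\<close> to \<open>[a, c]\<close>.\<close>

lemma resolvent_bracket_bound:
  assumes l: "l \<in> resolvent_set I w bc_op"
    and est: "\<And>y f. bc_op y f \<Longrightarrow> N2 y \<le> C * N2 (\<lambda>x. f x - l * y x)"
    and eig: "bc_op (\<lambda>x. \<phi> x \<mu>) (\<lambda>x. \<mu> * \<phi> x \<mu>)"
    and m: "\<And>l. \<exists>!z. weyl l z \<Longrightarrow> weyl l (m l)" and c: "c \<in> I" "a < c"
  shows "(cmod (sl_bracket (\<lambda>x. \<phi> x \<mu>) (\<lambda>x. \<phi>1 x \<mu>) (\<lambda>x. \<theta> x l + m l * \<phi> x l) (\<lambda>x. \<theta>1 x l + m l * \<phi>1 x l) c))\<^sup>2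
     * weighted_square a c (\<lambda>x. \<phi> x l) \<le> C * ((cmod (\<mu> - l))\<^sup>2 * N2 (\<lambda>x. if x \<le> c then 0 else \<phi> x \<mu>))"
proof -
  define g where "g x = (if x \<le> c then \<phi> x \<mu> else 0)" for x
  note cphi = solution_continuous[OF phi_sol c(1)] and J = initial_interval[OF c(1)]
  have gL2: "g \<in> L2w I w" unfolding g_def by (rule L2w_truncate[OF cphi(1) c(1)])
  obtain y f where yf: "bc_op y f" and fy: "AE x in lebesgue. x \<in> I \<longrightarrow> f x - l * y x = g x"
    using l gL2 unfolding resolvent_set_def by blast
  obtain u where u: "sl_expression w p q I y u f" "cos \<alpha> * y a + sin \<alpha> * u a = 0" "D y u" "y \<in> L2w I w" "f \<in> L2w I w"
    using yf unfolding bc_op_def by blast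
  have mu: "(\<lambda>x. \<phi> x \<mu>) \<in> L2w I w" "D (\<lambda>x. \<phi> x \<mu>) (\<lambda>x. \<phi>1 x \<mu>)"
  proof -
    obtain v where v: "sl_expression w p q I (\<lambda>x. \<phi> x \<mu>) v (\<lambda>x. \<mu> * \<phi> x \<mu>)" "D (\<lambda>x. \<phi> x \<mu>) v"
        "cos \<alpha> * \<phi> a \<mu> + sin \<alpha> * v a = 0" and L2: "(\<lambda>x. \<phi> x \<mu>) \<in> L2w I w"
      using eig unfolding bc_op_def by blast
    show "(\<lambda>x. \<phi> x \<mu>) \<in> L2w I w" by fact
    \<comment> \<open>\<open>bc_op\<close> hides the quasi-derivative behind an existential. The
      difference of two candidates is a quasi-derivative of the zero function and hence 0.\<close>
    have eq: "v x = \<phi>1 x \<mu>" if x: "x \<in> I" for x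
    proof -
      obtain n where n: "x \<le> bn n" using bn_cofinal[OF x] by blast
      have J: "{a..bn n} \<subseteq> I" by (rule initial_interval[OF bn_in(1)])
      have "sl_expression w p q I (\<lambda>x. 1 * \<phi> x \<mu> + - 1 * \<phi> x \<mu>) (\<lambda>x. 1 * v x + - 1 * \<phi>1 x \<mu>)
              (\<lambda>x. 1 * (\<mu> * \<phi> x \<mu>) + - 1 * (\<mu> * \<phi> x \<mu>))"
        by (rule sl_expression_lincomb[OF v(1) phi_sol[of \<mu>, unfolded sl_solution_def], where k = 1 and l = "- 1"])
      from sl_expression_zero(1)[OF this order_refl J bn_in(2), of x]
      show ?thesis using n a_least(2)[OF x] by simp
    qed
    show "D (\<lambda>x. \<phi> x \<mu>) (\<lambda>x. \<phi>1 x \<mu>)"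
      by (rule D_local[OF v(2) a_least(1)]) (use eq in simp)
  qed
  \<comment> \<open>Otherwise \<phi>(.,l) would be an eigenfunction, against the resolvent estimate.
    This gives uniqueness of the Weyl number at l and excludes a nonzero y that is a pure multiple
    of \<phi>(.,l) beyond c.\<close>
  have no_phi: "\<not> ((\<lambda>x. \<phi> x l) \<in> L2w I w \<and> D (\<lambda>x. \<phi> x l) (\<lambda>x. \<phi>1 x l))"
  proof
    assume *: "(\<lambda>x. \<phi> x l) \<in> L2w I w \<and> D (\<lambda>x. \<phi> x l) (\<lambda>x. \<phi>1 x l)"
    have "N2 (\<lambda>x. \<phi> x l) \<le> C * N2 (\<lambda>x. l * \<phi> x l - l * \<phi> x l)"
      using * by (intro est phi_eigenfunctionI) auto
    also have "\<dots> = 0" by (simp add: N2_zero)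
    finally show False using phi_N2_pos[of l] * by simp
  qed
  define \<psi> \<psi>1 where "\<psi> x = \<theta> x l + m l * \<phi> x l" and "\<psi>1 x = \<theta>1 x l + m l * \<phi>1 x l" for x
  \<comment> \<open>Beyond c the right-hand side g is zero, so y is there a solution at l that
    satisfies the end condition, hence a multiple of the Weyl solution; its bracket with \<psi>
    vanishes.\<close>
  have y_psi: "y c * \<psi>1 c - u c * \<psi> c = 0"
  proof -
    define T where "T = {x \<in> I. c \<le> x}"
    have T: "T \<subseteq> I" "c \<in> T" using c by (auto simp: T_def)
    have "T = I \<inter> {c..}" by (auto simp: T_def)
    then have T_int: "is_interval T" using is_interval_Int[OF I_interval is_interval_ci] by simp
    \<comment> \<open>At c itself g has the value \<phi>(c,\<mu>), so this one point of T is
      dropped.\<close>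
    have "AE x in lebesgue. x \<notin> {c}"
      by (rule AE_not_in) (simp flip: negligible_iff_null_sets)
    with fy have "AE x in lebesgue. x \<in> T \<longrightarrow> f x = l * y x"
      by eventually_elim (auto simp: T_def g_def)
    then have solT: "sl_solution w p q T l y u"
      unfolding sl_solution_def by (intro sl_expression_cong_AE[OF sl_expression_subset[OF u(1) T(1)]])
    obtain A B where AB: "\<And>x. x \<in> T \<Longrightarrow> y x = A * \<theta> x l + B * \<phi> x l"
        "\<And>x. x \<in> T \<Longrightarrow> u x = A * \<theta>1 x l + B * \<phi>1 x l"
      using solution_expansion[OF solT T(1) T_int T(2)] by metis
    have ext: "(\<lambda>x. A * \<theta> x l + B * \<phi> x l) \<in> L2w I w"
      by (rule L2w_extend[OF _ _ c(1) u(4)])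
         (use AB(1) in \<open>auto simp: T_def intro!: continuous_intros solution_continuous(1)[OF theta_sol c(1)] cphi
            sl_expression_continuous(1)[OF u(1) J]\<close>)
    have D: "D (\<lambda>x. A * \<theta> x l + B * \<phi> x l) (\<lambda>x. A * \<theta>1 x l + B * \<phi>1 x l)"
      by (rule D_local[OF u(3) c(1)]) (use AB in \<open>auto simp: T_def\<close>)
    show ?thesis
    proof (cases "A = 0")
      case True
      have "B = 0"
      proof (rule ccontr)
        assume "B \<noteq> 0"
        have "(\<lambda>x. \<phi> x l) \<in> L2w I w"
          using True \<open>B \<noteq> 0\<close> by (intro L2w_cong[OF L2w_cmult[OF ext, of "1 / B"]]) simp
        moreover have "D (\<lambda>x. \<phi> x l) (\<lambda>x. \<phi>1 x l)"
          using True \<open>B \<noteq> 0\<close> by (intro D_local[OF D_lincomb[OF D D, of "1 / B" 0] a_least(1)]) simp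
        ultimately show False using no_phi by blast
      qed
      then show ?thesis using AB T(2) True by simp
    next
      case False
      have "weyl l (B / A)" unfolding weyl_def
      proof
        show "(\<lambda>x. \<theta> x l + B / A * \<phi> x l) \<in> L2w I w"
          using False by (intro L2w_cong[OF L2w_cmult[OF ext, of "1 / A"]]) (simp add: field_simps)
        show "D (\<lambda>x. \<theta> x l + B / A * \<phi> x l) (\<lambda>x. \<theta>1 x l + B / A * \<phi>1 x l)"
          using False by (intro D_local[OF D_lincomb[OF D D, of "1 / A" 0] a_least(1)]) (simp add: field_simps)
      qed
      moreover have uniq: "z1 = z2" if w12: "weyl l z1" "weyl l z2" for z1 z2
      proof (rule ccontr)
        assume "z1 \<noteq> z2"
        \<comment> \<open>Two Weyl solutions differ by a multiple of \<phi>(.,l); k rescales the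
          difference to \<phi>(.,l) itself.\<close>
        define k where "k = 1 / (z1 - z2)"
        have k: "k * (z1 - z2) = 1" using \<open>z1 \<noteq> z2\<close> by (simp add: k_def)
        have eq: "k * (A + z1 * B) + - k * (A + z2 * B) = B" for A B
        proof -
          have "k * (A + z1 * B) + - k * (A + z2 * B) = (k * (z1 - z2)) * B" by (simp add: algebra_simps)
          then show ?thesis using k by simp
        qed
        have "(\<lambda>x. k * (\<theta> x l + z1 * \<phi> x l) + - k * (\<theta> x l + z2 * \<phi> x l)) \<in> L2w I w"
          using w12 unfolding weyl_def by (intro L2w_lincomb) auto
        moreover have "D (\<lambda>x. k * (\<theta> x l + z1 * \<phi> x l) + - k * (\<theta> x l + z2 * \<phi> x l))
            (\<lambda>x. k * (\<theta>1 x l + z1 * \<phi>1 x l) + - k * (\<theta>1 x l + z2 * \<phi>1 x l))"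
          using w12 unfolding weyl_def by (intro D_lincomb) auto
        ultimately show False using no_phi unfolding eq by blast
      qed
      ultimately have "\<exists>!z. weyl l z" by blast
      then have "m l = B / A" using m uniq \<open>weyl l (B / A)\<close> by blast
      then have "A * \<psi> c = y c" "A * \<psi>1 c = u c"
        using AB T(2) False by (simp_all add: \<psi>_def \<psi>1_def field_simps)
      then have "y c * \<psi>1 c - u c * \<psi> c = (A * \<psi> c) * \<psi>1 c - (A * \<psi>1 c) * \<psi> c" by simp
      then show ?thesis by simp
    qed
  qed
  \<comment> \<open>Applying M - l to z gives (\<mu> - l) (g - \<phi>(.,\<mu>)), which is - (\<mu> -
    l) times the tail of \<phi>(.,\<mu>). So the norm of z is controlled by the tail, while on
    {a..c} the equation is homogeneous and z is a multiple t of \<phi>(.,l).\<close>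
  define z v where "z x = (\<mu> - l) * y x + - 1 * \<phi> x \<mu>" and "v x = (\<mu> - l) * u x + - 1 * \<phi>1 x \<mu>" for x
  define fz where "fz x = (\<mu> - l) * f x + - 1 * (\<mu> * \<phi> x \<mu>)" for x
  have zv: "sl_expression w p q I z v fz"
    unfolding z_def v_def fz_def
    using sl_expression_lincomb[OF u(1) phi_sol[of \<mu>, unfolded sl_solution_def], where k = "\<mu> - l" and l = "- 1"] .
  have zL2: "z \<in> L2w I w" unfolding z_def by (intro L2w_lincomb u mu)
  have fzL2: "fz \<in> L2w I w" unfolding fz_def by (intro L2w_lincomb L2w_cmult u mu)
  have bcz: "cos \<alpha> * z a + sin \<alpha> * v a = 0"
  proof -
    have "cos \<alpha> * z a + sin \<alpha> * v a = (\<mu> - l) * (cos \<alpha> * y a + sin \<alpha> * u a)"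
      by (simp add: z_def v_def phi_init algebra_simps)
    then show ?thesis using u(2) by simp
  qed
  have "D z v" unfolding z_def v_def by (rule D_lincomb[OF u(3) mu(2)])
  then have Mz: "bc_op z fz" unfolding bc_op_def using zv zL2 fzL2 bcz by blast
  have fz_eq: "AE x in lebesgue. x \<in> I \<longrightarrow> fz x - l * z x = - (\<mu> - l) * (if x \<le> c then 0 else \<phi> x \<mu>)"
    using fy
  proof (eventually_elim, intro impI)
    fix x assume "x \<in> I \<longrightarrow> f x - l * y x = g x" "x \<in> I"
    then have "fz x - l * z x = (\<mu> - l) * g x - (\<mu> - l) * \<phi> x \<mu>"
      by (simp add: fz_def z_def algebra_simps flip: \<open>x \<in> I \<longrightarrow> f x - l * y x = g x\<close>)
    then show "fz x - l * z x = - (\<mu> - l) * (if x \<le> c then 0 else \<phi> x \<mu>)"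
      by (cases "x \<le> c") (simp_all add: g_def algebra_simps)
  qed
  have "N2 (\<lambda>x. fz x - l * z x) = N2 (\<lambda>x. - (\<mu> - l) * (if x \<le> c then 0 else \<phi> x \<mu>))"
  proof (rule N2_cong_AE[OF fz_eq])
    show "(\<lambda>x. fz x - l * z x) \<in> L2w I w"
      using L2w_lincomb[OF fzL2 zL2, of 1 "- l"] by simp
    show "(\<lambda>x. - (\<mu> - l) * (if x \<le> c then 0 else \<phi> x \<mu>)) \<in> L2w I w"
      by (intro L2w_cmult L2w_tail mu cphi c)
  qed
  also have "\<dots> = (cmod (\<mu> - l))\<^sup>2 * N2 (\<lambda>x. if x \<le> c then 0 else \<phi> x \<mu>)"
    by (subst N2_cmult) (simp add: norm_minus_commute)
  finally have Nz: "N2 z \<le> C * ((cmod (\<mu> - l))\<^sup>2 * N2 (\<lambda>x. if x \<le> c then 0 else \<phi> x \<mu>))"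
    using est[OF Mz] by (simp only:)
  have "AE x in lebesgue. x \<in> {a..c} \<longrightarrow> fz x = l * z x"
    using AE_imp_subset[OF fz_eq J] by eventually_elim auto
  then have sol: "sl_solution w p q {a..c} l z v"
    unfolding sl_solution_def by (intro sl_expression_cong_AE[OF sl_expression_subset[OF zv J]])
  obtain t where t: "\<And>x. x \<in> {a..c} \<Longrightarrow> z x = t * \<phi> x l" "\<And>x. x \<in> {a..c} \<Longrightarrow> v x = t * \<phi>1 x l"
    using boundary_condition_expansion[OF sol c bcz] by metis
  have "weighted_square a c z = (cmod t)\<^sup>2 * weighted_square a c (\<lambda>x. \<phi> x l)"
  proof -
    have "weighted_square a c z = integral {a..c} (\<lambda>x. (cmod t)\<^sup>2 * (\<bar>w x\<bar> * (cmod (\<phi> x l))\<^sup>2))"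
      unfolding weighted_square_def using t(1)
      by (intro integral_cong) (simp add: norm_mult power_mult_distrib)
    then show ?thesis by (simp add: weighted_square_def)
  qed
  moreover have "weighted_square a c z \<le> N2 z"
    by (rule weighted_square_le_N2[OF sl_expression_continuous(1)[OF zv J] c(1) zL2])
  \<comment> \<open>Since \<phi>(.,\<mu>) = (\<mu> - l) y - z, the bracket with \<psi> splits in
    two. The part with y vanishes by \<open>y_psi\<close>; the part with z equals t
    [\<phi>(.,l), \<theta>(.,l)] = t.\<close>
  moreover have "\<phi> c \<mu> * \<psi>1 c - \<phi>1 c \<mu> * \<psi> c = - t"
  proof -
    have zc: "z c = t * \<phi> c l" "v c = t * \<phi>1 c l" using t[of c] c by auto
    have "\<phi> c \<mu> * \<psi>1 c - \<phi>1 c \<mu> * \<psi> c = (\<mu> - l) * (y c * \<psi>1 c - u c * \<psi> c) - (z c * \<psi>1 c - v c * \<psi> c)"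
      by (simp add: z_def v_def algebra_simps)
    also have "\<dots> = - (z c * \<psi>1 c - v c * \<psi> c)" using y_psi by simp
    also have "\<dots> = t * (\<theta> c l * \<phi>1 c l - \<theta>1 c l * \<phi> c l)"
      unfolding zc \<psi>_def \<psi>1_def by (simp add: algebra_simps)
    finally show ?thesis using theta_phi_bracket[OF c(1)] by simp
  qed
  ultimately show ?thesis using Nz by (simp add: sl_bracket_def \<psi>_def \<psi>1_def)
qed

end

section \<open>Eigenvalues of the truncated operators\<close>

context sl_exhaustion
begin

text \<open>\<phi>(.,l) satisfies both boundary conditions, so a resolvent estimate at l would force
  its norm to be 0.\<close>

lemma boundary_zero_in_spectrum:
  assumes c: "c \<in> I" "a < c" and zero: "\<phi> c l * cos \<beta> + \<phi>1 c l * sin \<beta> = 0"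
  shows "l \<in> op_spectrum {a..c} w (regular_op a c w p q \<alpha> \<beta>)"
proof -
  note cont = solution_continuous(1)[OF phi_sol c(1)]
  have sub: "sl_expression w p q {a..c} (\<lambda>x. \<phi> x l) (\<lambda>x. \<phi>1 x l) (\<lambda>x. l * \<phi> x l)"
    by (rule sl_expression_subset[OF phi_sol[of l, unfolded sl_solution_def] initial_interval[OF c(1)]])
  have L2: "h \<in> L2w {a..c} w" if h: "continuous_on {a..c} h" for h
  proof -
    have "set_integrable lebesgue {a..c} h" by (rule absolutely_integrable_continuous_real[OF h])
    then show ?thesis
      using weighted_square_has_integral(1)[OF h c(1)]
      by (simp add: L2w_def set_borel_measurable_def set_integrable_def borel_measurable_integrable)
  qed
  have reg: "regular_op a c w p q \<alpha> \<beta> (\<lambda>x. \<phi> x l) (\<lambda>x. l * \<phi> x l)"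
    unfolding regular_op_def using sub zero
    by (intro conjI L2 exI[of _ "\<lambda>x. \<phi>1 x l"] continuous_intros cont) (auto simp: phi_init)
  have norm: "L2w_norm {a..c} w (\<lambda>x. \<phi> x l) = sqrt (weighted_square a c (\<lambda>x. \<phi> x l))"
    using weighted_square_has_integral(2)[OF cont c(1)] by (simp add: L2w_norm_def set_lebesgue_integral_def)
  have "0 < weighted_square a c (\<lambda>x. \<phi> x l)"
    using phi_nonzero[OF c, of l] weighted_square_nonneg[OF cont initial_interval[OF c(1)], of l] by linarith
  moreover have "sqrt (weighted_square a c (\<lambda>x. \<phi> x l)) \<le> 0" if l: "l \<in> resolvent_set {a..c} w (regular_op a c w p q \<alpha> \<beta>)"
  proof -
    obtain C where "L2w_norm {a..c} w (\<lambda>x. \<phi> x l) \<le> C * L2w_norm {a..c} w (\<lambda>x. l * \<phi> x l - l * \<phi> x l)"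
      using l reg unfolding resolvent_set_def by blast
    then show ?thesis unfolding norm by (simp add: L2w_norm_def set_lebesgue_integral_def)
  qed
  ultimately show ?thesis by (auto simp: op_spectrum_def)
qed

end

section \<open>Uniform estimates on a circle in the resolvent set\<close>

context sl_operator
begin

text \<open>Rewriting f - l0 y as (f - l y) + (l - l0) y costs a term 2 K |l - l0|^2 N2 y. With
  \<rho> = 1 / (2 K) and K \<ge> 1 it is at most half of N2 y and is absorbed, leaving 4 K.\<close>

lemma resolvent_local_bound:
  assumes l0: "l0 \<in> resolvent_set I w bc_op"
  obtains \<rho> C where "0 < \<rho>" "0 \<le> C"
    "\<And>l y f. norm (l - l0) < \<rho> \<Longrightarrow> bc_op y f \<Longrightarrow> N2 y \<le> C * N2 (\<lambda>x. f x - l * y x)"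
proof -
  obtain C0 where C0: "\<And>y f. bc_op y f \<Longrightarrow> L2w_norm I w y \<le> C0 * L2w_norm I w (\<lambda>x. f x - l0 * y x)"
    using l0 unfolding resolvent_set_def by blast
  define K where "K = C0\<^sup>2 + 1"
  have K: "1 \<le> K" by (simp add: K_def)
  define \<rho> where "\<rho> = 1 / (2 * K)"
  show thesis
  proof (rule that[of \<rho> "4 * K"])
    show "0 < \<rho>" "0 \<le> 4 * K" using K by (auto simp: \<rho>_def)
    fix l y f assume l: "norm (l - l0) < \<rho>" and yf: "bc_op y f"
    then have L2: "y \<in> L2w I w" "f \<in> L2w I w" by (auto simp: bc_op_def)
    have N0: "0 \<le> N2 (\<lambda>x. f x - l0 * y x)" by (rule N2_nonneg)
    have "N2 y = (L2w_norm I w y)\<^sup>2" by (simp add: L2w_norm_eq N2_nonneg)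
    also have "\<dots> \<le> (C0 * L2w_norm I w (\<lambda>x. f x - l0 * y x))\<^sup>2"
      using C0[OF yf] by (intro power_mono) (auto simp: L2w_norm_eq N2_nonneg)
    also have "\<dots> = C0\<^sup>2 * N2 (\<lambda>x. f x - l0 * y x)"
      by (simp add: power_mult_distrib L2w_norm_eq N2_nonneg)
    also have "\<dots> \<le> K * N2 (\<lambda>x. f x - l0 * y x)"
      using N0 by (intro mult_right_mono) (simp_all add: K_def)
    also have "N2 (\<lambda>x. f x - l0 * y x) \<le> 2 * N2 (\<lambda>x. f x - l * y x) + 2 * ((norm (l - l0))\<^sup>2 * N2 y)"
    proof -
      have 1: "(\<lambda>x. f x - l * y x) \<in> L2w I w" using L2w_lincomb[OF L2(2,1), of 1 "- l"] by simp
      have "N2 (\<lambda>x. (f x - l * y x) + (l - l0) * y x) \<le> 2 * N2 (\<lambda>x. f x - l * y x) + 2 * N2 (\<lambda>x. (l - l0) * y x)"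
        by (rule N2_add(2)[OF 1 L2w_cmult[OF L2(1)]])
      moreover have "(\<lambda>x. (f x - l * y x) + (l - l0) * y x) = (\<lambda>x. f x - l0 * y x)"
        by (simp add: algebra_simps)
      ultimately show ?thesis unfolding N2_cmult by simp
    qed
    finally have *: "N2 y \<le> K * (2 * N2 (\<lambda>x. f x - l * y x) + 2 * ((norm (l - l0))\<^sup>2 * N2 y))"
      using K by simp
    have "(norm (l - l0))\<^sup>2 \<le> \<rho>\<^sup>2" using l by (intro power_mono) auto
    also have "\<dots> \<le> 1 / (4 * K)"
      using K by (simp add: \<rho>_def power2_eq_square divide_simps)
    finally have "4 * K * (norm (l - l0))\<^sup>2 \<le> 1" using K by (simp add: field_simps)
    from mult_right_mono[OF this N2_nonneg[of y]]
    show "N2 y \<le> 4 * K * N2 (\<lambda>x. f x - l * y x)"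
      using * by (simp add: algebra_simps)
  qed
qed

text \<open>The mean square is positive at l0, and \<phi> is Lipschitz in l uniformly on {a..c}. The
  radius s makes the mean square of the difference at most N0 / 4, so N0 \<le> 2 * N0 / 4 plus twice
  the mean square at l.\<close>

lemma phi_square_lower_bound:
  assumes c: "c \<in> I" "a < c"
  obtains \<rho> \<kappa> where "0 < \<rho>" "0 < \<kappa>" "\<And>l. norm (l - l0) < \<rho> \<Longrightarrow> \<kappa> \<le> weighted_square a c (\<lambda>x. \<phi> x l)"
proof -
  note J = initial_interval[OF c(1)] and cont = solution_continuous(1)[OF phi_sol c(1)]
  define W where "W = integral {a..c} (\<lambda>t. \<bar>w t\<bar>)"
  have W: "0 < W" unfolding W_def by (rule weight_integral_pos(1)[OF c(2) J])
  define N0 where "N0 = weighted_square a c (\<lambda>x. \<phi> x l0)"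
  have N0: "0 < N0"
    unfolding N0_def using phi_nonzero[OF c, of l0] weighted_square_nonneg[OF cont J, of l0] by linarith
  obtain C \<delta> where C: "0 < \<delta>" "0 < C"
    "\<And>l x. norm (l - l0) < \<delta> \<Longrightarrow> x \<in> {a..c} \<Longrightarrow> norm (\<phi> x l - \<phi> x l0) \<le> C * norm (l - l0)"
    using uniformly_differentiable_family_lipschitz[OF phi_family(1)[OF c(1)]] by metis
  define s where "s = sqrt (N0 / (4 * W)) / C"
  have s: "0 < s" using N0 W C by (simp add: s_def)
  show thesis
  proof (rule that[of "min \<delta> s" "N0 / 4"])
    fix l assume l: "norm (l - l0) < min \<delta> s"
    have bound: "(cmod (\<phi> x l0 - \<phi> x l))\<^sup>2 \<le> N0 / (4 * W)" if "x \<in> {a..c}" for x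
    proof -
      have "cmod (\<phi> x l0 - \<phi> x l) \<le> C * norm (l - l0)"
        using C(3)[of l x] l that by (simp add: norm_minus_commute)
      also have "\<dots> \<le> C * s" using l C by (intro mult_left_mono) auto
      finally have "(cmod (\<phi> x l0 - \<phi> x l))\<^sup>2 \<le> (C * s)\<^sup>2" by (intro power_mono) auto
      then show ?thesis using C N0 W by (simp add: s_def)
    qed
    have "weighted_square a c (\<lambda>x. \<phi> x l0 - \<phi> x l) \<le> integral {a..c} (\<lambda>t. \<bar>w t\<bar> * (N0 / (4 * W)))"
      unfolding weighted_square_def using bound J
      by (intro integral_le weighted_square_integrable_on weighted_integrable_on continuous_intros cont mult_left_mono) auto
    also have "\<dots> = N0 / 4" using W by (simp add: W_def[symmetric])
    finally have d: "weighted_square a c (\<lambda>x. \<phi> x l0 - \<phi> x l) \<le> N0 / 4" .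
    have "N0 \<le> 2 * weighted_square a c (\<lambda>x. \<phi> x l0 - \<phi> x l) + 2 * weighted_square a c (\<lambda>x. \<phi> x l)"
      using weighted_square_add_le[OF continuous_on_diff[OF cont[of l0] cont[of l]] cont[of l] J] by (simp add: N0_def)
    then show "N0 / 4 \<le> weighted_square a c (\<lambda>x. \<phi> x l)" using d by simp
  qed (use C s N0 in auto)
qed

text \<open>The resolvent constant and the lower bound for \<phi>(.,l) are only local in l;
  compactness of the circle makes them global. The sum of the finitely many local constants bounds
  each of them, and none depends on n.\<close>

lemma bracket_uniform_bound:
  assumes S: "sphere \<mu> R \<subseteq> resolvent_set I w bc_op"
    and eig: "bc_op (\<lambda>x. \<phi> x \<mu>) (\<lambda>x. \<mu> * \<phi> x \<mu>)" and m: "\<And>l. \<exists>!z. weyl l z \<Longrightarrow> weyl l (m l)"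
  shows "\<exists>L. \<forall>l\<in>sphere \<mu> R. \<forall>n.
     (cmod (sl_bracket (\<lambda>x. \<phi> x \<mu>) (\<lambda>x. \<phi>1 x \<mu>) (\<lambda>x. \<theta> x l + m l * \<phi> x l) (\<lambda>x. \<theta>1 x l + m l * \<phi>1 x l) (bn n)))\<^sup>2
       \<le> L * N2 (\<lambda>x. if x \<le> bn n then 0 else \<phi> x \<mu>)"
proof -
  define T where "T l n = (cmod (sl_bracket (\<lambda>x. \<phi> x \<mu>) (\<lambda>x. \<phi>1 x \<mu>) (\<lambda>x. \<theta> x l + m l * \<phi> x l)
      (\<lambda>x. \<theta>1 x l + m l * \<phi>1 x l) (bn n)))\<^sup>2" for l n
  define N where "N n = N2 (\<lambda>x. if x \<le> bn n then 0 else \<phi> x \<mu>)" for n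
  have N: "0 \<le> N n" for n unfolding N_def by (rule N2_nonneg)
  have "\<exists>\<rho> L. 0 < \<rho> \<and> 0 \<le> L \<and> (\<forall>l n. l \<in> sphere \<mu> R \<longrightarrow> norm (l - l0) < \<rho> \<longrightarrow> T l n \<le> L * N n)"
    if l0: "l0 \<in> sphere \<mu> R" for l0
  proof -
    obtain \<rho>1 C where C: "0 < \<rho>1" "0 \<le> C"
      "\<And>l y f. norm (l - l0) < \<rho>1 \<Longrightarrow> bc_op y f \<Longrightarrow> N2 y \<le> C * N2 (\<lambda>x. f x - l * y x)"
      using resolvent_local_bound[of l0] l0 S by blast
    obtain \<rho>2 \<kappa> where \<kappa>: "0 < \<rho>2" "0 < \<kappa>" "\<And>l. norm (l - l0) < \<rho>2 \<Longrightarrow> \<kappa> \<le> weighted_square a (bn 0) (\<lambda>x. \<phi> x l)"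
      using phi_square_lower_bound[OF bn_in, of l0] by metis
    have "T l n \<le> (C * R\<^sup>2 / \<kappa>) * N n" if l: "l \<in> sphere \<mu> R" "norm (l - l0) < min \<rho>1 \<rho>2" for l n
    proof -
      have "\<kappa> \<le> weighted_square a (bn 0) (\<lambda>x. \<phi> x l)" using \<kappa>(3) l by simp
      \<comment> \<open>The mean square grows with the interval, so the lower bound on the first
        interval serves for all n.\<close>
      also have "\<dots> \<le> weighted_square a (bn n) (\<lambda>x. \<phi> x l)"
        unfolding weighted_square_def using incseqD[OF bn_mono, of 0 n]
        by (intro integral_subset_le weighted_square_integrable_on solution_continuous(1)[OF phi_sol] bn_in initial_interval) auto
      finally have "T l n * \<kappa> \<le> T l n * weighted_square a (bn n) (\<lambda>x. \<phi> x l)"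
        by (intro mult_left_mono) (auto simp: T_def)
      also have "\<dots> \<le> C * ((cmod (\<mu> - l))\<^sup>2 * N n)"
        unfolding T_def N_def
        by (rule resolvent_bracket_bound[OF _ _ eig m bn_in]) (use l S C(3) in auto)
      also have "cmod (\<mu> - l) = R" using l(1) by (simp add: dist_norm)
      finally show ?thesis using \<kappa>(2) by (simp add: field_simps)
    qed
    then show ?thesis using C \<kappa> by (intro exI[of _ "min \<rho>1 \<rho>2"] exI[of _ "C * R\<^sup>2 / \<kappa>"]) auto
  qed
  then obtain \<rho> L where L: "\<And>l0. l0 \<in> sphere \<mu> R \<Longrightarrow> 0 < \<rho> l0 \<and> 0 \<le> L l0 \<and>
      (\<forall>l n. l \<in> sphere \<mu> R \<longrightarrow> norm (l - l0) < \<rho> l0 \<longrightarrow> T l n \<le> L l0 * N n)"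
    by metis
  have "sphere \<mu> R \<subseteq> (\<Union>l0\<in>sphere \<mu> R. ball l0 (\<rho> l0))"
    using L by fastforce
  then obtain F where F: "F \<subseteq> sphere \<mu> R" "finite F" "sphere \<mu> R \<subseteq> (\<Union>l0\<in>F. ball l0 (\<rho> l0))"
    by (rule compactE_image[OF compact_sphere, rotated]) auto
  show ?thesis
  proof (intro exI[of _ "sum L F"] ballI allI)
    fix l n assume l: "l \<in> sphere \<mu> R"
    then obtain l0 where l0: "l0 \<in> F" "norm (l - l0) < \<rho> l0"
      using F(3) by (force simp: dist_norm norm_minus_commute)
    then have "T l n \<le> L l0 * N n" using L[of l0] F(1) l by blast
    also have "\<dots> \<le> sum L F * N n"
      using F L N l0 by (intro mult_right_mono member_le_sum) blast+
    finally show "(cmod (sl_bracket (\<lambda>x. \<phi> x \<mu>) (\<lambda>x. \<phi>1 x \<mu>) (\<lambda>x. \<theta> x l + m l * \<phi> x l) (\<lambda>x. \<theta>1 x l + m l * \<phi>1 x l) (bn n)))\<^sup>2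
       \<le> sum L F * N2 (\<lambda>x. if x \<le> bn n then 0 else \<phi> x \<mu>)"
      by (simp add: T_def N_def)
  qed
qed

text \<open>With \<open>m\<^sub>n\<close> in place of \<open>m\<close> the bracket is holomorphic in \<open>l\<close> on the disc unless the boundary form
  vanishes there, and it equals 1 at \<open>\<mu>\<close>; this contradicts the maximum principle as soon as it is small on
  the circle.\<close>

lemma eventually_boundary_zero:
  assumes "0 < R" and S: "sphere \<mu> R \<subseteq> resolvent_set I w bc_op"
    and eig: "bc_op (\<lambda>x. \<phi> x \<mu>) (\<lambda>x. \<mu> * \<phi> x \<mu>)" and m: "\<And>l. \<exists>!z. weyl l z \<Longrightarrow> weyl l (m l)"
    and lim: "uniform_limit (sphere \<mu> R) (\<lambda>n. truncated_m \<theta> \<theta>1 \<phi> \<phi>1 (bn n) (\<beta> n)) m sequentially"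
  shows "\<forall>\<^sub>F n in sequentially. \<exists>l\<in>cball \<mu> R. \<phi> (bn n) l * cos (\<beta> n) + \<phi>1 (bn n) l * sin (\<beta> n) = 0"
proof -
  define B where "B c z l = sl_bracket (\<lambda>x. \<phi> x \<mu>) (\<lambda>x. \<phi>1 x \<mu>) (\<lambda>x. \<theta> x l + z * \<phi> x l) (\<lambda>x. \<theta>1 x l + z * \<phi>1 x l) c" for c z l
  obtain L where L: "\<And>l n. l \<in> sphere \<mu> R \<Longrightarrow> (cmod (B (bn n) (m l) l))\<^sup>2 \<le> L * N2 (\<lambda>x. if x \<le> bn n then 0 else \<phi> x \<mu>)"
    using bracket_uniform_bound[OF S eig m] unfolding B_def by blast
  have muL2: "(\<lambda>x. \<phi> x \<mu>) \<in> L2w I w" using eig by (simp add: bc_op_def)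
  have "(\<lambda>n. L * N2 (\<lambda>x. if x \<le> bn n then 0 else \<phi> x \<mu>)) \<longlonglongrightarrow> L * 0"
    by (intro tendsto_intros N2_tail_tendsto_0 muL2 solution_continuous(1)[OF phi_sol] bn_in)
  then have "\<forall>\<^sub>F n in sequentially. L * N2 (\<lambda>x. if x \<le> bn n then 0 else \<phi> x \<mu>) < 1 / 16"
    by (rule order_tendstoD) simp
  \<comment> \<open>The evaluation point is frozen here, before n varies; otherwise the bound H
    below would change with n. The threshold 1/16 makes the bracket at most 1/4 on the
    circle.\<close>
  then obtain j where j: "L * N2 (\<lambda>x. if x \<le> bn j then 0 else \<phi> x \<mu>) < 1 / 16"
    unfolding eventually_sequentially by blast
  define c where "c = bn j"
  have c: "c \<in> I" "a < c" "c \<in> {a..c}" using bn_in[of j] by (auto simp: c_def less_imp_le)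
  have small: "cmod (B c (m l) l) \<le> 1 / 4" if "l \<in> sphere \<mu> R" for l
  proof -
    have "(cmod (B c (m l) l))\<^sup>2 \<le> (1 / 4)\<^sup>2"
      using L[OF that, of j] j by (simp add: c_def power2_eq_square)
    then show ?thesis by (rule power2_le_imp_le) simp
  qed
  have hol: "\<phi> x holomorphic_on A" "\<phi>1 x holomorphic_on A" "\<theta> x holomorphic_on A" "\<theta>1 x holomorphic_on A"
    if "x \<in> I" for x A
    using that phi_family[OF that] theta_family[OF that] a_least(2)[OF that]
    by (auto intro!: uniformly_differentiable_family_holomorphic[of "{a..x}"])
  define h where "h l = \<phi> c \<mu> * \<phi>1 c l - \<phi>1 c \<mu> * \<phi> c l" for l
  have "continuous_on (sphere \<mu> R) h" unfolding h_def
    by (intro continuous_intros holomorphic_on_imp_continuous_on hol c)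
  then have "bounded (h ` sphere \<mu> R)"
    by (intro compact_imp_bounded compact_continuous_image) auto
  then obtain H where H: "0 < H" "\<And>l. l \<in> sphere \<mu> R \<Longrightarrow> cmod (h l) \<le> H"
    unfolding bounded_pos by auto
  \<comment> \<open>With slope h bounded by H, closeness 1 / (4 H) of the Weyl numbers costs another
    1/4. Together with \<open>small\<close> this leaves 1/2 on the circle, against 1 at the
    centre.\<close>
  have B_diff: "B c z l - B c z' l = (z - z') * h l" for z z' l
    by (simp add: B_def h_def sl_bracket_def algebra_simps)
  have "\<forall>\<^sub>F n in sequentially. \<forall>l\<in>sphere \<mu> R. dist (truncated_m \<theta> \<theta>1 \<phi> \<phi>1 (bn n) (\<beta> n) l) (m l) < 1 / (4 * H)"
    by (rule uniform_limitD[OF lim]) (use H in simp)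
  then show ?thesis
  proof eventually_elim
    fix n assume near: "\<forall>l\<in>sphere \<mu> R. dist (truncated_m \<theta> \<theta>1 \<phi> \<phi>1 (bn n) (\<beta> n) l) (m l) < 1 / (4 * H)"
    define mn where "mn = truncated_m \<theta> \<theta>1 \<phi> \<phi>1 (bn n) (\<beta> n)"
    show "\<exists>l\<in>cball \<mu> R. \<phi> (bn n) l * cos (\<beta> n) + \<phi>1 (bn n) l * sin (\<beta> n) = 0"
    proof (rule ccontr)
      assume nz: "\<not> (\<exists>l\<in>cball \<mu> R. \<phi> (bn n) l * cos (\<beta> n) + \<phi>1 (bn n) l * sin (\<beta> n) = 0)"
      have hol_mn: "mn holomorphic_on cball \<mu> R"
        unfolding mn_def truncated_m_def[abs_def] using nz
        by (intro holomorphic_intros hol bn_in) auto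
      define f where "f l = B c (mn l) l" for l
      have hol_f: "f holomorphic_on cball \<mu> R"
        unfolding f_def B_def sl_bracket_def by (intro holomorphic_intros hol hol_mn c)
      have "norm (f \<mu>) \<le> 1 / 2"
      proof (rule maximum_modulus_frontier[of f "cball \<mu> R"])
        show "f holomorphic_on interior (cball \<mu> R)"
          using hol_f interior_subset holomorphic_on_subset by blast
        show "continuous_on (closure (cball \<mu> R)) f"
          using hol_f by (simp add: holomorphic_on_imp_continuous_on)
        fix l assume "l \<in> frontier (cball \<mu> R)"
        then have l: "l \<in> sphere \<mu> R" using \<open>0 < R\<close> by simp
        have "cmod (f l) \<le> cmod (B c (m l) l) + cmod (B c (mn l) l - B c (m l) l)"
          using norm_triangle_ineq[of "B c (m l) l" "B c (mn l) l - B c (m l) l"] by (simp add: f_def)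
        also have "cmod (B c (mn l) l - B c (m l) l) \<le> 1 / (4 * H) * H"
          unfolding B_diff norm_mult using near l H
          by (intro mult_mono) (auto simp: mn_def dist_norm intro: less_imp_le)
        also have "\<dots> = 1 / 4" using H by simp
        finally show "cmod (f l) \<le> 1 / 2" using small[OF l] by simp
      qed (use \<open>0 < R\<close> in auto)
      moreover have "f \<mu> = 1"
      proof -
        have "f \<mu> = - (\<theta> c \<mu> * \<phi>1 c \<mu> - \<theta>1 c \<mu> * \<phi> c \<mu>)"
          by (simp add: f_def B_def sl_bracket_def algebra_simps)
        then show ?thesis using theta_phi_bracket[OF c(1)] by simp
      qed
      ultimately show False by simp
    qed
  qed
qed

end

text \<open>The inequality 0 \<le> r A + B holds for every r > 0: large r forces A \<ge> 0, and r
  tending to 0 forces B \<ge> 0. The second claim is w B \<ge> 0.\<close>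

lemma admissible_pair_accretive:
  assumes pair: "(\<eta>, K) \<in> admissible_pairs I w p q" and x: "x \<in> I" "0 < w x"
  shows "0 \<le> Re (cis \<eta> * p x)" "0 \<le> Re (cis \<eta> * (q x - K * complex_of_real (w x)))"
proof -
  define A B where "A = Re (cis \<eta> * p x)" and "B = Re (cis \<eta> * (q x / complex_of_real (w x) - K))"
  have *: "0 \<le> r * A + B" if "0 < r" for r
  proof -
    have "0 \<le> Re ((complex_of_real r * p x + q x / complex_of_real (w x) - K) * cis \<eta>)"
      using pair x that unfolding admissible_pairs_def by auto
    also have "(complex_of_real r * p x + q x / complex_of_real (w x) - K) * cis \<eta> =
        complex_of_real r * (cis \<eta> * p x) + cis \<eta> * (q x / complex_of_real (w x) - K)"
      by (simp add: algebra_simps)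
    finally show ?thesis by (simp add: A_def B_def)
  qed
  show "0 \<le> Re (cis \<eta> * p x)"
  proof (rule ccontr)
    assume "\<not> 0 \<le> Re (cis \<eta> * p x)"
    then have "A < 0" by (simp add: A_def)
    have "0 \<le> ((\<bar>B\<bar> + 1) / (- A)) * A + B" using \<open>A < 0\<close> by (intro * divide_pos_pos) auto
    also have "((\<bar>B\<bar> + 1) / (- A)) * A = - (\<bar>B\<bar> + 1)" using \<open>A < 0\<close> by (simp add: field_simps)
    finally show False by linarith
  qed
  then have "0 \<le> A" by (simp add: A_def)
  have "0 \<le> B"
  proof (rule field_le_epsilon)
    fix e :: real assume "0 < e"
    then have "0 \<le> (e / (A + 1)) * A + B" using \<open>0 \<le> A\<close> by (intro *) simp
    also have "(e / (A + 1)) * A \<le> e" using \<open>0 \<le> A\<close> \<open>0 < e\<close> by (simp add: field_simps)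
    finally show "0 \<le> B + e" by linarith
  qed
  have "cis \<eta> * (q x - K * complex_of_real (w x)) = complex_of_real (w x) * (cis \<eta> * (q x / complex_of_real (w x) - K))"
    using x by (simp add: field_simps)
  then have "Re (cis \<eta> * (q x - K * complex_of_real (w x))) = w x * B"
    unfolding B_def by (simp only: Re_complex_of_real times_complex.sel Im_complex_of_real)
  then show "0 \<le> Re (cis \<eta> * (q x - K * complex_of_real (w x)))" using \<open>0 \<le> B\<close> x by simp
qed

lemma vanishes_at_end_lincomb:
  assumes "vanishes_at_end b f" "vanishes_at_end b g"
  shows "vanishes_at_end b (\<lambda>x. A * f x + B * g x)"
  using tendsto_add[OF tendsto_mult_left[OF assms(1)[unfolded vanishes_at_end_def], of A]
      tendsto_mult_left[OF assms(2)[unfolded vanishes_at_end_def], of B]]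
  by (simp add: vanishes_at_end_def o_def)

lemma vanishes_at_end_cong:
  assumes f: "vanishes_at_end b f" and c: "c \<in> half_open a b"
    and eq: "\<And>x. x \<in> half_open a b \<Longrightarrow> c \<le> x \<Longrightarrow> f x = g x"
  shows "vanishes_at_end b g"
proof -
  have cb: "ereal c < b" and ac: "a \<le> c" using c by (auto simp: half_open_def)
  have "\<forall>\<^sub>F t in at_left b. (f \<circ> real_of_ereal) t = (g \<circ> real_of_ereal) t"
    unfolding eventually_at_left[OF cb]
  proof (intro exI[of _ "ereal c"] conjI cb allI impI)
    fix t assume "ereal c < t" "t < b"
    then obtain r where r: "t = ereal r" "c < r" by (cases t) auto
    then show "(f \<circ> real_of_ereal) t = (g \<circ> real_of_ereal) t"
      using eq[of r] \<open>t < b\<close> ac by (simp add: half_open_def)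
  qed
  then show ?thesis
    using f Lim_transform_eventually unfolding vanishes_at_end_def by blast
qed

text \<open>A nearest point need not exist, as the sets are not assumed closed; a point within 1 /
  (n + 1) of the infimum distance does as well. One choice for all accuracies e avoids a diagonal
  argument.\<close>

lemma tendsto_nearest_point:
  fixes x :: "'a::metric_space"
  assumes ne: "\<And>n. S n \<noteq> {}" and near: "\<And>e. 0 < e \<Longrightarrow> \<forall>\<^sub>F n in sequentially. \<exists>s\<in>S n. dist x s \<le> e"
  shows "\<exists>y. (\<forall>n. y n \<in> S n) \<and> y \<longlonglongrightarrow> x"
proof -
  have "\<exists>s\<in>S n. dist x s < infdist x (S n) + 1 / real (Suc n)" for n
  proof (rule ccontr)
    assume "\<not> ?thesis"
    then have "infdist x (S n) + 1 / real (Suc n) \<le> infdist x (S n)"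
      using ne[of n] by (subst (2) infdist_notempty) (auto intro!: cINF_greatest simp: not_less)
    then show False by simp
  qed
  then obtain y where y: "\<And>n. y n \<in> S n" "\<And>n. dist x (y n) < infdist x (S n) + 1 / real (Suc n)"
    by metis
  have "y \<longlonglongrightarrow> x"
  proof (rule tendstoI)
    fix e :: real assume "0 < e"
    then have "\<forall>\<^sub>F n in sequentially. \<exists>s\<in>S n. dist x s \<le> e / 2" by (intro near) simp
    moreover have "\<forall>\<^sub>F n in sequentially. 1 / real (Suc n) < e / 2"
      using order_tendstoD(2)[OF lim_1_over_n[THEN LIMSEQ_Suc], of "e / 2"] \<open>0 < e\<close> by simp
    ultimately show "\<forall>\<^sub>F n in sequentially. dist (y n) x < e"
    proof eventually_elim
      case (elim n)
      then obtain s where "s \<in> S n" "dist x s \<le> e / 2" by blast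
      then have "infdist x (S n) \<le> e / 2" by (meson infdist_le order_trans)
      then show ?case using y(2)[of n] elim by (simp add: dist_commute)
    qed
  qed
  then show ?thesis using y by blast
qed

theorem theorem3p5:
  fixes a :: real and b :: ereal
    and w :: "real \<Rightarrow> real" and p q :: "real \<Rightarrow> complex"
    and \<alpha> :: complex and \<eta> :: real and K :: complex
    and \<theta> \<theta>1 \<phi> \<phi>1 :: "real \<Rightarrow> complex \<Rightarrow> complex"
    and l' :: complex and m :: "complex \<Rightarrow> complex"
    and bn :: "nat \<Rightarrow> real" and \<beta> :: "nat \<Rightarrow> complex"
    and \<mu> :: complex
  defines "I \<equiv> half_open a b"
    and "psi \<equiv> \<lambda>x. \<theta> x l' + m l' * \<phi> x l'"
    and "psi1 \<equiv> \<lambda>x. \<theta>1 x l' + m l' * \<phi>1 x l'"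
  defines "M \<equiv> singular_op a b w p q \<alpha> \<eta> K psi psi1"
    and "Mn \<equiv> \<lambda>n. regular_op a (bn n) w p q \<alpha> (\<beta> n)"
    and "mn \<equiv> \<lambda>n. truncated_m \<theta> \<theta>1 \<phi> \<phi>1 (bn n) (\<beta> n)"
  assumes ab: "ereal a < b"
    and w_pos: "AE x in lebesgue. x \<in> I \<longrightarrow> 0 < w x"
    and p_nz: "AE x in lebesgue. x \<in> I \<longrightarrow> p x \<noteq> 0"
    and w_int: "locally_integrable I w"
    and p_int: "locally_integrable I (\<lambda>x. 1 / p x)"
    and q_int: "locally_integrable I q"
    and Q_proper: "range_hull I w p q \<noteq> UNIV"
    and b_singular: "b = \<infinity> \<or> \<not> set_integrable lebesgue I (\<lambda>x. w x + 1 / cmod (p x) + cmod (q x))"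
    and pair: "(\<eta>, K) \<in> admissible_pairs_bc I w p q \<alpha>"
    and theta_sol: "\<And>l. sl_solution w p q I l (\<lambda>x. \<theta> x l) (\<lambda>x. \<theta>1 x l)"
    and theta_init: "\<And>l. \<theta> a l = cos \<alpha>" "\<And>l. \<theta>1 a l = sin \<alpha>"
    and phi_sol: "\<And>l. sl_solution w p q I l (\<lambda>x. \<phi> x l) (\<lambda>x. \<phi>1 x l)"
    and phi_init: "\<And>l. \<phi> a l = sin \<alpha>" "\<And>l. \<phi>1 a l = - cos \<alpha>"
    and l'_in: "l' \<in> Lambda_plane \<eta> K"
    and m_weyl: "titchmarsh_weyl a b w p q \<eta> K psi psi1 \<theta> \<theta>1 \<phi> \<phi>1 m"
    and bn_inner: "\<And>n. a < bn n" "\<And>n. ereal (bn n) < b"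
    and bn_mono: "incseq bn"
    and bn_lim: "(\<lambda>n. ereal (bn n)) \<longlonglongrightarrow> b"
    and mu: "isolated_eigenvalue I w M \<mu>"
    and conv: "\<And>r R. 0 < r \<Longrightarrow> r < R \<Longrightarrow> cball \<mu> R \<inter> op_spectrum I w M \<subseteq> {\<mu>} \<Longrightarrow>
                 uniform_limit (cball \<mu> R - ball \<mu> r) mn m sequentially"
  shows "\<exists>lam :: nat \<Rightarrow> complex.
           (\<forall>n. lam n \<in> op_spectrum {a..bn n} w (Mn n)) \<and> lam \<longlonglongrightarrow> \<mu>"
proof -
  have I_iff: "x \<in> I \<longleftrightarrow> a \<le> x \<and> ereal x < b" for x
    by (simp add: I_def half_open_def)
  have I_interval: "is_interval I"
    unfolding is_interval_1 Ball_def I_iff by (meson ereal_less_eq(3) order_trans order_le_less_trans)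
  \<comment> \<open>In Case I the implication is vacuous, so \<open>D\<close> holds for every pair
    and a single argument covers all three cases.\<close>
  define D where "D y u \<longleftrightarrow> (sims_case2 I w p q \<eta> K \<or> sims_case3 I w p q \<eta> K \<longrightarrow>
      vanishes_at_end b (sl_bracket y u psi psi1))" for y u
  interpret sl_operator w p q I a \<alpha> \<theta> \<theta>1 \<phi> \<phi>1 bn D
  proof
    show "a \<in> I" using ab by (simp add: I_iff)
    show "a \<le> x" if "x \<in> I" for x using that by (simp add: I_iff)
    show "bn n \<in> I" for n using bn_inner[of n] by (simp add: I_iff)
    show "\<exists>n. x \<le> bn n" if "x \<in> I" for x
    proof -
      have "\<forall>\<^sub>F n in sequentially. ereal x < ereal (bn n)"
        using order_tendstoD(1)[OF bn_lim, of "ereal x"] that unfolding I_iff by blast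
      then show ?thesis unfolding eventually_sequentially by (auto intro: less_imp_le)
    qed
    show "D (\<lambda>x. A * y x + B * z x) (\<lambda>x. A * u x + B * v x)" if "D y u" "D z v" for y u z v A B
    proof -
      have "sl_bracket (\<lambda>x. A * y x + B * z x) (\<lambda>x. A * u x + B * v x) psi psi1 =
          (\<lambda>x. A * sl_bracket y u psi psi1 x + B * sl_bracket z v psi psi1 x)"
        by (simp add: sl_bracket_def fun_eq_iff algebra_simps)
      then show ?thesis using that vanishes_at_end_lincomb by (simp add: D_def)
    qed
    show "D z v" if "D y u" "c \<in> I" "\<And>x. x \<in> I \<Longrightarrow> c \<le> x \<Longrightarrow> y x = z x \<and> u x = v x" for y u z v c
    proof -
      have "vanishes_at_end b (sl_bracket z v psi psi1)" if "vanishes_at_end b (sl_bracket y u psi psi1)"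
        using that \<open>c \<in> I\<close>[unfolded I_def]
        by (rule vanishes_at_end_cong)
           (use \<open>\<And>x. x \<in> I \<Longrightarrow> c \<le> x \<Longrightarrow> y x = z x \<and> u x = v x\<close> in \<open>simp add: I_def sl_bracket_def\<close>)
      then show ?thesis using \<open>D y u\<close> by (simp add: D_def)
    qed
  qed (fact w_pos p_nz w_int p_int q_int I_interval theta_sol theta_init phi_sol phi_init bn_inner bn_mono)+
  have M_eq: "M = bc_op"
    unfolding M_def bc_op_def[abs_def] singular_op_def[abs_def] D_def unfolding I_def ..
  define S where "S n = op_spectrum {a..bn n} w (Mn n)" for n
  have zero_S: "l \<in> S n" if "\<phi> (bn n) l * cos (\<beta> n) + \<phi>1 (bn n) l * sin (\<beta> n) = 0" for l n
    unfolding S_def Mn_def by (rule boundary_zero_in_spectrum[OF bn_in that])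
  have adm: "(\<eta>, K) \<in> admissible_pairs I w p q"
    using pair by (auto simp: admissible_pairs_bc_def)
  have "AE x in lebesgue. x \<in> I \<longrightarrow>
      0 \<le> Re (cis \<eta> * p x) \<and> 0 \<le> Re (cis \<eta> * (q x - K * complex_of_real (w x)))"
    using w_pos by (rule eventually_mono) (use admissible_pair_accretive[OF adm] in blast)
  then have S_nonempty: "S n \<noteq> {}" for n
    using boundary_form_has_zero[OF _ bn_in] zero_S by blast
  have eig: "bc_op (\<lambda>x. \<phi> x \<mu>) (\<lambda>x. \<mu> * \<phi> x \<mu>)"
    using mu unfolding isolated_eigenvalue_def M_eq by (intro eigenvalue_phi) blast
  have weyl_eq: "weyl_number a b w p q \<eta> K psi psi1 \<theta> \<theta>1 \<phi> \<phi>1 l z \<longleftrightarrow> weyl l z" for l z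
    unfolding weyl_number_def weyl_def D_def unfolding I_def ..
  have weyl: "weyl l (m l)" if "\<exists>!z. weyl l z" for l
    using m_weyl that unfolding titchmarsh_weyl_def weyl_eq by blast
  obtain T where T: "open T" "T \<inter> op_spectrum I w bc_op = {\<mu>}"
    using mu unfolding isolated_eigenvalue_def isolated_in_def M_eq by blast
  then obtain R0 where R0: "0 < R0" "cball \<mu> R0 \<subseteq> T"
    using open_contains_cball[of T] by blast
  have near: "\<forall>\<^sub>F n in sequentially. \<exists>l\<in>S n. dist \<mu> l \<le> e" if "0 < e" for e
  proof -
    \<comment> \<open>R0 keeps the disc free of spectrum other than \<mu>, which puts its boundary
      circle into the resolvent set; e is the required accuracy.\<close>
    define R where "R = min R0 e"
    have R: "0 < R" "R \<le> e" using R0 that by (auto simp: R_def)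
    have "cball \<mu> R \<subseteq> T" using R0(2) by (auto simp: R_def)
    then have isol: "cball \<mu> R \<inter> op_spectrum I w bc_op \<subseteq> {\<mu>}" using T(2) by blast
    have sphere: "sphere \<mu> R \<subseteq> resolvent_set I w bc_op"
    proof
      fix l assume "l \<in> sphere \<mu> R"
      then have "l \<in> cball \<mu> R" "l \<noteq> \<mu>" using R by auto
      then show "l \<in> resolvent_set I w bc_op" using isol by (auto simp: op_spectrum_def)
    qed
    have "uniform_limit (cball \<mu> R - ball \<mu> (R / 2)) mn m sequentially"
      using conv[of "R / 2" R] R isol by (simp add: M_eq)
    \<comment> \<open>The circle of radius R is the outer edge of the annulus; the inner radius R /
      2 is an arbitrary choice.\<close>
    then have lim: "uniform_limit (sphere \<mu> R) mn m sequentially"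
      by (rule uniform_limit_on_subset) (use R in auto)
    have "\<forall>\<^sub>F n in sequentially. \<exists>l\<in>cball \<mu> R. \<phi> (bn n) l * cos (\<beta> n) + \<phi>1 (bn n) l * sin (\<beta> n) = 0"
      by (rule eventually_boundary_zero[OF R(1) sphere eig _ lim[unfolded mn_def]]) (rule weyl)
    then show ?thesis
      by (rule eventually_mono) (use zero_S R(2) in force)
  qed
  show ?thesis
    using tendsto_nearest_point[OF S_nonempty near] unfolding S_def .
qed

end
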